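(* Let $M$ be a compact orientable connected manifold with boundary $\partial M$, $\dim M=n$, let $U$ be a topological space, and let $f:M\times U\to M$ be a map with $f(\partial M\times U)\subset\partial M$. Let $U'=\{u\in U: f(x,u)\in\partial M\text{ for all }x\in M\}$, so that $f:(M,\partial M)\times(U,U')\to(M,\partial M)$ is a map of pairs. Let $L\subset M$, $L'=L\cap\partial M$, and let $f':(L,L')\times(U,U')\to(M,\partial M)$ be the restriction of $f$. Suppose that there are $r\ge 0$, $a_0\in H_p(L,L')$ and $v_0\in H_{s_0}(U,U'),\dots,v_r\in H_{s_r}(U,U')$ such that $$a_1=f'_*(a_0\otimes v_0),\quad a_2=f_*(a_1\otimes v_1),\ \dots,\quad a_{r+1}=f_*(a_r\otimes v_r)\in H_n(M,\partial M)\setminus\{0\}.$$ Then the discrete time system $D_f$ is strongly robustly controllable from $L$.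
   Context: "Map" means continuous map. Homology is singular with coefficients in $\mathbf{Q}$. The boundary $\partial M$ may be empty. The product of pairs is $(X,A)\times(Y,B)=(X\times Y,\,A\times Y\cup X\times B)$, and $a\otimes v$ denotes the element of the homology of the product of pairs corresponding to $a\otimes v$ under the Künneth theorem (cross product). A discrete time control system $D_f$ is given by a map $f:M\times U\to M$, with $U$ the space of inputs and $M$ the space of states. Definition. $D_f$ is strongly robustly controllable from $L$ if there is $r\ge0$ such that for any map $f_0$ homotopic to $f'$, any maps $f_1,\dots,f_r$ homotopic to $f$ (homotopies being homotopies of maps of pairs $(L,L')\times(U,U')\to(M,\partial M)$ and $(M,\partial M)\times(U,U')\to(M,\partial M)$, respectively), and for each $y\in M$ there is $x\in L$ and there are inputs $u_0,\dots,u_r\in U$ such that $$x_1=f_0(x,u_0),\ x_2=f_1(x_1,u_1),\ \dots,\ y=x_{r+1}=f_r(x_r,u_r).$$ *)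

theory Defs
  imports "HOL-Analysis.Analysis" "HOL-Homology.Homology" "HOL-Algebra.Generated_Groups"
begin

section \<open>Singular homology of pairs with rational coefficients\<close>

text \<open>
  HOL-Homology provides singular homology with integer coefficients only. The definitions
  below repeat its construction with chains in \<open>'s \<Rightarrow>\<^sub>0 rat\<close>, on the same singular simplices
  and faces (in particular, simplices are extensional on the standard simplex).
\<close>

type_synonym 'a qchain = "((nat \<Rightarrow> real) \<Rightarrow> 'a) \<Rightarrow>\<^sub>0 rat"

definition qextend :: "('s \<Rightarrow> 't \<Rightarrow>\<^sub>0 rat) \<Rightarrow> ('s \<Rightarrow>\<^sub>0 rat) \<Rightarrow> ('t \<Rightarrow>\<^sub>0 rat)"
  where "qextend b c =
    (\<Sum>\<sigma>\<in>Poly_Mapping.keys c. Poly_Mapping.map ((*) (Poly_Mapping.lookup c \<sigma>)) (b \<sigma>))"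

definition qsingular_chain :: "nat \<Rightarrow> 'a topology \<Rightarrow> 'a qchain \<Rightarrow> bool"
  where "qsingular_chain p X c \<longleftrightarrow> Poly_Mapping.keys c \<subseteq> singular_simplex_set p X"

definition qchain_boundary :: "nat \<Rightarrow> 'a qchain \<Rightarrow> 'a qchain"
  where "qchain_boundary p c =
    (if p = 0 then 0
     else qextend (\<lambda>\<sigma>. \<Sum>k\<le>p. Poly_Mapping.single (singular_face p k \<sigma>) ((-1) ^ k)) c)"

definition qrelcycle :: "nat \<Rightarrow> 'a topology \<Rightarrow> 'a set \<Rightarrow> 'a qchain \<Rightarrow> bool"
  where "qrelcycle p X A c \<longleftrightarrow>
    qsingular_chain p X c \<and> qsingular_chain (p - 1) (subtopology X A) (qchain_boundary p c)"

definition qrelboundary :: "nat \<Rightarrow> 'a topology \<Rightarrow> 'a set \<Rightarrow> 'a qchain \<Rightarrow> bool"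
  where "qrelboundary p X A c \<longleftrightarrow>
    (\<exists>d. qsingular_chain (Suc p) X d \<and>
         qsingular_chain p (subtopology X A) (qchain_boundary (Suc p) d - c))"

definition qrelcycle_group :: "nat \<Rightarrow> 'a topology \<Rightarrow> 'a set \<Rightarrow> 'a qchain monoid"
  where "qrelcycle_group p X A = \<lparr>carrier = Collect (qrelcycle p X A), mult = (+), one = 0\<rparr>"

text \<open>\<open>H\<^sub>p(X,A;\<rat>)\<close>, as an abelian group whose elements are cosets of relative cycles. The scalar
  multiplication by rationals is not recorded.\<close>

definition qhomology :: "nat \<Rightarrow> 'a topology \<Rightarrow> 'a set \<Rightarrow> 'a qchain set monoid"
  where "qhomology p X A = qrelcycle_group p X A Mod Collect (qrelboundary p X A)"

definition qhomology_class :: "nat \<Rightarrow> 'a topology \<Rightarrow> 'a set \<Rightarrow> 'a qchain \<Rightarrow> 'a qchain set"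
  where "qhomology_class p X A c =
    Collect (qrelboundary p X A) #>\<^bsub>qrelcycle_group p X A\<^esub> c"

definition qchain_map :: "nat \<Rightarrow> ('a \<Rightarrow> 'b) \<Rightarrow> 'a qchain \<Rightarrow> 'b qchain"
  where "qchain_map p g = qextend (\<lambda>\<sigma>. Poly_Mapping.single (simplex_map p g \<sigma>) 1)"

text \<open>The map \<open>H\<^sub>p(X,A;\<rat>) \<rightarrow> H\<^sub>p(Y,B;\<rat>)\<close> induced by a map of pairs \<open>g\<close>. The class of the image does
  not depend on the representative, so the union is over equal cosets.\<close>

definition qhom_induced ::
    "nat \<Rightarrow> 'b topology \<Rightarrow> 'b set \<Rightarrow> ('a \<Rightarrow> 'b) \<Rightarrow> 'a qchain set \<Rightarrow> 'b qchain set"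
  where "qhom_induced p Y B g \<alpha> = (\<Union>c\<in>\<alpha>. qhomology_class p Y B (qchain_map p g c))"


section \<open>The homology cross product\<close>

text \<open>The subspace in the product of pairs \<open>(X,A) \<times> (Y,B) = (X \<times> Y, A \<times> Y \<union> X \<times> B)\<close>.\<close>

definition prod_pair :: "'a topology \<Rightarrow> 'a set \<Rightarrow> 'b topology \<Rightarrow> 'b set \<Rightarrow> ('a \<times> 'b) set"
  where "prod_pair X A Y B = A \<times> topspace Y \<union> topspace X \<times> B"

text \<open>
  On chains, the cross product is the Eilenberg--Zilber shuffle map. A \<open>(p,q)\<close>-shuffle is given by
  the set \<open>S \<subseteq> {..<p+q}\<close>, of cardinality \<open>p\<close>, of the steps in the first direction of the lattice
  path from \<open>(0,0)\<close> to \<open>(p,q)\<close>. The simplex of \<open>\<Delta>\<^sup>p \<times> \<Delta>\<^sup>q\<close> belonging to it has as \<open>k\<close>-th vertex the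
  pair of vertices indexed by the \<open>k\<close>-th point of the path; its sign is that of the shuffle
  permutation listing \<open>S\<close> and then its complement, both in increasing order.
\<close>

definition shuffles_of :: "nat \<Rightarrow> nat \<Rightarrow> nat set set"
  where "shuffles_of p q = {S. S \<subseteq> {..<p + q} \<and> card S = p}"

definition shuffle_sign :: "nat \<Rightarrow> nat \<Rightarrow> nat set \<Rightarrow> rat"
  where "shuffle_sign p q S = (-1) ^ card {(a, b). a \<in> S \<and> b \<in> {..<p + q} - S \<and> b < a}"

definition vertex_map_simplex :: "nat \<Rightarrow> (nat \<Rightarrow> nat) \<Rightarrow> (nat \<Rightarrow> real) \<Rightarrow> (nat \<Rightarrow> real)"
  where "vertex_map_simplex m h = oriented_simplex m (\<lambda>k i. if i = h k then 1 else 0)"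

definition shuffle_simplex ::
    "nat \<Rightarrow> nat \<Rightarrow> ((nat \<Rightarrow> real) \<Rightarrow> 'a) \<Rightarrow> ((nat \<Rightarrow> real) \<Rightarrow> 'b) \<Rightarrow> nat set \<Rightarrow> (nat \<Rightarrow> real) \<Rightarrow> 'a \<times> 'b"
  where "shuffle_simplex p q \<sigma> \<tau> S =
    (\<lambda>t\<in>standard_simplex (p + q).
       (\<sigma> (vertex_map_simplex (p + q) (\<lambda>k. card (S \<inter> {..<k})) t),
        \<tau> (vertex_map_simplex (p + q) (\<lambda>k. card ({..<k} - S)) t)))"

definition qchain_cross :: "nat \<Rightarrow> nat \<Rightarrow> 'a qchain \<Rightarrow> 'b qchain \<Rightarrow> ('a \<times> 'b) qchain"
  where "qchain_cross p q c d =
    qextend (\<lambda>\<sigma>. qextend (\<lambda>\<tau>.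
      \<Sum>S\<in>shuffles_of p q. Poly_Mapping.single (shuffle_simplex p q \<sigma> \<tau> S) (shuffle_sign p q S)) d) c"

text \<open>\<open>\<alpha> \<otimes> \<beta> \<in> H\<^sub>p\<^sub>+\<^sub>q((X,A) \<times> (Y,B);\<rat>)\<close> for \<open>\<alpha> \<in> H\<^sub>p(X,A;\<rat>)\<close>, \<open>\<beta> \<in> H\<^sub>q(Y,B;\<rat>)\<close>; again a union of equal
  cosets.\<close>

definition qcross ::
    "nat \<Rightarrow> 'a topology \<Rightarrow> 'a set \<Rightarrow> nat \<Rightarrow> 'b topology \<Rightarrow> 'b set
     \<Rightarrow> 'a qchain set \<Rightarrow> 'b qchain set \<Rightarrow> ('a \<times> 'b) qchain set"
  where "qcross p X A q Y B \<alpha> \<beta> =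
    (\<Union>c\<in>\<alpha>. \<Union>d\<in>\<beta>.
       qhomology_class (p + q) (prod_topology X Y) (prod_pair X A Y B) (qchain_cross p q c d))"


section \<open>Topological manifolds with boundary\<close>

text \<open>For \<open>n = 0\<close> the condition on \<open>x 0\<close> is void, so the half space is a point.\<close>

definition half_space :: "nat \<Rightarrow> (nat \<Rightarrow> real) topology"
  where "half_space n = subtopology (Euclidean_space n) {x. 0 \<le> x 0}"

definition manifold_with_boundary :: "nat \<Rightarrow> 'a topology \<Rightarrow> bool"
  where "manifold_with_boundary n M \<longleftrightarrow>
    Hausdorff_space M \<and> second_countable M \<and>
    (\<forall>x\<in>topspace M. \<exists>W V. openin M W \<and> x \<in> W \<and> openin (half_space n) V \<and>
       subtopology M W homeomorphic_space subtopology (half_space n) V)"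

definition manifold_interior :: "nat \<Rightarrow> 'a topology \<Rightarrow> 'a set"
  where "manifold_interior n M =
    {x. \<exists>W V. openin M W \<and> x \<in> W \<and> openin (Euclidean_space n) V \<and>
          subtopology M W homeomorphic_space subtopology (Euclidean_space n) V}"

definition manifold_boundary :: "nat \<Rightarrow> 'a topology \<Rightarrow> 'a set"
  where "manifold_boundary n M = topspace M - manifold_interior n M"

text \<open>\<open>M\<close> is orientable if its interior \<open>N\<close> is: there is a choice of generators \<open>\<mu> x\<close> of the infinite
  cyclic groups \<open>H\<^sub>n(N, N - {x}; \<int>)\<close> that is locally induced by classes in \<open>H\<^sub>n(N, N - B; \<int>)\<close>.\<close>

definition local_orientation :: "nat \<Rightarrow> 'a topology \<Rightarrow> 'a \<Rightarrow> 'a chain set \<Rightarrow> bool"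
  where "local_orientation n N x \<mu> \<longleftrightarrow>
    (let H = relative_homology_group (int n) N (topspace N - {x})
     in \<mu> \<in> carrier H \<and> generate H {\<mu>} = carrier H)"

definition orientable_manifold :: "nat \<Rightarrow> 'a topology \<Rightarrow> bool"
  where "orientable_manifold n M \<longleftrightarrow>
    (let N = subtopology M (manifold_interior n M) in
     \<exists>\<mu>. (\<forall>x\<in>topspace N. local_orientation n N x (\<mu> x)) \<and>
         (\<forall>x\<in>topspace N. \<exists>B. openin N B \<and> x \<in> B \<and>
            (\<exists>\<beta>\<in>carrier (relative_homology_group (int n) N (topspace N - B)).
               \<forall>y\<in>B. hom_induced (int n) N (topspace N - B) N (topspace N - {y}) id \<beta> = \<mu> y)))"


section \<open>Control systems\<close>

definition boundary_inputs :: "nat \<Rightarrow> 'm topology \<Rightarrow> 'u topology \<Rightarrow> ('m \<times> 'u \<Rightarrow> 'm) \<Rightarrow> 'u set"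
  where "boundary_inputs n M U f =
    {u \<in> topspace U. \<forall>x\<in>topspace M. f (x, u) \<in> manifold_boundary n M}"

definition homotopic_pair_maps ::
    "'a topology \<Rightarrow> 'a set \<Rightarrow> 'b topology \<Rightarrow> 'b set \<Rightarrow> ('a \<Rightarrow> 'b) \<Rightarrow> ('a \<Rightarrow> 'b) \<Rightarrow> bool"
  where "homotopic_pair_maps X A Y B = homotopic_with (\<lambda>h. h \<in> A \<rightarrow> B) X Y"

text \<open>In the homotopy condition on \<open>F 0\<close>, the function \<open>f\<close> on \<open>L \<times> U\<close> plays the role of its
  restriction \<open>f'\<close>.\<close>

definition strongly_robustly_controllable ::
    "nat \<Rightarrow> 'm topology \<Rightarrow> 'u topology \<Rightarrow> ('m \<times> 'u \<Rightarrow> 'm) \<Rightarrow> 'm set \<Rightarrow> bool"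
  where "strongly_robustly_controllable n M U f L \<longleftrightarrow>
    (let dM = manifold_boundary n M; U' = boundary_inputs n M U f; ML = subtopology M L in
     \<exists>r::nat. \<forall>F :: nat \<Rightarrow> 'm \<times> 'u \<Rightarrow> 'm.
       homotopic_pair_maps (prod_topology ML U) (prod_pair ML (L \<inter> dM) U U') M dM (F 0) f \<and>
       (\<forall>i\<in>{1..r}. homotopic_pair_maps (prod_topology M U) (prod_pair M dM U U') M dM (F i) f)
       \<longrightarrow> (\<forall>y\<in>topspace M. \<exists>(x :: nat \<Rightarrow> 'm) (u :: nat \<Rightarrow> 'u).
              x 0 \<in> L \<and> (\<forall>i\<le>r. u i \<in> topspace U \<and> x (Suc i) = F i (x i, u i)) \<and> x (Suc r) = y))"

end

theory Submission
  imports Defs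
begin

text \<open>
  Represent \<open>a 0\<close> and the \<open>v i\<close> by relative cycles and replace \<open>f\<close> in the \<open>i\<close>-th step by the homotopic
  map \<open>F i\<close>. By the Leibniz rule the cross products are relative cycles, so homotopy invariance shows
  that the resulting cycle still represents \<open>a (Suc r)\<close>; its simplices lie in the set of states that
  are reachable in \<open>r + 1\<close> steps. If some \<open>y\<close> were not reachable, the non-zero class \<open>a (Suc r)\<close> of top
  degree would be represented by a cycle that avoids \<open>y\<close>. This is impossible: with an open collar
  attached to its boundary, \<open>M\<close> becomes a compact connected subset of a manifold \<open>N\<close> without boundary,
  and a class in \<open>H\<^sub>n(N, N - M)\<close> that restricts to zero at one point of \<open>M\<close> does so at all points, hence
  vanishes by a Mayer--Vietoris argument. Rational chains become integral ones after multiplication by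
  a common denominator, so the topological part is carried out with integer coefficients.
\<close>

section \<open>Detecting relative homology classes at points\<close>

text \<open>Two notions of detection are combined because neither suffices alone. Detection at one
  point is lost under disjoint unions. Detection at all points is stable under unions only together
  with vanishing in degrees above \<open>n\<close>, since Mayer-Vietoris in degree \<open>i\<close>
  consumes degree \<open>i + 1\<close> of the intersection. One point suffices for boxes, by an
  explicit dilation, and connectedness later passes from one point to all. The collar is forced by
  the boundary: a boundary point sees no relative homology in top degree, and the comparison with
  Euclidean space wants a Euclidean neighbourhood at every point. The unions in
  \<open>qcross\<close> and \<open>qhom_induced\<close> are used through membership: the cycle built
  from chosen representatives lies in them, so one explicit chain is followed from step to step.
  That \<open>a (Suc r)\<close> is a single coset is an assumption. The shuffle signs in the Leibniz
  rule are handled by a recursion on the first step of a lattice path instead of a matching of the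
  faces of individual shuffles.\<close>

lemma singular_relcycle_mono:
  assumes "singular_relcycle p X S c" and "S \<subseteq> T"
  shows "singular_relcycle p X T c"
  using assms singular_chain_mono unfolding singular_relcycle by blast

lemma singular_relboundary_mono:
  assumes "singular_relboundary p X S c" and "S \<subseteq> T"
  shows "singular_relboundary p X T c"
  using assms singular_chain_mono unfolding singular_relboundary by blast

lemma singular_chain_subtopology_Int:
  assumes "singular_chain p (subtopology X S) c" and "singular_chain p (subtopology X T) c"
  shows "singular_chain p (subtopology X (S \<inter> T)) c"
  using assms by (auto simp: singular_chain_subtopology)

lemma singular_chain_iterated_subdivision:
  assumes "singular_chain p X c"
  shows "singular_chain p X ((singular_subdivision p ^^ m) c)"
  by (induction m) (auto simp: assms singular_chain_singular_subdivision)

text \<open>Relative Mayer--Vietoris on chains: the kernel of \<open>H\<^sub>p(X, U \<inter> V) \<rightarrow> H\<^sub>p(X, U) \<oplus> H\<^sub>p(X, V)\<close> comes from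
  \<open>H\<^sub>p\<^sub>+\<^sub>1(X, U \<union> V)\<close>.\<close>

lemma relboundary_Int_of_relboundaries:
  assumes "openin X U" and "openin X V"
    and zU: "singular_relboundary p X U z" and zV: "singular_relboundary p X V z"
    and van: "\<And>w. singular_relcycle (Suc p) X (U \<union> V) w \<Longrightarrow> singular_relboundary (Suc p) X (U \<union> V) w"
  shows "singular_relboundary p X (U \<inter> V) z"
proof -
  obtain x u where x: "singular_chain (Suc p) X x" and u: "singular_chain p (subtopology X U) u"
    and xu: "chain_boundary (Suc p) x + u = z"
    using zU unfolding singular_relboundary by blast
  obtain y v where y: "singular_chain (Suc p) X y" and v: "singular_chain p (subtopology X V) v"
    and yv: "chain_boundary (Suc p) y + v = z"
    using zV unfolding singular_relboundary by blast
  let ?W = "subtopology X (U \<union> V)"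
  have uW: "singular_chain p ?W u" and vW: "singular_chain p ?W v"
    using u v singular_chain_mono by blast+
  have dxy: "chain_boundary (Suc p) (x - y) = v - u"
    unfolding chain_boundary_diff using xu yv by (simp add: algebra_simps)
  \<comment> \<open>The two bounding chains differ by a relative cycle modulo the union. The
    vanishing hypothesis reduces their difference to \<open>t\<close>, which lies in the union but
    not yet in pieces inside \<open>U\<close> or \<open>V\<close>.\<close>
  have "singular_relcycle (Suc p) X (U \<union> V) (x - y)"
    by (simp add: singular_relcycle dxy singular_chain_diff x y uW vW)
  then obtain q t where q: "singular_chain (Suc (Suc p)) X q" and t: "singular_chain (Suc p) ?W t"
    and qt: "chain_boundary (Suc (Suc p)) q + t = x - y"
    using van unfolding singular_relboundary by blast
  have dt: "chain_boundary (Suc p) t = v - u"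
    using dxy chain_boundary_boundary_alt[OF q] unfolding qt[symmetric] chain_boundary_add by simp
  obtain m where m: "\<And>f. f \<in> Poly_Mapping.keys ((singular_subdivision (Suc p) ^^ m) t)
      \<Longrightarrow> \<exists>Q\<in>{U, V}. f \<in> standard_simplex (Suc p) \<rightarrow> Q"
  proof (rule sufficient_iterated_singular_subdivision_exists[of "{U, V}" ?W "Suc p" t])
    show "openin ?W Q" if "Q \<in> {U, V}" for Q
      using that assms(1,2) by (auto simp: openin_subtopology)
  qed (use t in auto)
  obtain h where h: "\<And>p. h p 0 = (0 :: 'a chain)"
        "\<And>p c1 c2. h p (c1-c2) = h p c1 - h p c2"
        "\<And>p X c. singular_chain p X c \<Longrightarrow> singular_chain (Suc p) X (h p c)"
        "\<And>p X c. singular_chain p X c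
                 \<Longrightarrow> chain_boundary (Suc p) (h p c) + h (p - Suc 0) (chain_boundary p c)
                   = (singular_subdivision p ^^ m) c - c"
    using chain_homotopic_iterated_singular_subdivision[of m] by blast
  let ?t = "(singular_subdivision (Suc p) ^^ m) t"
  have "singular_chain (Suc p) ?W ?t"
    by (rule singular_chain_iterated_subdivision[OF t])
  then have key: "f ` standard_simplex (Suc p) \<subseteq> U \<or> f ` standard_simplex (Suc p) \<subseteq> V"
    "singular_simplex (Suc p) X f" if "f \<in> Poly_Mapping.keys ?t" for f
    using m[OF that] that by (auto simp: singular_chain_def singular_simplex_subtopology image_subset_iff Pi_iff)
  have "Poly_Mapping.keys ?t \<subseteq> singular_simplex_set (Suc p) (subtopology X U)
      \<union> singular_simplex_set (Suc p) (subtopology X V)"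
    unfolding singular_simplex_subtopology using key by blast
  then obtain tU tV where tU: "singular_chain (Suc p) (subtopology X U) tU"
    and tV: "singular_chain (Suc p) (subtopology X V) tV" and tt: "tU + tV = ?t"
    unfolding singular_chain_def using frag_split by metis
  let ?b = "chain_boundary (Suc p)"
  have "?t - t = chain_boundary (Suc (Suc p)) (h (Suc p) t) + (h p v - h p u)"
    using h(4)[OF t] by (simp add: dt h(2))
  then have "?t = t + chain_boundary (Suc (Suc p)) (h (Suc p) t) + (h p v - h p u)"
    by (simp add: algebra_simps)
  moreover have "?b (chain_boundary (Suc (Suc p)) (h (Suc p) t)) = 0"
    using chain_boundary_boundary_alt[OF h(3)[OF t]] .
  ultimately have "?b tU + ?b tV = v - u + (?b (h p v) - ?b (h p u))"
    unfolding chain_boundary_add[symmetric] tt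
    by (simp add: chain_boundary_add chain_boundary_diff dt)
  \<comment> \<open>The left side is a chain in \<open>U\<close>, the right side one in
    \<open>V\<close>, so their common value lies in \<open>U \<inter> V\<close>. It is what remains
    of \<open>z\<close> after \<open>x\<close> is corrected to
    \<open>x - tU - h p u\<close>.\<close>
  then have e: "?b tU + u + ?b (h p u) = v + ?b (h p v) - ?b tV"
    by (simp add: algebra_simps)
  have eU: "singular_chain p (subtopology X U) (?b tU + u + ?b (h p u))"
    using tU u h(3)[OF u] by (intro singular_chain_add singular_chain_boundary_alt)
  have eV: "singular_chain p (subtopology X V) (?b tU + u + ?b (h p u))"
    unfolding e using tV v h(3)[OF v] by (intro singular_chain_add singular_chain_diff singular_chain_boundary_alt)
  have sX: "singular_chain q X c" if "singular_chain q (subtopology X S) c" for q S c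
    using that by (simp add: singular_chain_subtopology)
  have "singular_chain (Suc p) X (x - tU - h p u)"
    using x sX[OF tU] sX[OF h(3)[OF u]] by (intro singular_chain_diff)
  moreover have "?b (x - tU - h p u) + (?b tU + u + ?b (h p u)) = z"
    unfolding xu[symmetric] chain_boundary_diff by simp
  ultimately show ?thesis
    using singular_chain_subtopology_Int[OF eU eV] unfolding singular_relboundary by blast
qed

section \<open>Excision for open subspaces\<close>

text \<open>With \<open>W\<close> open and \<open>K\<close> closed, the complement of
  \<open>W\<close> is a closed set inside the open set \<open>topspace X - K\<close>. Excising it
  leaves the pair of \<open>W\<close> and \<open>W - K\<close>; this is the surjective half of
  excision.\<close>

lemma excision_relcycle_exists:
  assumes W: "openin X W" and K: "closedin X K" "K \<subseteq> W"
    and z: "singular_relcycle p X (topspace X - K) z"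
  obtains z' where "singular_relcycle p (subtopology X W) (W - K) z'"
    "homologous_rel p X (topspace X - K) z z'"
proof -
  have "X closure_of (topspace X - W) = topspace X - W"
    using W by (simp add: closure_of_closedin closedin_diff)
  moreover have "X interior_of (topspace X - K) = topspace X - K"
    using K by (simp add: interior_of_openin openin_diff)
  ultimately have "X closure_of (topspace X - W) \<subseteq> X interior_of (topspace X - K)"
    using K by blast
  then obtain c' where
    "singular_relcycle p (subtopology X (topspace X - (topspace X - W))) (topspace X - K - (topspace X - W)) c'"
    "homologous_rel p (subtopology X (topspace X)) (topspace X - K) z c'"
    using excised_relcycle_exists[of X "topspace X - W" "topspace X - K" "topspace X" p z] z by auto
  moreover have "topspace X - (topspace X - W) = W" "topspace X - K - (topspace X - W) = W - K"
    using openin_subset[OF W] by auto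
  ultimately show ?thesis
    using that by (simp add: subtopology_topspace)
qed

lemma singular_relcycle_subtopology_imp:
  assumes "singular_relcycle p (subtopology X W) S z" "S \<subseteq> W"
  shows "singular_relcycle p X S z"
  using assms by (auto simp: singular_relcycle subtopology_subtopology Int_absorb1 singular_chain_subtopology)

lemma singular_relboundary_subtopology_imp:
  assumes "singular_relboundary p (subtopology X W) S z" "S \<subseteq> W"
  shows "singular_relboundary p X S z"
  using assms unfolding singular_relboundary subtopology_subtopology
  by (metis Int_absorb1 singular_chain_subtopology)

text \<open>The injective half of excision, on chains: a chain bounding \<open>z\<close> modulo the
  complement of \<open>K\<close> is subdivided until it splits into a piece in \<open>W\<close> and
  a piece off \<open>K\<close>, and the first piece is kept.\<close>

lemma excision_relboundary:
  assumes W: "openin X W" and K: "closedin X K" "K \<subseteq> W"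
    and z: "singular_relcycle p (subtopology X W) (W - K) z"
    and zb: "singular_relboundary p X (topspace X - K) z"
  shows "singular_relboundary p (subtopology X W) (W - K) z"
proof -
  have "X closure_of (topspace X - W) = topspace X - W"
    using W by (simp add: closure_of_closedin closedin_diff)
  moreover have "X interior_of (topspace X - K) = topspace X - K"
    using K by (simp add: interior_of_openin openin_diff)
  ultimately have cl: "X closure_of (topspace X - W) \<subseteq> X interior_of (topspace X - K)"
    using K by blast
  have WX: "topspace X - (topspace X - W) = W" "topspace (subtopology X W) = W"
    using openin_subset[OF W] by auto
  obtain d u where d: "singular_chain (Suc p) X d" and u: "singular_chain p (subtopology X (topspace X - K)) u"
    and du: "chain_boundary (Suc p) d + u = z"
    using zb unfolding singular_relboundary by blast
  obtain m d1 d2 where d1: "singular_chain (Suc p) (subtopology X W) d1"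
    and d2: "singular_chain (Suc p) (subtopology X (topspace X - K)) d2"
    and dd: "(singular_subdivision (Suc p) ^^ m) d = d1 + d2"
  proof (rule excised_chain_exists[OF cl, of "topspace X" "Suc p" d])
    show "singular_chain (Suc p) (subtopology X (topspace X)) d"
      using d by (simp add: subtopology_topspace)
  qed (use WX in auto)
  obtain h where h: "\<And>p. h p 0 = (0 :: 'a chain)"
        "\<And>p c1 c2. h p (c1-c2) = h p c1 - h p c2"
        "\<And>p X c. singular_chain p X c \<Longrightarrow> singular_chain (Suc p) X (h p c)"
        "\<And>p X c. singular_chain p X c
                 \<Longrightarrow> chain_boundary (Suc p) (h p c) + h (p - Suc 0) (chain_boundary p c)
                   = (singular_subdivision p ^^ m) c - c"
    using chain_homotopic_iterated_singular_subdivision[of m] by blast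
  let ?b = "chain_boundary (Suc p)"
  have zW: "singular_chain p (subtopology X W) z"
    using z by (simp add: singular_relcycle)
  have hz: "h p z = h p (?b d) + h p u"
    by (metis add_diff_cancel_right' diff_add_cancel du h(2))
  have "d1 + d2 = d + chain_boundary (Suc (Suc p)) (h (Suc p) d) + h p (?b d)"
    using h(4)[OF d] unfolding dd by (simp add: algebra_simps)
  then have "?b d1 + ?b d2 = ?b d + ?b (h p (?b d))"
    unfolding chain_boundary_add[symmetric]
    by (simp add: chain_boundary_add chain_boundary_boundary_alt[OF h(3)[OF d]])
  \<comment> \<open>The left side is a chain in \<open>W\<close>, the right side avoids
    \<open>K\<close>. Passing from \<open>d\<close> to its subdivision costs the term
    \<open>h p z\<close>, which stays in \<open>W\<close> because \<open>z\<close> does.\<close>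
  then have eq: "z - ?b (d1 - h p z) = ?b d2 + u + ?b (h p u)"
    unfolding chain_boundary_diff hz chain_boundary_add unfolding du[symmetric] by (simp add: algebra_simps)
  have 1: "singular_chain (Suc p) (subtopology X W) (d1 - h p z)"
    using d1 h(3)[OF zW] by (rule singular_chain_diff)
  have 2: "singular_chain p (subtopology X W) (z - ?b (d1 - h p z))"
    using zW singular_chain_boundary_alt[OF 1] by (rule singular_chain_diff)
  have 3: "singular_chain p (subtopology X (topspace X - K)) (z - ?b (d1 - h p z))"
    unfolding eq by (intro singular_chain_add singular_chain_boundary_alt d2 u h(3))
  have "singular_chain p (subtopology X (W \<inter> (topspace X - K))) (z - ?b (d1 - h p z))"
    by (rule singular_chain_subtopology_Int[OF 2 3])
  moreover have "W \<inter> (topspace X - K) = W \<inter> (W - K)"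
    using openin_subset[OF W] by auto
  ultimately have "singular_chain p (subtopology (subtopology X W) (W - K)) (z - ?b (d1 - h p z))"
    by (simp add: subtopology_subtopology)
  then show ?thesis
    unfolding singular_relboundary using 1 by (metis add.commute diff_add_cancel)
qed

section \<open>Detection of classes at points and its behaviour under unions and charts\<close>

text \<open>The first clause is what makes the notion inductive: gluing over a union in degree
  \<open>n\<close> needs vanishing in degree \<open>n + 1\<close> over the intersection.\<close>

definition locally_detected :: "nat \<Rightarrow> 'a topology \<Rightarrow> 'a set \<Rightarrow> bool"
  where "locally_detected n X K \<longleftrightarrow>
    (\<forall>i>n. \<forall>z. singular_relcycle i X (topspace X - K) z \<longrightarrow> singular_relboundary i X (topspace X - K) z) \<and>
    (\<forall>z. singular_relcycle n X (topspace X - K) z \<longrightarrow>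
         (\<forall>x\<in>K. singular_relboundary n X (topspace X - {x}) z) \<longrightarrow>
         singular_relboundary n X (topspace X - K) z)"

text \<open>Here nullity at any one point of \<open>K\<close> is enough. This is a statement about
  small connected pieces; for two points of a Euclidean space it fails.\<close>

definition pointwise_detected :: "nat \<Rightarrow> 'a topology \<Rightarrow> 'a set \<Rightarrow> bool"
  where "pointwise_detected n X K \<longleftrightarrow>
    (\<forall>z. \<forall>x\<in>K. singular_relcycle n X (topspace X - K) z \<longrightarrow>
         singular_relboundary n X (topspace X - {x}) z \<longrightarrow>
         singular_relboundary n X (topspace X - K) z)"

text \<open>Mayer-Vietoris for complements: removing a union intersects the two complements, and the
  vanishing above \<open>n\<close> for \<open>A \<inter> B\<close> kills the obstruction in degree
  \<open>i + 1\<close>. Hence \<open>glue\<close> covers every \<open>i\<close> from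
  \<open>n\<close> on.\<close>

lemma locally_detected_Un:
  assumes "closedin X A" "closedin X B"
    and A: "locally_detected n X A" and B: "locally_detected n X B"
    and AB: "locally_detected n X (A \<inter> B)"
  shows "locally_detected n X (A \<union> B)"
proof -
  let ?T = "topspace X"
  have oA: "openin X (?T - A)" and oB: "openin X (?T - B)"
    using assms by auto
  have eqs: "?T - (A \<inter> B) = (?T - A) \<union> (?T - B)" "?T - (A \<union> B) = (?T - A) \<inter> (?T - B)"
    by auto
  have glue: "singular_relboundary i X (?T - (A \<union> B)) z"
    if "i \<ge> n" "singular_relboundary i X (?T - A) z" "singular_relboundary i X (?T - B) z" for i z
    unfolding eqs
  proof (rule relboundary_Int_of_relboundaries[OF oA oB that(2,3)])
    fix w assume "singular_relcycle (Suc i) X (?T - A \<union> (?T - B)) w"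
    then show "singular_relboundary (Suc i) X (?T - A \<union> (?T - B)) w"
      using AB \<open>i \<ge> n\<close> unfolding locally_detected_def eqs by (meson le_imp_less_Suc)
  qed
  have sub: "?T - (A \<union> B) \<subseteq> ?T - A" "?T - (A \<union> B) \<subseteq> ?T - B" by auto
  show ?thesis
    unfolding locally_detected_def
  proof (intro conjI allI impI)
    fix i z assume i: "n < i" and z: "singular_relcycle i X (?T - (A \<union> B)) z"
    show "singular_relboundary i X (?T - (A \<union> B)) z"
      using A B i singular_relcycle_mono[OF z sub(1)] singular_relcycle_mono[OF z sub(2)]
      by (intro glue) (auto simp: locally_detected_def)
  next
    fix z assume z: "singular_relcycle n X (?T - (A \<union> B)) z"
      and "\<forall>x\<in>A \<union> B. singular_relboundary n X (?T - {x}) z"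
    then show "singular_relboundary n X (?T - (A \<union> B)) z"
      using A B singular_relcycle_mono[OF z sub(1)] singular_relcycle_mono[OF z sub(2)]
      by (intro glue) (auto simp: locally_detected_def)
  qed
qed

lemma locally_detected_empty: "locally_detected n X {}"
  unfolding locally_detected_def
  by (auto simp: singular_relcycle subtopology_topspace intro!: singular_chain_imp_relboundary)

text \<open>Excision moves a cycle from \<open>X\<close> into \<open>W\<close>. It is applied to
  \<open>K\<close> and to the single points of \<open>K\<close>, which are closed by
  \<open>t1_space\<close>.\<close>

lemma detected_open_subtopology_imp:
  assumes W: "openin X W" and K: "closedin X K" "K \<subseteq> W" and T1: "t1_space X"
  shows "locally_detected n (subtopology X W) K \<Longrightarrow> locally_detected n X K"
    and "pointwise_detected n (subtopology X W) K \<Longrightarrow> pointwise_detected n X K"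
proof -
  have tW: "topspace (subtopology X W) = W" using openin_subset[OF W] by auto
  have cls: "closedin X {x}" if "x \<in> K" for x
    using T1 that K by (metis closedin_subset closedin_t1_singleton subsetD)
  have ex: "\<exists>z'. singular_relcycle p (subtopology X W) (W - K) z' \<and>
      (singular_relboundary p (subtopology X W) (W - K) z' \<longrightarrow> singular_relboundary p X (topspace X - K) z) \<and>
      (\<forall>x\<in>K. singular_relboundary p X (topspace X - {x}) z \<longrightarrow>
             singular_relboundary p (subtopology X W) (W - {x}) z')"
    if z: "singular_relcycle p X (topspace X - K) z" for p z
  proof -
    obtain z' where z': "singular_relcycle p (subtopology X W) (W - K) z'"
      and hz: "homologous_rel p X (topspace X - K) z z'"
      using excision_relcycle_exists[OF W K z] by blast
    have 1: "singular_relboundary p X (topspace X - K) z"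
      if "singular_relboundary p (subtopology X W) (W - K) z'"
    proof -
      have "singular_relboundary p X (W - K) z'"
        using singular_relboundary_subtopology_imp[OF that] by blast
      then have "singular_relboundary p X (topspace X - K) z'"
        by (rule singular_relboundary_mono) (use openin_subset[OF W] in auto)
      then show ?thesis
        using hz unfolding homologous_rel_def by (metis diff_add_cancel singular_relboundary_add)
    qed
    have 2: "singular_relboundary p (subtopology X W) (W - {x}) z'"
      if x: "x \<in> K" "singular_relboundary p X (topspace X - {x}) z" for x
    proof (rule excision_relboundary[OF W cls[OF x(1)]])
      show "{x} \<subseteq> W" using x K by auto
      show "singular_relcycle p (subtopology X W) (W - {x}) z'"
        using z' by (rule singular_relcycle_mono) (use x in auto)
      have "singular_relboundary p X (topspace X - {x}) (z - z')"
        using hz unfolding homologous_rel_def by (rule singular_relboundary_mono) (use x in auto)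
      then show "singular_relboundary p X (topspace X - {x}) z'"
        using x(2) by (metis diff_diff_eq2 add_diff_cancel_left' singular_relboundary_diff)
    qed
    show ?thesis using z' 1 2 by blast
  qed
  show "locally_detected n (subtopology X W) K \<Longrightarrow> locally_detected n X K"
    unfolding locally_detected_def tW using ex by metis
  show "pointwise_detected n (subtopology X W) K \<Longrightarrow> pointwise_detected n X K"
    unfolding pointwise_detected_def tW using ex by metis
qed

lemma detected_imp_open_subtopology:
  assumes W: "openin X W" and K: "closedin X K" "K \<subseteq> W"
  shows "locally_detected n X K \<Longrightarrow> locally_detected n (subtopology X W) K"
    and "pointwise_detected n X K \<Longrightarrow> pointwise_detected n (subtopology X W) K"
proof -
  have tW: "topspace (subtopology X W) = W" using openin_subset[OF W] by auto
  have cyc: "singular_relcycle p X (topspace X - K) z"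
    if "singular_relcycle p (subtopology X W) (W - K) z" for p z
    using singular_relcycle_mono[OF singular_relcycle_subtopology_imp[OF that]] openin_subset[OF W] by blast
  have bd: "singular_relboundary p X (topspace X - {x}) z"
    if "singular_relboundary p (subtopology X W) (W - {x}) z" for p z x
    using singular_relboundary_mono[OF singular_relboundary_subtopology_imp[OF that]] openin_subset[OF W] by blast
  show "locally_detected n X K \<Longrightarrow> locally_detected n (subtopology X W) K"
    unfolding locally_detected_def tW using excision_relboundary[OF W K] cyc bd by blast
  show "pointwise_detected n X K \<Longrightarrow> pointwise_detected n (subtopology X W) K"
    unfolding pointwise_detected_def tW using excision_relboundary[OF W K] cyc bd by blast
qed

lemma detected_homeomorphic_image:
  assumes fg: "homeomorphic_maps X Y f g" and K: "K \<subseteq> topspace X"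
  shows "locally_detected n X K \<Longrightarrow> locally_detected n Y (f ` K)"
    and "pointwise_detected n X K \<Longrightarrow> pointwise_detected n Y (f ` K)"
proof -
  have f: "continuous_map X Y f" and g: "continuous_map Y X g"
    and gf: "\<And>x. x \<in> topspace X \<Longrightarrow> g (f x) = x" and fg': "\<And>y. y \<in> topspace Y \<Longrightarrow> f (g y) = y"
    using fg by (auto simp: homeomorphic_maps_def)
  have gin: "\<And>y. y \<in> topspace Y \<Longrightarrow> g y \<in> topspace X" and fin: "\<And>x. x \<in> topspace X \<Longrightarrow> f x \<in> topspace Y"
    using f g by (auto simp: continuous_map_def)
  have gS: "g \<in> (topspace Y - f ` S) \<rightarrow> topspace X - S" if "S \<subseteq> topspace X" for S
  proof
    fix y assume y: "y \<in> topspace Y - f ` S"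
    then have "g y \<notin> S" using fg'[of y] by force
    then show "g y \<in> topspace X - S" using gin y by auto
  qed
  have fS: "f \<in> (topspace X - S) \<rightarrow> topspace Y - f ` S" if "S \<subseteq> topspace X" for S
  proof
    fix x assume x: "x \<in> topspace X - S"
    have "f x \<noteq> f x'" if "x' \<in> S" for x'
      using gf[of x] gf[of x'] x that \<open>S \<subseteq> topspace X\<close> by force
    then show "f x \<in> topspace Y - f ` S" using fin x by auto
  qed
  have cyc: "singular_relcycle p X (topspace X - K) (chain_map p g z)"
    if "singular_relcycle p Y (topspace Y - f ` K) z" for p z
    using singular_relcycle_chain_map[OF that g gS[OF K]] .
  have bd: "singular_relboundary p X (topspace X - {x}) (chain_map p g z)"
    if "singular_relboundary p Y (topspace Y - {f x}) z" "x \<in> K" for p z x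
    using singular_relboundary_chain_map[OF that(1) g, of "topspace X - {x}"] gS[of "{x}"] that K by auto
  have lift: "singular_relboundary p Y (topspace Y - f ` K) z"
    if "singular_relboundary p X (topspace X - K) (chain_map p g z)" "singular_relcycle p Y (topspace Y - f ` K) z" for p z
  proof -
    have "singular_chain p Y z" using that by (simp add: singular_relcycle)
    then have "chain_map p f (chain_map p g z) = z"
      using chain_map_id_gen[of p Y z "f \<circ> g"] fg' by (simp add: chain_map_compose)
    then show ?thesis
      using singular_relboundary_chain_map[OF that(1) f fS[OF K]] by simp
  qed
  show "locally_detected n X K \<Longrightarrow> locally_detected n Y (f ` K)"
    unfolding locally_detected_def by (metis (no_types, lifting) bd lift cyc imageI)
  show "pointwise_detected n X K \<Longrightarrow> pointwise_detected n Y (f ` K)"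
    unfolding pointwise_detected_def by (metis (no_types, lifting) bd lift cyc imageE)
qed

section \<open>Compact sets in Euclidean space\<close>

lemma pointwise_detectedD:
  assumes "pointwise_detected n X K" and "x \<in> K" and "singular_relcycle n X (topspace X - K) z"
    and "singular_relboundary n X (topspace X - {x}) z"
  shows "singular_relboundary n X (topspace X - K) z"
  using assms unfolding pointwise_detected_def by blast

lemma locally_detected_vanish:
  assumes "locally_detected n X K" and "n < i" and "singular_relcycle i X (topspace X - K) z"
  shows "singular_relboundary i X (topspace X - K) z"
  using assms by (simp add: locally_detected_def)

lemma locally_detectedD:
  assumes "locally_detected n X K" and "singular_relcycle n X (topspace X - K) z"
    and "\<And>x. x \<in> K \<Longrightarrow> singular_relboundary n X (topspace X - {x}) z"
  shows "singular_relboundary n X (topspace X - K) z"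
  using assms by (simp add: locally_detected_def)

text \<open>Boxes rather than balls: an intersection of boxes is a box again (empty when bounds
  cross), which permits an induction over finite unions.\<close>

definition Euclidean_box :: "nat \<Rightarrow> (nat \<Rightarrow> real) \<Rightarrow> (nat \<Rightarrow> real) \<Rightarrow> (nat \<Rightarrow> real) set"
  where "Euclidean_box n a b = {x \<in> topspace (Euclidean_space n). \<forall>i<n. a i \<le> x i \<and> x i \<le> b i}"

lemma Euclidean_box_Int:
  "Euclidean_box n a b \<inter> Euclidean_box n c d = Euclidean_box n (\<lambda>i. max (a i) (c i)) (\<lambda>i. min (b i) (d i))"
  by (auto simp: Euclidean_box_def)

lemma compactin_Euclidean_box: "compactin (Euclidean_space n) (Euclidean_box n a b)"
proof -
  let ?S = "\<lambda>i::nat. if i < n then {a i..b i} else {0::real}"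
  have "compactin (powertop_real UNIV) (PiE UNIV ?S)"
    by (subst compactin_PiE) auto
  moreover have "PiE UNIV ?S = Euclidean_box n a b"
    by (force simp: Euclidean_box_def topspace_Euclidean_space PiE_iff split: if_splits)
  moreover have "Euclidean_box n a b \<subseteq> {x. \<forall>i\<ge>n. x i = 0}"
    by (auto simp: Euclidean_box_def topspace_Euclidean_space)
  ultimately show ?thesis
    unfolding Euclidean_space_def by (simp add: compactin_subtopology)
qed

lemma closedin_Euclidean_box: "closedin (Euclidean_space n) (Euclidean_box n a b)"
  using compactin_imp_closedin[OF Hausdorff_Euclidean_space compactin_Euclidean_box] .

lemma openin_Euclidean_space_contains_box:
  assumes "openin (Euclidean_space n) S" and "x \<in> S"
  obtains e where "e > 0" "Euclidean_box n (\<lambda>i. x i - e) (\<lambda>i. x i + e) \<subseteq> S"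
proof -
  obtain T where T: "openin (powertop_real UNIV) T" and S: "S = T \<inter> {x. \<forall>i\<ge>n. x i = 0}"
    using assms unfolding Euclidean_space_def openin_subtopology by blast
  obtain X where X: "x \<in> PiE UNIV X" "\<And>i. open (X i)" "PiE UNIV X \<subseteq> T"
    using product_topology_open_contains_basis[OF T, of x] assms(2) S by auto
  have "\<exists>e>0. \<forall>y. \<bar>y - x i\<bar> \<le> e \<longrightarrow> y \<in> X i" for i
  proof -
    have "x i \<in> X i" using X(1) by (auto simp: PiE_iff)
    then show ?thesis
      using X(2)[of i] unfolding open_contains_cball subset_iff mem_cball dist_real_def
      by (metis abs_minus_commute)
  qed
  then obtain e where e: "\<And>i. e i > 0" "\<And>i y. \<bar>y - x i\<bar> \<le> e i \<Longrightarrow> y \<in> X i"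
    by metis
  \<comment> \<open>Only the coordinates below \<open>n\<close> restrict the radius; the inserted 1
    keeps the minimum defined for \<open>n = 0\<close>.\<close>
  let ?e = "Min (insert 1 (e ` {..<n}))"
  have "y \<in> S" if y: "y \<in> Euclidean_box n (\<lambda>i. x i - ?e) (\<lambda>i. x i + ?e)" for y
  proof -
    have xE: "x i = 0" and yE: "y i = 0" if "i \<ge> n" for i
      using that assms(2) S y by (auto simp: Euclidean_box_def topspace_Euclidean_space)
    have "y i \<in> X i" for i
    proof (cases "i < n")
      case True
      have "?e \<le> e i" using True by (intro Min_le) auto
      moreover have "x i - ?e \<le> y i" "y i \<le> x i + ?e"
        using y True by (auto simp: Euclidean_box_def)
      ultimately show ?thesis by (intro e(2)) linarith
    next
      case False
      then show ?thesis using e(1)[of i] xE yE by (intro e(2)) (simp add: less_imp_le)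
    qed
    then show ?thesis using X(3) yE S by (auto simp: PiE_iff)
  qed
  moreover have "?e > 0" using e(1) by (subst Min_gr_iff) auto
  ultimately show ?thesis using that by blast
qed

lemma openin_Euclidean_open_box:
  "openin (Euclidean_space n) {x \<in> topspace (Euclidean_space n). \<forall>i<n. a i < x i \<and> x i < b i}"
proof -
  let ?S = "\<lambda>i::nat. if i < n then {a i<..<b i} else UNIV"
  have "finite {i. ?S i \<noteq> UNIV}" by (rule finite_subset[of _ "{..<n}"]) (auto split: if_splits)
  then have "openin (powertop_real UNIV) (PiE UNIV ?S)"
    by (intro product_topology_basis) auto
  moreover have "{x \<in> topspace (Euclidean_space n). \<forall>i<n. a i < x i \<and> x i < b i} = PiE UNIV ?S \<inter> {x. \<forall>i\<ge>n. x i = 0}"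
    by (auto simp: topspace_Euclidean_space PiE_iff split: if_splits)
  ultimately show ?thesis unfolding Euclidean_space_def openin_subtopology by blast
qed

section \<open>Compact supports and the room they leave\<close>

definition chain_support :: "nat \<Rightarrow> 'a chain \<Rightarrow> 'a set"
  where "chain_support p c = (\<Union>\<sigma>\<in>Poly_Mapping.keys c. \<sigma> ` standard_simplex p)"

lemma compactin_chain_support:
  assumes "singular_chain p X c"
  shows "compactin X (chain_support p c)"
  unfolding chain_support_def
proof (rule compactin_Union)
  show "compactin X S" if S: "S \<in> (\<lambda>\<sigma>. \<sigma> ` standard_simplex p) ` Poly_Mapping.keys c" for S
  proof -
    obtain \<sigma> where \<sigma>: "\<sigma> \<in> Poly_Mapping.keys c" "S = \<sigma> ` standard_simplex p" using S by blast
    have "continuous_map (subtopology (powertop_real UNIV) (standard_simplex p)) X \<sigma>"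
      using \<sigma> assms by (auto simp: singular_chain_def singular_simplex_def)
    moreover have "compactin (subtopology (powertop_real UNIV) (standard_simplex p)) (standard_simplex p)"
      by (simp add: compactin_subtopology compactin_standard_simplex)
    ultimately show ?thesis unfolding \<sigma>(2) by (rule image_compactin[rotated])
  qed
qed auto

lemma singular_chain_subtopology_support:
  "singular_chain p (subtopology X S) c \<longleftrightarrow> singular_chain p X c \<and> chain_support p c \<subseteq> S"
  by (auto simp: singular_chain_subtopology chain_support_def)

text \<open>The support of the boundary of \<open>z\<close> is compact, hence closed in a Hausdorff
  space, and its complement is an open set around \<open>K\<close>. This allows \<open>K\<close> to
  be enlarged to nicer sets.\<close>

lemma relcycle_avoids_nbhd:
  assumes H: "Hausdorff_space X" and z: "singular_relcycle p X (topspace X - K) z" and K: "K \<subseteq> topspace X"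
  obtains Q where "openin X Q" "K \<subseteq> Q" "\<And>B. B \<subseteq> Q \<Longrightarrow> singular_relcycle p X (topspace X - B) z"
proof -
  let ?C = "chain_support (p - 1) (chain_boundary p z)"
  have zc: "singular_chain p X z" and bz: "singular_chain (p - 1) (subtopology X (topspace X - K)) (chain_boundary p z)"
    using z by (auto simp: singular_relcycle)
  have bX: "singular_chain (p - 1) X (chain_boundary p z)" and CK: "?C \<subseteq> topspace X - K"
    using bz by (auto simp: singular_chain_subtopology_support)
  have "closedin X ?C"
    using compactin_imp_closedin[OF H compactin_chain_support[OF bX]] .
  then have "openin X (topspace X - ?C)" by blast
  moreover have "singular_relcycle p X (topspace X - B) z" if "B \<subseteq> topspace X - ?C" for B
    using that zc bX CK by (auto simp: singular_relcycle singular_chain_subtopology_support)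
  ultimately show ?thesis using that K CK by blast
qed

text \<open>The same argument for the remainder \<open>e\<close> of a bounding chain, whose compact
  support misses \<open>x\<close> and therefore a whole neighbourhood of \<open>x\<close>.\<close>

lemma relboundary_avoids_nbhd:
  assumes H: "Hausdorff_space X" and z: "singular_relboundary p X (topspace X - {x}) z" and x: "x \<in> topspace X"
  obtains Q where "openin X Q" "x \<in> Q" "\<And>B. B \<subseteq> Q \<Longrightarrow> singular_relboundary p X (topspace X - B) z"
proof -
  obtain d e where d: "singular_chain (Suc p) X d" and e: "singular_chain p (subtopology X (topspace X - {x})) e"
    and de: "chain_boundary (Suc p) d + e = z"
    using z unfolding singular_relboundary by blast
  let ?C = "chain_support p e"
  have eX: "singular_chain p X e" and C: "?C \<subseteq> topspace X - {x}"
    using e by (auto simp: singular_chain_subtopology_support)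
  have "closedin X ?C"
    using compactin_imp_closedin[OF H compactin_chain_support[OF eX]] .
  then have "openin X (topspace X - ?C)" by blast
  moreover have "singular_relboundary p X (topspace X - B) z" if "B \<subseteq> topspace X - ?C" for B
  proof -
    have "singular_chain p (subtopology X (topspace X - B)) e"
      using that eX C by (auto simp: singular_chain_subtopology_support)
    then show ?thesis unfolding singular_relboundary using d de by blast
  qed
  ultimately show ?thesis using that x C by blast
qed

text \<open>Coordinates from \<open>n\<close> on are set to 0, so all values lie in
  \<open>Euclidean_space n\<close>; factor 1 gives the identity on that space.\<close>

definition dilation :: "nat \<Rightarrow> (nat \<Rightarrow> real) \<Rightarrow> real \<Rightarrow> (nat \<Rightarrow> real) \<Rightarrow> nat \<Rightarrow> real"
  where "dilation n x s y = (\<lambda>i. if i < n then x i + s * (y i - x i) else 0)"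

text \<open>Argued in one coordinate: a point off \<open>K\<close> violates a bound there which
  \<open>x\<close> respects, and stretching away from \<open>x\<close> by a factor of at least 1 can
  only increase the violation.\<close>

lemma homotopic_dilation:
  assumes K: "K = Euclidean_box n a b" and x: "x \<in> K" and R: "R \<ge> 1"
  shows "homotopic_with (\<lambda>h. h \<in> (topspace (Euclidean_space n) - K) \<rightarrow> topspace (Euclidean_space n) - K)
           (Euclidean_space n) (Euclidean_space n) (dilation n x 1) (dilation n x R)"
  unfolding homotopic_with_def
proof (intro exI conjI allI ballI)
  let ?E = "Euclidean_space n"
  let ?h = "\<lambda>z. dilation n x (1 + fst z * (R - 1)) (snd z)"
  have co: "continuous_map ?E euclideanreal (\<lambda>y. y i)" for i
    unfolding Euclidean_space_def
    by (intro continuous_map_from_subtopology continuous_map_product_projection) auto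
  show "continuous_map (prod_topology (top_of_set {0..1}) ?E) ?E ?h"
    unfolding dilation_def continuous_map_componentwise_Euclidean_space
  proof (intro allI impI)
    fix i
    have 1: "continuous_map (prod_topology (top_of_set {0..1}) ?E) euclideanreal (\<lambda>z. snd z i)"
      using continuous_map_compose[OF continuous_map_snd co[of i]] by (simp add: o_def)
    have 2: "continuous_map (prod_topology (top_of_set {0..1::real}) ?E) euclideanreal fst"
      using continuous_map_into_fulltopology[OF continuous_map_fst] by blast
    show "continuous_map (prod_topology (top_of_set {0..1}) ?E) euclideanreal
         (\<lambda>z. x i + (1 + fst z * (R - 1)) * (snd z i - x i))"
      by (intro continuous_intros 1 2)
  qed
  show "?h (0, y) = dilation n x 1 y" "?h (1, y) = dilation n x R y" for y by (auto simp: dilation_def)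
  fix t :: real assume t: "t \<in> {0..1}"
  let ?s = "1 + t * (R - 1)"
  define s where "s = ?s"
  have s: "s \<ge> 1" using t R by (simp add: s_def)
  have "dilation n x s y \<notin> K" if y: "y \<in> topspace ?E - K" for y
  proof
    assume k: "dilation n x s y \<in> K"
    obtain i where i: "i < n" "y i < a i \<or> y i > b i"
      using y by (auto simp: K Euclidean_box_def not_le)
    have xi: "a i \<le> x i" "x i \<le> b i" using x i by (auto simp: K Euclidean_box_def)
    have ki: "a i \<le> x i + s * (y i - x i)" "x i + s * (y i - x i) \<le> b i"
      using k i by (auto simp: K Euclidean_box_def dilation_def)
    from i(2) show False
    proof
      assume "y i < a i"
      then have "0 \<le> (s - 1) * (x i - y i)" using s xi by (intro mult_nonneg_nonneg) auto
      then show False using ki xi \<open>y i < a i\<close> by (simp add: algebra_simps)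
    next
      assume "y i > b i"
      then have "0 \<le> (s - 1) * (y i - x i)" using s xi by (intro mult_nonneg_nonneg) auto
      then show False using ki xi \<open>y i > b i\<close> by (simp add: algebra_simps)
    qed
  qed
  then show "(\<lambda>y. ?h (t, y)) \<in> (topspace ?E - K) \<rightarrow> topspace ?E - K"
    by (auto simp: topspace_Euclidean_space dilation_def s_def)
qed

text \<open>Dilating from a point \<open>x\<close> of the box pushes everything that avoids a neighbourhood of \<open>x\<close> out
  of the box, and never moves a point into it.\<close>

lemma pointwise_detected_box: "pointwise_detected p (Euclidean_space n) (Euclidean_box n a b)"
  unfolding pointwise_detected_def
proof (intro allI ballI impI)
  let ?E = "Euclidean_space n"
  define K where "K = Euclidean_box n a b"
  fix z x assume "x \<in> Euclidean_box n a b" and "singular_relcycle p ?E (topspace ?E - Euclidean_box n a b) z"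
    and zx: "singular_relboundary p ?E (topspace ?E - {x}) z"
  then have x: "x \<in> K" and z: "singular_relcycle p ?E (topspace ?E - K) z" by (auto simp: K_def)
  have xE: "x \<in> topspace ?E" using x by (auto simp: K_def Euclidean_box_def)
  obtain Q where Q: "openin ?E Q" "x \<in> Q" "\<And>B. B \<subseteq> Q \<Longrightarrow> singular_relboundary p ?E (topspace ?E - B) z"
    using relboundary_avoids_nbhd[OF Hausdorff_Euclidean_space zx xE] by blast
  obtain e where e: "e > 0" "Euclidean_box n (\<lambda>i. x i - e) (\<lambda>i. x i + e) \<subseteq> Q"
    using openin_Euclidean_space_contains_box[OF Q(1,2)] by blast
  define B where "B = Euclidean_box n (\<lambda>i. x i - e) (\<lambda>i. x i + e)"
  have zB: "singular_relboundary p ?E (topspace ?E - B) z" using Q(3) e(2) B_def by blast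
  \<comment> \<open>\<open>D\<close> bounds every side length and \<open>R * e = e + D\<close>. A
    coordinate more than \<open>e\<close> away from that of \<open>x\<close> is thus moved further
    from \<open>x\<close> than the box is wide.\<close>
  define D where "D = (\<Sum>i<n. \<bar>b i - a i\<bar>)"
  define R where "R = 1 + D / e"
  have "D \<ge> 0" by (auto simp: D_def intro: sum_nonneg)
  then have R: "R \<ge> 1" using e by (simp add: R_def)
  have hom: "homotopic_with (\<lambda>h. h \<in> (topspace ?E - K) \<rightarrow> topspace ?E - K) ?E ?E (dilation n x 1) (dilation n x R)"
    using homotopic_dilation[OF K_def x R] .
  have contR: "continuous_map ?E ?E (dilation n x R)"
    using homotopic_with_imp_continuous_maps[OF hom] by blast
  have "dilation n x R y \<notin> K" if y: "y \<in> topspace ?E - B" for y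
  proof
    assume k: "dilation n x R y \<in> K"
    obtain i where i: "i < n" "\<bar>y i - x i\<bar> > e"
      using y by (force simp: B_def Euclidean_box_def not_le)
    have xi: "a i \<le> x i" "x i \<le> b i" using x i by (auto simp: K_def Euclidean_box_def)
    have ki: "a i \<le> x i + R * (y i - x i)" "x i + R * (y i - x i) \<le> b i"
      using k i by (auto simp: K_def Euclidean_box_def dilation_def)
    have "\<bar>b i - a i\<bar> \<le> D" unfolding D_def using i by (intro member_le_sum) auto
    moreover have "R * e = e + D" using e by (simp add: R_def field_simps)
    moreover have "R * e \<le> R * \<bar>y i - x i\<bar>" using i R by (intro mult_left_mono) auto
    moreover have "R * \<bar>y i - x i\<bar> = \<bar>R * (y i - x i)\<bar>" using R by (simp add: abs_mult)
    ultimately show False using ki xi e by linarith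
  qed
  then have "dilation n x R \<in> (topspace ?E - B) \<rightarrow> topspace ?E - K"
    by (auto simp: topspace_Euclidean_space dilation_def)
  then have "singular_relboundary p ?E (topspace ?E - K) (chain_map p (dilation n x R) z)"
    by (rule singular_relboundary_chain_map[OF zB contR])
  moreover have "chain_map p (dilation n x 1) z = z"
    using z by (intro chain_map_id_gen[of p ?E]) (auto simp: singular_relcycle dilation_def topspace_Euclidean_space)
  ultimately have "singular_relboundary p ?E (topspace ?E - K) z"
    using homotopic_imp_homologous_rel_chain_maps[OF hom z] unfolding homologous_rel_def
    by (metis diff_add_cancel singular_relboundary_add)
  then show "singular_relboundary p ?E (topspace ?E - Euclidean_box n a b) z" by (simp add: K_def)
qed

lemma relboundary_of_trivial_relative_homology_group:
  assumes "trivial_group (relative_homology_group (int p) X S)" and "singular_relcycle p X S z"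
  shows "singular_relboundary p X S z"
proof -
  have "homologous_rel_set p X S z \<in> carrier (relative_homology_group (int p) X S)"
    unfolding carrier_relative_homology_group using assms(2) by blast
  then have "homologous_rel_set p X S z = singular_relboundary_set p X S"
    using assms(1) by (simp add: trivial_group_def)
  then show ?thesis by (simp add: homologous_rel_set_eq_relboundary)
qed

text \<open>Descending \<open>n\<close> dimensions at the origin leads to a one-point space in
  degree \<open>i - n > 0\<close>. The origin is exchanged for \<open>x\<close> because relative
  homology modulo the complement of a closed set depends only on that set up to
  homeomorphism.\<close>

lemma trivial_relative_homology_group_Euclidean_point:
  assumes "n < i" and x: "x \<in> topspace (Euclidean_space n)"
  shows "trivial_group (relative_homology_group (int i) (Euclidean_space n) (topspace (Euclidean_space n) - {x}))"
proof -
  let ?o = "\<lambda>i::nat. 0::real"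
  let ?E = "Euclidean_space"
  have T0: "topspace (?E 0) = {?o}" by (auto simp: topspace_Euclidean_space)
  have o: "?o \<in> topspace (?E n)" by (simp add: topspace_Euclidean_space)
  have cl: "closedin (?E n) {y}" if "y \<in> topspace (?E n)" for y n
    using that Hausdorff_Euclidean_space by (metis Hausdorff_imp_t1_space closedin_t1_singleton)
  have "trivial_group (homology_group (int (i - n)) (?E 0))"
    using homology_dimension_axiom[OF T0] assms by simp
  then have "trivial_group (relative_homology_group (int (i - n)) (?E 0) (topspace (?E 0) - {?o}))"
    by (simp add: T0)
  moreover have "relative_homology_group (int (i - n)) (?E 0) (topspace (?E 0) - {?o})
     \<cong> relative_homology_group (int i) (?E n) (topspace (?E n) - {?o})"
    using relative_homology_group_Euclidean_complement_step[OF cl[of ?o 0], of "int (i - n)" n] assms T0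
    by (simp add: of_nat_diff)
  ultimately have "trivial_group (relative_homology_group (int i) (?E n) (topspace (?E n) - {?o}))"
    using isomorphic_group_triviality1 group_relative_homology_group by blast
  moreover have "homeomorphic_maps (subtopology (?E n) {?o}) (subtopology (?E n) {x}) (\<lambda>_. x) (\<lambda>_. ?o)"
    using o x by (auto simp: homeomorphic_maps_def)
  then have "relative_homology_group (int i) (?E n) (topspace (?E n) - {?o})
     \<cong> relative_homology_group (int i) (?E n) (topspace (?E n) - {x})"
    by (intro isomorphic_relative_homology_groups_Euclidean_complements cl x o) (auto simp: homeomorphic_space_def)
  ultimately show ?thesis
    using isomorphic_group_triviality1 group_relative_homology_group by blast
qed

text \<open>\<open>pointwise_detected_box\<close> holds in every degree, so a single point of the
  box yields both the vanishing above \<open>n\<close> and the detection in degree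
  \<open>n\<close>.\<close>

lemma locally_detected_box: "locally_detected n (Euclidean_space n) (Euclidean_box n a b)"
proof (cases "Euclidean_box n a b = {}")
  case True
  then show ?thesis by (simp add: locally_detected_empty)
next
  case False
  let ?E = "Euclidean_space n"
  obtain x where x: "x \<in> Euclidean_box n a b" using False by blast
  have xE: "x \<in> topspace ?E" using x by (auto simp: Euclidean_box_def)
  have det: "singular_relboundary i ?E (topspace ?E - Euclidean_box n a b) z"
    if "singular_relcycle i ?E (topspace ?E - Euclidean_box n a b) z" "singular_relboundary i ?E (topspace ?E - {x}) z" for i z
    using pointwise_detectedD[OF pointwise_detected_box x that] .
  show ?thesis
    unfolding locally_detected_def
  proof (intro conjI allI impI)
    fix i z assume i: "n < i" and z: "singular_relcycle i ?E (topspace ?E - Euclidean_box n a b) z"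
    have "singular_relcycle i ?E (topspace ?E - {x}) z" by (rule singular_relcycle_mono[OF z]) (use x in blast)
    then show "singular_relboundary i ?E (topspace ?E - Euclidean_box n a b) z"
      by (intro det[OF z] relboundary_of_trivial_relative_homology_group
        trivial_relative_homology_group_Euclidean_point[OF i xE])
  next
    fix z assume "singular_relcycle n ?E (topspace ?E - Euclidean_box n a b) z"
      and "\<forall>x\<in>Euclidean_box n a b. singular_relboundary n ?E (topspace ?E - {x}) z"
    then show "singular_relboundary n ?E (topspace ?E - Euclidean_box n a b) z"
      using det x by simp
  qed
qed

text \<open>Meeting the union of the other boxes with the last one gives a union of fewer boxes, but
  with new corners. Hence the induction is on the number of boxes with \<open>a\<close> and
  \<open>b\<close> arbitrary.\<close>

lemma locally_detected_Union_boxes: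
  assumes "finite I"
  shows "locally_detected n (Euclidean_space n) (\<Union>j\<in>I. Euclidean_box n (a j) (b j))"
  using assms
proof (induction "card I" arbitrary: I a b rule: less_induct)
  case less
  show ?case
  proof (cases "I = {}")
    case True then show ?thesis by (simp add: locally_detected_empty)
  next
    case False
    then obtain k where k: "k \<in> I" by blast
    let ?J = "I - {k}"
    let ?B = "\<lambda>j. Euclidean_box n (a j) (b j)"
    have J: "finite ?J" "card ?J < card I" using less.prems k by (simp_all add: card_Diff1_less del: card_Diff_insert)
    have cl: "closedin (Euclidean_space n) (\<Union>j\<in>?J. ?B j)"
      using J(1) by (intro closedin_Union) (auto simp: closedin_Euclidean_box)
    have "(\<Union>j\<in>?J. ?B j) \<inter> ?B k
      = (\<Union>j\<in>?J. Euclidean_box n (\<lambda>i. max (a j i) (a k i)) (\<lambda>i. min (b j i) (b k i)))"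
      unfolding Euclidean_box_Int[symmetric] by blast
    then have "locally_detected n (Euclidean_space n) ((\<Union>j\<in>?J. ?B j) \<inter> ?B k)"
      using less.hyps[OF J(2,1), of "\<lambda>j i. max (a j i) (a k i)" "\<lambda>j i. min (b j i) (b k i)"] by (simp only:)
    then have "locally_detected n (Euclidean_space n) ((\<Union>j\<in>?J. ?B j) \<union> ?B k)"
      by (rule locally_detected_Un[OF cl closedin_Euclidean_box less.hyps[OF J(2,1)] locally_detected_box])
    moreover have "(\<Union>j\<in>?J. ?B j) \<union> ?B k = (\<Union>j\<in>I. ?B j)" using k by auto
    ultimately show ?thesis by simp
  qed
qed

text \<open>Compactness of supports lets \<open>z\<close> remain a relative cycle modulo the
  complement of finitely many boxes covering \<open>K\<close>, and the case of such unions
  applies.\<close>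

lemma locally_detected_compact_Euclidean:
  assumes K: "compactin (Euclidean_space n) K"
  shows "locally_detected n (Euclidean_space n) K"
proof -
  let ?E = "Euclidean_space n"
  have KE: "K \<subseteq> topspace ?E" using K by (simp add: compactin_subset_topspace)
  have cover: "\<exists>X c. finite X \<and> X \<subseteq> K \<and> K \<subseteq> (\<Union>x\<in>X. Euclidean_box n (\<lambda>i. x i - c x) (\<lambda>i. x i + c x))
       \<and> (\<forall>x\<in>X. x \<in> Euclidean_box n (\<lambda>i. x i - c x) (\<lambda>i. x i + c x))
       \<and> singular_relcycle i ?E (topspace ?E - (\<Union>x\<in>X. Euclidean_box n (\<lambda>i. x i - c x) (\<lambda>i. x i + c x))) z"
    if z: "singular_relcycle i ?E (topspace ?E - K) z" for i z
  proof -
    obtain Q where Q: "openin ?E Q" "K \<subseteq> Q" "\<And>B. B \<subseteq> Q \<Longrightarrow> singular_relcycle i ?E (topspace ?E - B) z"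
      using relcycle_avoids_nbhd[OF Hausdorff_Euclidean_space z KE] by blast
    have "\<exists>e>0. Euclidean_box n (\<lambda>i. x i - e) (\<lambda>i. x i + e) \<subseteq> Q" if "x \<in> K" for x
      using openin_Euclidean_space_contains_box[OF Q(1)] Q(2) that by blast
    then obtain c where c: "\<And>x. x \<in> K \<Longrightarrow> c x > 0 \<and> Euclidean_box n (\<lambda>i. x i - c x) (\<lambda>i. x i + c x) \<subseteq> Q"
      by metis
    let ?O = "\<lambda>x. {y \<in> topspace ?E. \<forall>i<n. x i - c x < y i \<and> y i < x i + c x}"
    obtain \<F> where F: "finite \<F>" "\<F> \<subseteq> ?O ` K" "K \<subseteq> \<Union>\<F>"
    proof -
      have "K \<subseteq> \<Union>(?O ` K)" using c KE by auto
      moreover have "openin ?E S" if "S \<in> ?O ` K" for S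
      proof -
        obtain x where "S = ?O x" using \<open>S \<in> ?O ` K\<close> by blast
        then show ?thesis by (simp only: openin_Euclidean_open_box)
      qed
      ultimately show ?thesis using K that unfolding compactin_def by meson
    qed
    obtain X where X: "X \<subseteq> K" "finite X" "\<F> = ?O ` X"
      using finite_subset_image[OF F(1,2)] by blast
    have "K \<subseteq> (\<Union>x\<in>X. Euclidean_box n (\<lambda>i. x i - c x) (\<lambda>i. x i + c x))"
    proof
      fix y assume "y \<in> K"
      then obtain x where "x \<in> X" "y \<in> ?O x" using F(3) X(3) by auto
      then show "y \<in> (\<Union>x\<in>X. Euclidean_box n (\<lambda>i. x i - c x) (\<lambda>i. x i + c x))"
        by (intro UN_I[of x]) (auto simp: Euclidean_box_def less_imp_le)
    qed
    moreover have "x \<in> Euclidean_box n (\<lambda>i. x i - c x) (\<lambda>i. x i + c x)" if "x \<in> X" for x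
      using that X KE c[of x] by (auto simp: Euclidean_box_def)
    moreover have "singular_relcycle i ?E (topspace ?E - (\<Union>x\<in>X. Euclidean_box n (\<lambda>i. x i - c x) (\<lambda>i. x i + c x))) z"
      using c X by (intro Q(3)) blast
    ultimately show ?thesis using X(1,2) by blast
  qed
  show ?thesis
    unfolding locally_detected_def
  proof (intro conjI allI impI)
    fix i z assume i: "n < i" and z: "singular_relcycle i ?E (topspace ?E - K) z"
    obtain X c where X: "finite X" "X \<subseteq> K" "K \<subseteq> (\<Union>x\<in>X. Euclidean_box n (\<lambda>i. x i - c x) (\<lambda>i. x i + c x))"
      "singular_relcycle i ?E (topspace ?E - (\<Union>x\<in>X. Euclidean_box n (\<lambda>i. x i - c x) (\<lambda>i. x i + c x))) z"
      using cover[OF z] by blast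
    have "singular_relboundary i ?E (topspace ?E - (\<Union>x\<in>X. Euclidean_box n (\<lambda>i. x i - c x) (\<lambda>i. x i + c x))) z"
      using locally_detected_vanish[OF locally_detected_Union_boxes[OF X(1)] i X(4)] .
    then show "singular_relboundary i ?E (topspace ?E - K) z"
      by (rule singular_relboundary_mono) (use X(3) in blast)
  next
    fix z assume z: "singular_relcycle n ?E (topspace ?E - K) z"
      and zx: "\<forall>x\<in>K. singular_relboundary n ?E (topspace ?E - {x}) z"
    obtain X c where X: "finite X" "X \<subseteq> K" "K \<subseteq> (\<Union>x\<in>X. Euclidean_box n (\<lambda>i. x i - c x) (\<lambda>i. x i + c x))"
      "\<forall>x\<in>X. x \<in> Euclidean_box n (\<lambda>i. x i - c x) (\<lambda>i. x i + c x)"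
      "singular_relcycle n ?E (topspace ?E - (\<Union>x\<in>X. Euclidean_box n (\<lambda>i. x i - c x) (\<lambda>i. x i + c x))) z"
      using cover[OF z] by blast
    \<comment> \<open>The boxes reach beyond \<open>K\<close>, where nothing is assumed about
      \<open>z\<close>. Each is centred at a point of \<open>K\<close>, however, and a box is
      detected at its centre.\<close>
    have "singular_relboundary n ?E (topspace ?E - {y}) z"
      if y: "y \<in> (\<Union>x\<in>X. Euclidean_box n (\<lambda>i. x i - c x) (\<lambda>i. x i + c x))" for y
    proof -
      obtain x where x: "x \<in> X" "y \<in> Euclidean_box n (\<lambda>i. x i - c x) (\<lambda>i. x i + c x)" using y by blast
      let ?B = "Euclidean_box n (\<lambda>i. x i - c x) (\<lambda>i. x i + c x)"
      have "singular_relcycle n ?E (topspace ?E - ?B) z"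
        by (rule singular_relcycle_mono[OF X(5)]) (use x in blast)
      then have "singular_relboundary n ?E (topspace ?E - ?B) z"
        using X(2,4) x(1) zx by (intro pointwise_detectedD[OF pointwise_detected_box, of x]) auto
      then show ?thesis by (rule singular_relboundary_mono) (use x in blast)
    qed
    then have "singular_relboundary n ?E (topspace ?E - (\<Union>x\<in>X. Euclidean_box n (\<lambda>i. x i - c x) (\<lambda>i. x i + c x))) z"
      by (rule locally_detectedD[OF locally_detected_Union_boxes[OF X(1)] X(5)])
    then show "singular_relboundary n ?E (topspace ?E - K) z"
      by (rule singular_relboundary_mono) (use X(3) in blast)
  qed
qed

section \<open>Compact sets in manifolds\<close>

definition locally_Euclidean :: "nat \<Rightarrow> 'a topology \<Rightarrow> bool"
  where "locally_Euclidean n X \<longleftrightarrow>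
    (\<forall>x\<in>topspace X. \<exists>W V. openin X W \<and> x \<in> W \<and> openin (Euclidean_space n) V \<and>
       subtopology X W homeomorphic_space subtopology (Euclidean_space n) V)"

text \<open>\<open>C\<close> is a closed box of a chart and \<open>B\<close> its open interior. The
  open set serves for coverings, the compact one for detection: being closed in \<open>X\<close> it
  admits excision. \<open>Q\<close> keeps \<open>C\<close> inside the region where a given chain is
  still a relative cycle.\<close>

lemma locally_Euclidean_detecting_nbhd:
  assumes H: "Hausdorff_space X" and E: "locally_Euclidean n X" and Q: "openin X Q" "x \<in> Q"
  obtains B C where "openin X B" "x \<in> B" "B \<subseteq> C" "C \<subseteq> Q" "compactin X C" "pointwise_detected n X C"
    "\<And>K. compactin X K \<Longrightarrow> K \<subseteq> C \<Longrightarrow> locally_detected n X K"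
proof -
  let ?E = "Euclidean_space n"
  have "x \<in> topspace X" using openin_subset[OF Q(1)] Q(2) by blast
  then obtain W V f g where W: "openin X W" "x \<in> W" and V: "openin ?E V"
    and fg: "homeomorphic_maps (subtopology X W) (subtopology ?E V) f g"
    using E unfolding locally_Euclidean_def homeomorphic_space_def by meson
  let ?X = "subtopology X W" and ?Y = "subtopology ?E V"
  have tX: "topspace ?X = W" and tY: "topspace ?Y = V"
    using openin_subset[OF W(1)] openin_subset[OF V] by auto
  have f: "continuous_map ?X ?Y f" and g: "continuous_map ?Y ?X g"
    and gf: "\<And>w. w \<in> W \<Longrightarrow> g (f w) = w" and fg': "\<And>v. v \<in> V \<Longrightarrow> f (g v) = v"
    using fg by (auto simp: homeomorphic_maps_def tX tY simp del: topspace_subtopology)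
  have fgs: "homeomorphic_maps ?Y ?X g f" using fg by (rule homeomorphic_maps_sym[THEN iffD1])
  have homf: "homeomorphic_map ?X ?Y f" and homg: "homeomorphic_map ?Y ?X g"
    using fg homeomorphic_maps_map by blast+
  have "openin ?X (W \<inter> Q)" using W Q by (simp add: openin_open_subtopology openin_Int)
  then have "openin ?Y (f ` (W \<inter> Q))"
    using homeomorphic_map_openness_eq[OF homf] by (metis inf_le1 tX)
  then have oV: "openin ?E (f ` (W \<inter> Q))" and sV: "f ` (W \<inter> Q) \<subseteq> V"
    using V by (auto simp: openin_open_subtopology)
  obtain e where e: "e > 0" "Euclidean_box n (\<lambda>i. f x i - e) (\<lambda>i. f x i + e) \<subseteq> f ` (W \<inter> Q)"
    using openin_Euclidean_space_contains_box[OF oV] W Q by blast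
  define D where "D = Euclidean_box n (\<lambda>i. f x i - e) (\<lambda>i. f x i + e)"
  define D0 where "D0 = {y \<in> topspace ?E. \<forall>i<n. f x i - e < y i \<and> y i < f x i + e}"
  have D: "D \<subseteq> V" "D \<subseteq> f ` (W \<inter> Q)" "D0 \<subseteq> D"
    using e(2) sV by (auto simp: D_def D0_def Euclidean_box_def less_imp_le)
  have T1: "t1_space X" using H Hausdorff_imp_t1_space by blast
  have cY: "compactin ?E S" if "compactin ?Y S" for S using that by (simp add: compactin_subtopology)
  have ld: "locally_detected n X K" if K: "compactin X K" "K \<subseteq> W" for K
  proof -
    have "compactin ?X K" using K by (simp add: compactin_subtopology)
    then have fK: "compactin ?Y (f ` K)" using f image_compactin by blast
    then have "f ` K \<subseteq> V" by (metis compactin_subset_topspace tY)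
    moreover have "closedin ?E (f ` K)"
      using compactin_imp_closedin[OF Hausdorff_Euclidean_space cY[OF fK]] .
    ultimately have "locally_detected n ?Y (f ` K)"
      by (intro detected_imp_open_subtopology(1)[OF V] locally_detected_compact_Euclidean[OF cY[OF fK]])
    then have "locally_detected n ?X (g ` f ` K)"
      by (intro detected_homeomorphic_image(1)[OF fgs]) (simp only: tY \<open>f ` K \<subseteq> V\<close>)
    moreover have "g ` f ` K = K"
    proof -
      have "g ` f ` K = (\<lambda>w. w) ` K" unfolding image_image by (rule image_cong) (use gf K(2) in auto)
      then show ?thesis by simp
    qed
    ultimately have "locally_detected n ?X K" by (simp only:)
    then show ?thesis
      by (rule detected_open_subtopology_imp(1)[OF W(1) compactin_imp_closedin[OF H K(1)] K(2) T1])
  qed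
  have "compactin ?Y D" using D compactin_Euclidean_box by (simp add: compactin_subtopology D_def)
  then have gD: "compactin ?X (g ` D)" using g image_compactin by blast
  then have cD: "compactin X (g ` D)" "g ` D \<subseteq> W" by (auto simp: compactin_subtopology)
  have "pointwise_detected n ?Y D"
    by (rule detected_imp_open_subtopology(2)[OF V _ D(1)])
      (simp_all add: D_def closedin_Euclidean_box pointwise_detected_box)
  then have "pointwise_detected n ?X (g ` D)"
    by (intro detected_homeomorphic_image(2)[OF fgs]) (simp only: tY D(1))
  then have pd: "pointwise_detected n X (g ` D)"
    by (rule detected_open_subtopology_imp(2)[OF W(1) compactin_imp_closedin[OF H cD(1)] cD(2) T1])
  have "openin ?Y D0"
    using openin_Euclidean_open_box[of n "\<lambda>i. f x i - e" "\<lambda>i. f x i + e"] D V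
    unfolding D0_def[symmetric] by (auto simp: openin_open_subtopology)
  then have "openin ?X (g ` D0)"
    using homeomorphic_map_openness_eq[OF homg, of D0] D(1,3) tY by (metis order_trans)
  then have oB: "openin X (g ` D0)" using W(1) by (simp add: openin_open_subtopology)
  have "f x \<in> topspace ?E" using oV openin_subset W Q by blast
  then have "f x \<in> D0" using e(1) by (auto simp: D0_def)
  then have xB: "x \<in> g ` D0" using gf[OF W(2)] by force
  have "g ` D \<subseteq> Q"
  proof
    fix q assume "q \<in> g ` D"
    then obtain w where "w \<in> W \<inter> Q" "q = g (f w)" using D(2) by auto
    then show "q \<in> Q" using gf by auto
  qed
  then show ?thesis
    using that[OF oB xB image_mono[OF D(3)] _ cD(1) pd] ld cD(2) by (meson order_trans)
qed

text \<open>\<open>K\<close> is cut into its part in \<open>C\<close> and its part in the remaining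
  pieces. The overlap of the two parts is compact and lies in \<open>C\<close> alone, so the
  hypothesis on \<open>C\<close> covers it.\<close>

lemma locally_detected_finite_cover:
  assumes H: "Hausdorff_space X" and "finite \<C>"
    and "\<And>C. C \<in> \<C> \<Longrightarrow> compactin X C"
    and "\<And>C K. C \<in> \<C> \<Longrightarrow> compactin X K \<Longrightarrow> K \<subseteq> C \<Longrightarrow> locally_detected n X K"
    and "compactin X K" "K \<subseteq> \<Union>\<C>"
  shows "locally_detected n X K"
  using assms(2-)
proof (induction \<C> arbitrary: K rule: finite_induct)
  case empty
  then show ?case by (simp add: locally_detected_empty)
next
  case (insert C \<C>)
  have cl: "closedin X S" if "compactin X S" for S using compactin_imp_closedin[OF H that] .
  have U: "compactin X (\<Union>\<C>)" using insert by (intro compactin_Union) auto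
  have 1: "compactin X (K \<inter> \<Union>\<C>)" and 2: "compactin X (K \<inter> C)"
    using insert.prems U cl by (auto intro: compact_Int_closedin)
  have 3: "compactin X ((K \<inter> \<Union>\<C>) \<inter> (K \<inter> C))"
    using 1 2 cl by (blast intro: compact_Int_closedin)
  have "locally_detected n X ((K \<inter> \<Union>\<C>) \<union> (K \<inter> C))"
  proof (rule locally_detected_Un[OF cl[OF 1] cl[OF 2]])
    show "locally_detected n X (K \<inter> \<Union>\<C>)" 
      by (rule insert.IH[OF _ _ 1]) (use insert.prems in \<open>auto simp del: Union_iff\<close>)
    show "locally_detected n X (K \<inter> C)" by (rule insert.prems(2)[OF insertI1 2 Int_lower2])
    show "locally_detected n X ((K \<inter> \<Union>\<C>) \<inter> (K \<inter> C))"
      by (rule insert.prems(2)[OF insertI1 3]) blast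
  qed
  moreover have "(K \<inter> \<Union>\<C>) \<union> (K \<inter> C) = K" using insert.prems(4) by blast
  ultimately show ?case by simp
qed

lemma locally_detected_compact:
  assumes H: "Hausdorff_space X" and E: "locally_Euclidean n X" and K: "compactin X K"
  shows "locally_detected n X K"
proof -
  have "\<exists>B C. openin X B \<and> x \<in> B \<and> B \<subseteq> C \<and> compactin X C \<and>
      (\<forall>K. compactin X K \<longrightarrow> K \<subseteq> C \<longrightarrow> locally_detected n X K)" if "x \<in> topspace X" for x
    using locally_Euclidean_detecting_nbhd[OF H E openin_topspace that] by metis
  then obtain B C where BC: "\<And>x. x \<in> topspace X \<Longrightarrow> openin X (B x) \<and> x \<in> B x \<and> B x \<subseteq> C x \<and>
      compactin X (C x) \<and> (\<forall>K. compactin X K \<longrightarrow> K \<subseteq> C x \<longrightarrow> locally_detected n X K)"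
    by metis
  have KX: "K \<subseteq> topspace X" using K by (rule compactin_subset_topspace)
  have "\<exists>\<F>. finite \<F> \<and> \<F> \<subseteq> B ` K \<and> K \<subseteq> \<Union>\<F>"
  proof -
    have "K \<subseteq> \<Union>(B ` K)" using BC KX by blast
    moreover have "openin X S" if "S \<in> B ` K" for S using that BC KX by blast
    ultimately show ?thesis using K unfolding compactin_def by meson
  qed
  then obtain \<F> where F: "finite \<F>" "\<F> \<subseteq> B ` K" "K \<subseteq> \<Union>\<F>" by blast
  obtain T where T: "T \<subseteq> K" "finite T" "\<F> = B ` T" using finite_subset_image[OF F(1,2)] by blast
  show ?thesis
  proof (rule locally_detected_finite_cover[OF H, of "C ` T"])
    show "K \<subseteq> \<Union>(C ` T)" using F(3) T BC KX by blast
    show "compactin X S" if "S \<in> C ` T" for S using that T BC KX by blast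
    show "locally_detected n X K'" if "S \<in> C ` T" "compactin X K'" "K' \<subseteq> S" for S K'
      using that T BC KX by blast
  qed (use T K in auto)
qed

text \<open>Nullity of \<open>z\<close> at a point is locally constant along \<open>K\<close>: near
  each point there is a compact \<open>C\<close> detected at any of its points, chosen in a
  neighbourhood \<open>Q\<close> of \<open>K\<close> where \<open>z\<close> is still a relative
  cycle. Connectedness does the rest.\<close>

lemma relboundary_of_null_at_point:
  assumes H: "Hausdorff_space X" and E: "locally_Euclidean n X"
    and K: "compactin X K" "connectedin X K"
    and z: "singular_relcycle n X (topspace X - K) z"
    and y: "y \<in> K" "singular_relboundary n X (topspace X - {y}) z"
  shows "singular_relboundary n X (topspace X - K) z"
proof (rule locally_detectedD[OF locally_detected_compact[OF H E K(1)] z])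
  have KX: "K \<subseteq> topspace X" using K(1) by (rule compactin_subset_topspace)
  let ?P = "\<lambda>x. singular_relboundary n X (topspace X - {x}) z"
  obtain Q where Q: "openin X Q" "K \<subseteq> Q" "\<And>B. B \<subseteq> Q \<Longrightarrow> singular_relcycle n X (topspace X - B) z"
    using relcycle_avoids_nbhd[OF H z KX] by blast
  have "\<exists>B. openin X B \<and> x \<in> B \<and> (\<forall>x'\<in>B. \<forall>x''\<in>B. ?P x' \<longrightarrow> ?P x'')" if "x \<in> K" for x
  proof -
    have "x \<in> Q" using that Q(2) by blast
    then obtain B C where BC: "openin X B" "x \<in> B" "B \<subseteq> C" "C \<subseteq> Q" "pointwise_detected n X C"
      using locally_Euclidean_detecting_nbhd[OF H E Q(1)] by metis
    have "?P x''" if "x' \<in> B" "x'' \<in> B" "?P x'" for x' x''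
    proof -
      have "singular_relboundary n X (topspace X - C) z"
        by (rule pointwise_detectedD[OF BC(5) subsetD[OF BC(3) that(1)] Q(3)[OF BC(4)] that(3)])
      then show ?thesis by (rule singular_relboundary_mono) (use that(2) BC(3) in blast)
    qed
    then show ?thesis using BC(1,2) by blast
  qed
  then obtain B where B: "\<And>x. x \<in> K \<Longrightarrow> openin X (B x) \<and> x \<in> B x \<and> (\<forall>x'\<in>B x. \<forall>x''\<in>B x. ?P x' \<longrightarrow> ?P x'')"
    by metis
  let ?U = "\<Union>(B ` {x\<in>K. ?P x})" and ?V = "\<Union>(B ` {x\<in>K. \<not> ?P x})"
  have "openin X ?U" "openin X ?V" using B by blast+
  moreover have "?U \<inter> ?V = {}"
  proof (rule ccontr)
    assume "?U \<inter> ?V \<noteq> {}"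
    then obtain q x x' where q: "x \<in> K" "?P x" "q \<in> B x" "x' \<in> K" "\<not> ?P x'" "q \<in> B x'" by blast
    have "?P q" using B[OF q(1)] q by blast
    then show False using B[OF q(4)] q by blast
  qed
  moreover have "K \<subseteq> ?U \<union> ?V" using B by blast
  moreover have "?U \<inter> K \<noteq> {}" using B y by blast
  ultimately have V: "?V \<inter> K = {}" using K(2) unfolding connectedin by blast
  show "?P x" if "x \<in> K" for x using V B that by blast
qed

section \<open>Manifolds with boundary\<close>

lemma topspace_half_space: "topspace (half_space n) = {x \<in> topspace (Euclidean_space n). 0 \<le> x 0}"
  by (auto simp: half_space_def)

lemma manifold_chart:
  assumes "manifold_with_boundary n M" and "x \<in> topspace M"
  obtains W V f g where "openin M W" "x \<in> W" "openin (half_space n) V"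
    "homeomorphic_maps (subtopology M W) (subtopology (half_space n) V) f g"
  using assms unfolding manifold_with_boundary_def homeomorphic_space_def by meson

text \<open>Off the bounding hyperplane the chart shrinks into the open half space, which is open in
  Euclidean space. The condition \<open>n > 0\<close> is there because in dimension 0 coordinate 0
  is always 0 while every point is interior.\<close>

lemma manifold_boundary_chart:
  assumes W: "openin M W" and V: "openin (half_space n) V"
    and fg: "homeomorphic_maps (subtopology M W) (subtopology (half_space n) V) f g"
    and w: "w \<in> W"
  shows "w \<in> manifold_boundary n M \<longleftrightarrow> n > 0 \<and> f w 0 = 0"
proof -
  let ?E = "Euclidean_space n"
  let ?X = "subtopology M W" and ?Y = "subtopology (half_space n) V"
  have tX: "topspace ?X = W" and tY: "topspace ?Y = V"
    using openin_subset[OF W] openin_subset[OF V] by auto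
  have f: "continuous_map ?X ?Y f" and g: "continuous_map ?Y ?X g"
    and gf: "\<And>w. w \<in> W \<Longrightarrow> g (f w) = w" and fg': "\<And>v. v \<in> V \<Longrightarrow> f (g v) = v"
    using fg by (auto simp: homeomorphic_maps_def tX tY simp del: topspace_subtopology)
  have homf: "homeomorphic_map ?X ?Y f"
    using fg homeomorphic_maps_map by blast
  have fV: "f w \<in> V" if "w \<in> W" for w using f that tX tY by (auto simp: continuous_map_def)
  have Vh: "v \<in> topspace ?E" "0 \<le> v 0" if "v \<in> V" for v
    using openin_subset[OF V] that by (auto simp: topspace_half_space)
  have fw: "f w \<in> V" "0 \<le> f w 0" using fV[OF w] Vh by auto
  have wM: "w \<in> topspace M" using W w openin_subset by blast
  obtain T where T: "openin ?E T" "V = T \<inter> {x. 0 \<le> x 0}"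
    using V unfolding half_space_def openin_subtopology by blast
  have co: "continuous_map ?E euclideanreal (\<lambda>y. y 0)"
    unfolding Euclidean_space_def
    by (intro continuous_map_from_subtopology continuous_map_product_projection) auto
  show ?thesis
  proof (cases "n > 0 \<and> f w 0 = 0")
    case False
    \<comment> \<open>For \<open>n = 0\<close> the half space is all of the one-point Euclidean
      space, so \<open>V\<close> is already open there and nothing is cut off.\<close>
    define V' where "V' = (if n = 0 then V else V \<inter> {x \<in> topspace ?E. x 0 \<in> {0<..}})"
    have oE: "openin ?E V'"
    proof (cases "n = 0")
      case True
      then have "T \<subseteq> {x. 0 \<le> x 0}" using openin_subset[OF T(1)] by (auto simp: topspace_Euclidean_space)
      then have "V = T" using T(2) by blast
      then show ?thesis using T(1) True by (simp add: V'_def)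
    next
      case False
      have "openin ?E {x \<in> topspace ?E. x 0 \<in> {0<..}}"
        by (rule openin_continuous_map_preimage[OF co]) simp
      moreover have "V' = T \<inter> {x \<in> topspace ?E. x 0 \<in> {0<..}}" using T(2) False by (auto simp: V'_def)
      ultimately show ?thesis using T(1) by (simp add: openin_Int)
    qed
    have V'V: "V' \<subseteq> V" by (auto simp: V'_def)
    have fwV': "f w \<in> V'" using False fw Vh by (auto simp: V'_def order_le_less)
    have "openin (half_space n) V'"
      using oE V'V V Vh unfolding half_space_def openin_subtopology by blast
    then have "openin ?Y V'" using V V'V by (simp add: openin_open_subtopology)
    then have "openin ?X {w \<in> topspace ?X. f w \<in> V'}" by (rule openin_continuous_map_preimage[OF f])
    then have "openin ?X {w \<in> W. f w \<in> V'}" unfolding tX .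
    then have oW': "openin M {w \<in> W. f w \<in> V'}" using W by (simp add: openin_open_subtopology)
    have im: "f ` {w \<in> W. f w \<in> V'} = V'"
    proof
      show "V' \<subseteq> f ` {w \<in> W. f w \<in> V'}"
      proof
        fix v assume v: "v \<in> V'"
        then have "v \<in> V" using V'V by blast
        then have "g v \<in> W" "f (g v) = v" using g fg' tX tY by (auto simp: continuous_map_def)
        then show "v \<in> f ` {w \<in> W. f w \<in> V'}" using v by force
      qed
    qed auto
    have "homeomorphic_map (subtopology ?X {w \<in> W. f w \<in> V'}) (subtopology ?Y V') f"
      using homeomorphic_map_subtopologies[OF homf, of "{w \<in> W. f w \<in> V'}" V'] im tX tY V'V
      by (simp add: Int_absorb1 Int_absorb2 Collect_conj_eq)
    moreover have "subtopology ?X {w \<in> W. f w \<in> V'} = subtopology M {w \<in> W. f w \<in> V'}"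
      by (simp add: subtopology_subtopology Int_absorb1)
    moreover have "subtopology ?Y V' = subtopology ?E V'"
    proof -
      have "{x. 0 \<le> x 0} \<inter> (V \<inter> V') = V'" using V'V Vh by auto
      then show ?thesis by (simp add: half_space_def subtopology_subtopology Int_assoc)
    qed
    ultimately have "subtopology M {w \<in> W. f w \<in> V'} homeomorphic_space subtopology ?E V'"
      by (metis homeomorphic_map_imp_homeomorphic_space)
    then have "w \<in> manifold_interior n M"
      unfolding manifold_interior_def using oW' oE w fwV' by blast
    then show ?thesis using False by (simp add: manifold_boundary_def)
  next
    case True
    \<comment> \<open>At an interior point, invariance of domain would make the image of the chart reach below the
      bounding hyperplane.\<close>
    have "w \<notin> manifold_interior n M"
    proof
      assume "w \<in> manifold_interior n M"
      then obtain W1 V1 h k where W1: "openin M W1" "w \<in> W1" and V1: "openin ?E V1"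
        and hk: "homeomorphic_maps (subtopology M W1) (subtopology ?E V1) h k"
        unfolding manifold_interior_def homeomorphic_space_def by blast
      let ?X1 = "subtopology M W1" and ?Y1 = "subtopology ?E V1"
      have tX1: "topspace ?X1 = W1" and tY1: "topspace ?Y1 = V1"
        using openin_subset[OF W1(1)] openin_subset[OF V1] by auto
      have h: "continuous_map ?X1 ?Y1 h" and k: "continuous_map ?Y1 ?X1 k"
        and kh: "\<And>w. w \<in> W1 \<Longrightarrow> k (h w) = w" and hk': "\<And>v. v \<in> V1 \<Longrightarrow> h (k v) = v"
        using hk by (auto simp: homeomorphic_maps_def tX1 tY1 simp del: topspace_subtopology)
      have homh: "homeomorphic_map ?X1 ?Y1 h" using hk homeomorphic_maps_map by blast
      let ?S = "h ` (W \<inter> W1)"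
      have "openin ?X1 (W \<inter> W1)" using W W1 by (simp add: openin_open_subtopology openin_Int)
      then have "openin ?Y1 ?S" using homeomorphic_map_openness_eq[OF homh] by (metis inf_le2 tX1)
      then have S: "openin ?E ?S" "?S \<subseteq> V1" using V1 by (auto simp: openin_open_subtopology)
      have kS: "k \<in> ?S \<rightarrow> W" using kh by auto
      have "continuous_map (subtopology ?E ?S) ?X1 k"
        using continuous_map_from_subtopology_mono[OF k S(2)] .
      then have "continuous_map (subtopology ?E ?S) M k" using continuous_map_into_fulltopology by blast
      then have "continuous_map (subtopology ?E ?S) ?X k"
        by (rule continuous_map_into_subtopology) (use kS in auto)
      then have "continuous_map (subtopology ?E ?S) ?Y (f \<circ> k)" using f by (rule continuous_map_compose)
      then have "continuous_map (subtopology ?E ?S) ?E (f \<circ> k)"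
        unfolding half_space_def using continuous_map_into_fulltopology by blast
      moreover have "inj_on (f \<circ> k) ?S"
      proof (rule inj_onI)
        fix u v assume uv: "u \<in> ?S" "v \<in> ?S" "(f \<circ> k) u = (f \<circ> k) v"
        then have "k u \<in> W" "k v \<in> W" using kS by auto
        then have "k u = k v" using gf uv(3) by (metis comp_apply)
        then show "u = v" using hk' S(2) uv by (metis subsetD)
      qed
      ultimately have op: "openin ?E ((f \<circ> k) ` ?S)"
        using invariance_of_domain_Euclidean_space[OF S(1)] by blast
      have "(f \<circ> k) (h w) = f w" using kh W1(2) by simp
      moreover have "h w \<in> ?S" using w W1(2) by blast
      ultimately have "f w \<in> (f \<circ> k) ` ?S" by (metis imageI)
      then obtain e where e: "e > 0" "Euclidean_box n (\<lambda>i. f w i - e) (\<lambda>i. f w i + e) \<subseteq> (f \<circ> k) ` ?S"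
        using openin_Euclidean_space_contains_box[OF op] by blast
      have "(f w)(0 := - e) \<in> Euclidean_box n (\<lambda>i. f w i - e) (\<lambda>i. f w i + e)"
        using Vh[OF fw(1)] True e(1) by (auto simp: Euclidean_box_def topspace_Euclidean_space)
      then have "(f w)(0 := - e) \<in> (f \<circ> k) ` ?S" using e(2) by blast
      then obtain s where s: "(f w)(0 := - e) = (f \<circ> k) s" "s \<in> ?S" by (rule imageE)
      then have "f (k s) \<in> V" using fV s(2) kS by blast
      then have "0 \<le> (f (k s)) 0" using Vh by blast
      moreover have "f (k s) 0 = - e" using fun_cong[OF s(1), of 0] by simp
      ultimately show False using e(1) by simp
    qed
    then show ?thesis using True wM by (simp add: manifold_boundary_def)
  qed
qed

text \<open>Raising coordinate 0 in a chart stays in the half space and leaves the hyperplane. This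
  replaces an avoided point on the boundary by an avoided interior point.\<close>

lemma manifold_interior_dense:
  assumes M: "manifold_with_boundary n M" and Q: "openin M Q" "y \<in> Q"
  obtains y' where "y' \<in> Q" "y' \<in> topspace M - manifold_boundary n M"
proof -
  have "y \<in> topspace M" using openin_subset Q by blast
  then obtain W V f g where W: "openin M W" "y \<in> W" and V: "openin (half_space n) V"
    and fg: "homeomorphic_maps (subtopology M W) (subtopology (half_space n) V) f g"
    using manifold_chart[OF M] by metis
  have bd: "w \<in> manifold_boundary n M \<longleftrightarrow> n > 0 \<and> f w 0 = 0" if "w \<in> W" for w
    using manifold_boundary_chart[OF W(1) V fg that] .
  show ?thesis
  proof (cases "n = 0")
    case True
    then show ?thesis using that Q W bd \<open>y \<in> topspace M\<close> by blast
  next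
    case False
    let ?X = "subtopology M W" and ?Y = "subtopology (half_space n) V"
    have tX: "topspace ?X = W" and tY: "topspace ?Y = V"
      using openin_subset[OF W(1)] openin_subset[OF V] by auto
    have f: "continuous_map ?X ?Y f" and gf: "\<And>w. w \<in> W \<Longrightarrow> g (f w) = w" and fg': "\<And>v. v \<in> V \<Longrightarrow> f (g v) = v"
      using fg by (auto simp: homeomorphic_maps_def tX tY simp del: topspace_subtopology)
    have homf: "homeomorphic_map ?X ?Y f" using fg homeomorphic_maps_map by blast
    have "openin ?X (W \<inter> Q)" using W Q by (simp add: openin_open_subtopology openin_Int)
    then have "openin ?Y (f ` (W \<inter> Q))"
      using homeomorphic_map_openness_eq[OF homf] by (metis inf_le1 tX)
    then have "openin (half_space n) (f ` (W \<inter> Q))" using V by (simp add: openin_open_subtopology)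
    then obtain T where T: "openin (Euclidean_space n) T" "f ` (W \<inter> Q) = T \<inter> {x. 0 \<le> x 0}"
      unfolding half_space_def openin_subtopology by blast
    have fy: "f y \<in> T" "0 \<le> f y 0" using T(2) W(2) Q(2) by auto
    obtain e where e: "e > 0" "Euclidean_box n (\<lambda>i. f y i - e) (\<lambda>i. f y i + e) \<subseteq> T"
      using openin_Euclidean_space_contains_box[OF T(1) fy(1)] by blast
    have "f y \<in> topspace (Euclidean_space n)" using fy(1) openin_subset[OF T(1)] by blast
    then have "(f y)(0 := f y 0 + e) \<in> Euclidean_box n (\<lambda>i. f y i - e) (\<lambda>i. f y i + e)"
      using False e(1) by (auto simp: Euclidean_box_def topspace_Euclidean_space)
    then have "(f y)(0 := f y 0 + e) \<in> f ` (W \<inter> Q)" unfolding T(2) using e fy by auto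
    then obtain y' where "(f y)(0 := f y 0 + e) = f y'" "y' \<in> W \<inter> Q" by (rule imageE)
    then have y': "y' \<in> W" "y' \<in> Q" "f y' = (f y)(0 := f y 0 + e)" by auto
    have "f y' 0 > 0" using y'(3) e(1) fy(2) by simp
    then have "y' \<notin> manifold_boundary n M" using bd[OF y'(1)] by simp
    then show ?thesis using that[OF y'(2)] y'(1) openin_subset[OF W(1)] by blast
  qed
qed

text \<open>When \<open>D\<close> is the boundary of \<open>M\<close>, attaching the collar yields a manifold without boundary.\<close>

definition external_collar :: "'a topology \<Rightarrow> 'a set \<Rightarrow> ('a \<times> real) topology"
  where "external_collar M D =
    subtopology (prod_topology M euclideanreal) (topspace M \<times> {0} \<union> D \<times> {0..})"

lemma topspace_external_collar:
  assumes "D \<subseteq> topspace M"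
  shows "topspace (external_collar M D) = topspace M \<times> {0} \<union> D \<times> {0..}"
  using assms by (auto simp: external_collar_def)

lemma Hausdorff_external_collar:
  assumes "Hausdorff_space M"
  shows "Hausdorff_space (external_collar M D)"
  unfolding external_collar_def
  by (intro Hausdorff_space_subtopology) (simp add: Hausdorff_space_prod_topology assms Hausdorff_space_euclidean)

text \<open>Subtracting the collar height from coordinate 0 continues the chart below the
  hyperplane: over \<open>D\<close> that coordinate is 0, so height \<open>s\<close> becomes
  \<open>- s\<close>. The inverse recovers the base point by clamping and the height as
  \<open>max 0 (- v 0)\<close>.\<close>

lemma external_collar_chart:
  assumes W: "openin M W" and V: "openin (half_space n) V"
    and fg: "homeomorphic_maps (subtopology M W) (subtopology (half_space n) V) f g"
    and D: "D = manifold_boundary n M" and n: "n > 0"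
  defines "N \<equiv> external_collar M D"
  obtains S where "openin (Euclidean_space n) S"
    "subtopology N (W \<times> UNIV) homeomorphic_space subtopology (Euclidean_space n) S"
proof -
  let ?E = "Euclidean_space n" and ?H = "half_space n"
  let ?X = "subtopology M W" and ?Y = "subtopology ?H V"
  have tX: "topspace ?X = W" and tY: "topspace ?Y = V"
    using openin_subset[OF W] openin_subset[OF V] by auto
  have f: "continuous_map ?X ?Y f" and g: "continuous_map ?Y ?X g"
    and gf: "\<And>w. w \<in> W \<Longrightarrow> g (f w) = w" and fg': "\<And>v. v \<in> V \<Longrightarrow> f (g v) = v"
    using fg by (auto simp: homeomorphic_maps_def tX tY simp del: topspace_subtopology)
  have fV: "f w \<in> V" if "w \<in> W" for w using f that tX tY by (auto simp: continuous_map_def)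
  have gW: "g v \<in> W" if "v \<in> V" for v using g that tX tY by (auto simp: continuous_map_def)
  have Vh: "v \<in> topspace ?E" "0 \<le> v 0" if "v \<in> V" for v
    using openin_subset[OF V] that by (auto simp: topspace_half_space)
  have WM: "W \<subseteq> topspace M" using openin_subset[OF W] .
  have bd: "w \<in> D \<longleftrightarrow> f w 0 = 0" if "w \<in> W" for w
    using manifold_boundary_chart[OF W V fg that] n D by simp
  have DM: "D \<subseteq> topspace M" by (auto simp: D manifold_boundary_def)
  \<comment> \<open>The retraction of Euclidean space onto the half space. Its continuity makes the
    enlarged chart domain \<open>S\<close>, the preimage of \<open>V\<close>, open.\<close>
  define clamp where "clamp v = (\<lambda>i. if i < n then (if i = 0 then max 0 (v 0) else v i) else 0)" for v :: "nat \<Rightarrow> real"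
  define S where "S = {v \<in> topspace ?E. clamp v \<in> V}"
  have co: "continuous_map ?E euclideanreal (\<lambda>y. y i)" for i
    unfolding Euclidean_space_def
    by (intro continuous_map_from_subtopology continuous_map_product_projection) auto
  have "continuous_map ?E ?E clamp"
    unfolding clamp_def continuous_map_componentwise_Euclidean_space
  proof (intro allI impI)
    fix i show "continuous_map ?E euclideanreal (\<lambda>v. if i = 0 then max 0 (v 0) else v i)"
    proof (cases "i = 0")
      case True
      then show ?thesis using continuous_map_real_max[OF _ co[of 0], of "\<lambda>_. 0"] by simp
    qed (simp add: co)
  qed
  then have cH: "continuous_map ?E ?H clamp"
    unfolding half_space_def by (rule continuous_map_into_subtopology) (auto simp: clamp_def)
  have oS: "openin ?E S" unfolding S_def by (rule openin_continuous_map_preimage[OF cH V])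
  have tS: "topspace (subtopology ?E S) = S" using openin_subset[OF oS] by auto
  have cl: "clamp v = v" if "v \<in> topspace ?E" "0 \<le> v 0" for v
    using that by (auto simp: clamp_def topspace_Euclidean_space fun_eq_iff max_def)
  let ?NW = "subtopology N (W \<times> UNIV)"
  have tNW: "topspace ?NW = W \<times> {0} \<union> (D \<inter> W) \<times> {0..}"
    using WM by (auto simp: N_def topspace_external_collar[OF DM])
  have NW: "?NW = subtopology (prod_topology M euclideanreal) (W \<times> {0} \<union> (D \<inter> W) \<times> {0..})"
  proof -
    have "(topspace M \<times> {0} \<union> D \<times> {0..}) \<inter> W \<times> UNIV = W \<times> {0} \<union> (D \<inter> W) \<times> {0::real..}"
      using WM by auto
    then show ?thesis by (simp add: N_def external_collar_def subtopology_subtopology)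
  qed
  define F where "F z = (\<lambda>i. if i < n then (if i = 0 then f (fst z) 0 - snd z else f (fst z) i) else 0)"
    for z :: "'a \<times> real"
  define G where "G v = (g (clamp v), max 0 (- v 0))" for v
  have FS: "F z \<in> S \<and> G (F z) = z" if z: "z \<in> topspace ?NW" for z
  proof -
    obtain w s where zw: "z = (w, s)" by (cases z)
    have w: "w \<in> W" and s: "s = 0 \<or> s \<ge> 0 \<and> f w 0 = 0" using z bd unfolding zw tNW by auto
    have fw: "f w \<in> topspace ?E" "0 \<le> f w 0" using Vh[OF fV[OF w]] by auto
    have "clamp (F z) = f w"
      using fw s n by (auto simp: clamp_def F_def zw topspace_Euclidean_space fun_eq_iff max_def)
    moreover have "max 0 (- F z 0) = s" using s fw n by (auto simp: F_def zw max_def)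
    moreover have "F z \<in> topspace ?E" by (auto simp: F_def topspace_Euclidean_space)
    ultimately show ?thesis using fV[OF w] gf[OF w] by (auto simp: S_def G_def zw)
  qed
  have GN: "G v \<in> topspace ?NW \<and> F (G v) = v" if v: "v \<in> S" for v
  proof -
    have vE: "v \<in> topspace ?E" and cV: "clamp v \<in> V" using v by (auto simp: S_def)
    have fgc: "f (g (clamp v)) = clamp v" using fg'[OF cV] .
    \<comment> \<open>Below the hyperplane, clamping gives coordinate 0 the value 0, so the base
      point lies on \<open>D\<close>, where positive heights exist.\<close>
    have 1: "max 0 (- v 0) = 0 \<or> g (clamp v) \<in> D"
      using bd[OF gW[OF cV]] fgc n by (auto simp: clamp_def max_def)
    then have "G v \<in> topspace ?NW" using gW[OF cV] unfolding tNW by (auto simp: G_def)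
    moreover have "F (G v) = (\<lambda>i. if i < n then (if i = 0 then clamp v 0 - max 0 (- v 0) else clamp v i) else 0)"
      unfolding F_def G_def fst_conv snd_conv fgc ..
    moreover have "\<dots> = v"
      using vE n by (auto simp: clamp_def topspace_Euclidean_space fun_eq_iff max_def)
    ultimately show ?thesis by simp
  qed
  have cF: "continuous_map ?NW (subtopology ?E S) F"
  proof (rule continuous_map_into_subtopology)
    have 1: "continuous_map ?NW M fst"
      unfolding NW by (intro continuous_map_from_subtopology continuous_map_fst)
    have 2: "continuous_map ?NW euclideanreal snd"
      unfolding NW by (intro continuous_map_from_subtopology continuous_map_snd)
    have "continuous_map ?NW ?X fst" by (rule continuous_map_into_subtopology[OF 1]) (auto simp: tNW simp del: topspace_subtopology)
    then have "continuous_map ?NW ?Y (f \<circ> fst)" using f by (rule continuous_map_compose)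
    then have "continuous_map ?NW ?E (f \<circ> fst)"
      unfolding half_space_def using continuous_map_into_fulltopology by blast
    then have 3: "continuous_map ?NW euclideanreal (\<lambda>z. f (fst z) i)" for i
      using continuous_map_compose[OF _ co[of i]] by (force simp: o_def)
    show "continuous_map ?NW ?E F"
      unfolding F_def continuous_map_componentwise_Euclidean_space
    proof (intro allI impI)
      fix i show "continuous_map ?NW euclideanreal (\<lambda>z. if i = 0 then f (fst z) 0 - snd z else f (fst z) i)"
        by (cases "i = 0") (simp_all add: 3 2 continuous_map_diff)
    qed
    show "F \<in> topspace ?NW \<rightarrow> S" using FS by blast
  qed
  have cG: "continuous_map (subtopology ?E S) ?NW G"
    unfolding NW
  proof (rule continuous_map_into_subtopology)
    have "continuous_map (subtopology ?E S) ?H clamp" using cH by (rule continuous_map_from_subtopology)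
    then have "continuous_map (subtopology ?E S) ?Y clamp"
      by (rule continuous_map_into_subtopology) (auto simp: S_def)
    then have "continuous_map (subtopology ?E S) ?X (g \<circ> clamp)" using g by (rule continuous_map_compose)
    then have 1: "continuous_map (subtopology ?E S) M (g \<circ> clamp)" using continuous_map_into_fulltopology by blast
    have 2: "continuous_map (subtopology ?E S) euclideanreal (\<lambda>v. max 0 (- v 0))"
      by (intro continuous_map_from_subtopology continuous_map_real_max continuous_map_minus co) simp
    show "continuous_map (subtopology ?E S) (prod_topology M euclideanreal) G"
      using 1 2 unfolding G_def continuous_map_pairwise by (simp add: o_def)
    show "G \<in> topspace (subtopology ?E S) \<rightarrow> W \<times> {0} \<union> (D \<inter> W) \<times> {0..}"
      using GN unfolding tS tNW by blast
  qed
  have "homeomorphic_maps ?NW (subtopology ?E S) F G"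
    unfolding homeomorphic_maps_def using cF cG FS GN unfolding tS by blast
  then show ?thesis using that[OF oS] unfolding homeomorphic_space_def by blast
qed

lemma locally_Euclidean_external_collar:
  assumes M: "manifold_with_boundary n M" and D: "D = manifold_boundary n M"
  shows "locally_Euclidean n (external_collar M D)"
  unfolding locally_Euclidean_def
proof
  let ?N = "external_collar M D"
  have DM: "D \<subseteq> topspace M" by (auto simp: D manifold_boundary_def)
  fix z assume z: "z \<in> topspace ?N"
  have co: "openin ?N (topspace ?N \<inter> W \<times> UNIV)" if "openin M W" for W
    unfolding external_collar_def openin_subtopology
    by (rule exI[of _ "W \<times> UNIV"]) (use that openin_subset[OF that] DM in \<open>auto simp: openin_prod_Times_iff\<close>)
  have sub: "subtopology ?N (topspace ?N \<inter> W \<times> UNIV) = subtopology ?N (W \<times> UNIV)" for W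
    using subtopology_restrict by blast
  obtain w s where zw: "z = (w, s)" by (cases z)
  have wM: "w \<in> topspace M" using z DM by (auto simp: zw topspace_external_collar[OF DM])
  show "\<exists>W V. openin ?N W \<and> z \<in> W \<and> openin (Euclidean_space n) V \<and>
    subtopology ?N W homeomorphic_space subtopology (Euclidean_space n) V"
  proof (cases "w \<in> D")
    case True
    obtain W V f g where W: "openin M W" "w \<in> W" and V: "openin (half_space n) V"
      and fg: "homeomorphic_maps (subtopology M W) (subtopology (half_space n) V) f g"
      using manifold_chart[OF M wM] by metis
    have n: "n > 0" using manifold_boundary_chart[OF W(1) V fg W(2)] True D by simp
    obtain S where "openin (Euclidean_space n) S"
      "subtopology ?N (W \<times> UNIV) homeomorphic_space subtopology (Euclidean_space n) S"
      using external_collar_chart[OF W(1) V fg D n] by metis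
    then show ?thesis using co[OF W(1)] sub W(2) z zw
      by (intro exI[of _ "topspace ?N \<inter> W \<times> UNIV"] exI[of _ S]) simp
  next
    case False
    then have "w \<in> manifold_interior n M" using wM by (simp add: D manifold_boundary_def)
    then obtain W V where W: "openin M W" "w \<in> W" and V: "openin (Euclidean_space n) V"
      and WV: "subtopology M W homeomorphic_space subtopology (Euclidean_space n) V"
      unfolding manifold_interior_def by blast
    \<comment> \<open>The chart on \<open>W\<close> witnesses that every point of \<open>W\<close>
      is interior, so there is no collar above \<open>W\<close>.\<close>
    have WD: "W \<inter> D = {}" using W(1) V WV by (auto simp: D manifold_boundary_def manifold_interior_def)
    have WM: "W \<subseteq> topspace M" using openin_subset[OF W(1)] .
    have NW: "subtopology ?N (W \<times> UNIV) = subtopology (prod_topology M euclideanreal) (W \<times> {0})"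
    proof -
      have "(topspace M \<times> {0} \<union> D \<times> {0..}) \<inter> W \<times> UNIV = W \<times> {0::real}" using WD WM by auto
      then show ?thesis by (simp add: external_collar_def subtopology_subtopology)
    qed
    have "homeomorphic_maps (subtopology ?N (W \<times> UNIV)) (subtopology M W) fst (\<lambda>w. (w, 0))"
      unfolding homeomorphic_maps_def NW
    proof (intro conjI ballI)
      show "continuous_map (subtopology (prod_topology M euclideanreal) (W \<times> {0})) (subtopology M W) fst"
        by (intro continuous_map_into_subtopology continuous_map_from_subtopology continuous_map_fst) auto
      show "continuous_map (subtopology M W) (subtopology (prod_topology M euclideanreal) (W \<times> {0})) (\<lambda>w. (w, 0))"
        by (intro continuous_map_into_subtopology continuous_map_from_subtopology)
          (auto simp: continuous_map_pairwise o_def)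
    qed auto
    then have "subtopology ?N (W \<times> UNIV) homeomorphic_space subtopology (Euclidean_space n) V"
      using WV homeomorphic_space_trans unfolding homeomorphic_space_def[of "subtopology ?N (W \<times> UNIV)" "subtopology M W"] 
      by (metis homeomorphic_space_def)
    then show ?thesis using co[OF W(1)] sub W(2) z zw V
      by (intro exI[of _ "topspace ?N \<inter> W \<times> UNIV"] exI[of _ V]) simp
  qed
qed

text \<open>Pushing the boundary of the relative cycle into the collar makes it a relative cycle modulo the
  complement of \<open>M\<close>, where it can be detected at any single point; projecting the collar to the
  boundary brings the conclusion back to \<open>M\<close>.\<close>

theorem relboundary_of_relcycle_avoiding_point:
  assumes M: "manifold_with_boundary n M" and comp: "compact_space M" and conn: "connected_space M"
    and D: "D = manifold_boundary n M"
    and c: "singular_relcycle n M D c"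
    and y: "y \<in> topspace M" "singular_chain n (subtopology M (topspace M - {y})) c"
  shows "singular_relboundary n M D c"
proof -
  have H: "Hausdorff_space M" using M by (simp add: manifold_with_boundary_def)
  have DM: "D \<subseteq> topspace M" by (auto simp: D manifold_boundary_def)
  let ?N = "external_collar M D"
  let ?S = "chain_support n c"
  let ?b = "chain_boundary n c"
  have tN: "topspace ?N = topspace M \<times> {0} \<union> D \<times> {0..}" by (rule topspace_external_collar[OF DM])
  have cM: "singular_chain n M c" and bD: "singular_chain (n - 1) (subtopology M D) ?b"
    using c by (auto simp: singular_relcycle)
  \<comment> \<open>The avoided point is moved off \<open>D\<close>, because the chain
    \<open>h\<close> constructed below runs through the collar and may meet \<open>D\<close> at
    height 0. The support of \<open>c\<close> is closed, which leaves room for this.\<close>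
  have "closedin M ?S" using compactin_imp_closedin[OF H compactin_chain_support[OF cM]] .
  then have "openin M (topspace M - ?S)" by blast
  moreover have "y \<in> topspace M - ?S" using y by (auto simp: singular_chain_subtopology_support)
  ultimately obtain y' where y': "y' \<in> topspace M - ?S" "y' \<in> topspace M - D"
    using manifold_interior_dense[OF M] D by metis
  let ?i = "\<lambda>w. (w, 0::real)" and ?j = "\<lambda>w. (w, 1::real)"
  have i: "continuous_map M ?N ?i"
    unfolding external_collar_def
    by (intro continuous_map_into_subtopology) (auto simp: continuous_map_pairwise o_def)
  let ?Y = "subtopology ?N (D \<times> {0..})"
  \<comment> \<open>The homotopy lifts \<open>D\<close> from height 0 to height 1. Empty subspaces
    make it a homotopy of absolute maps, suited to the absolute cycle \<open>?b\<close>.\<close>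
  have hom: "homotopic_with (\<lambda>h. h \<in> {} \<rightarrow> {}) (subtopology M D) ?Y ?i ?j"
    unfolding homotopic_with_def
  proof (intro exI conjI allI ballI)
    let ?h = "\<lambda>z::real \<times> 'a. (snd z, fst z)"
    have 1: "continuous_map (prod_topology (top_of_set {0..1}) (subtopology M D)) M snd"
      using continuous_map_into_fulltopology[OF continuous_map_snd] by blast
    have 2: "continuous_map (prod_topology (top_of_set {0..1::real}) (subtopology M D)) euclideanreal fst"
      using continuous_map_into_fulltopology[OF continuous_map_fst] by blast
    have "continuous_map (prod_topology (top_of_set {0..1}) (subtopology M D)) (prod_topology M euclideanreal) ?h"
      using 1 2 by (simp add: continuous_map_pairwise o_def)
    then show "continuous_map (prod_topology (top_of_set {0..1}) (subtopology M D)) ?Y ?h"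
      unfolding external_collar_def by (intro continuous_map_into_subtopology) auto
  qed auto
  have j: "continuous_map (subtopology M D) ?Y ?j" using homotopic_with_imp_continuous_maps[OF hom] by blast
  \<comment> \<open>In degree 0 all boundaries are 0 and \<open>h = 0\<close> serves; otherwise
    \<open>h\<close> is the track of \<open>?b\<close> from height 0 to height 1.\<close>
  obtain h where h: "singular_chain n ?Y h"
    "chain_boundary n h = chain_map (n - 1) ?i ?b - chain_map (n - 1) ?j ?b"
  proof (cases n)
    case 0
    then show ?thesis using that[of 0] by (simp add: chain_boundary_def)
  next
    case (Suc m)
    have "singular_relcycle m (subtopology M D) {} ?b"
      using bD chain_boundary_boundary[OF cM] Suc by (simp add: singular_cycle)
    then have "homologous_rel m ?Y {} (chain_map m ?i ?b) (chain_map m ?j ?b)"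
      by (rule homotopic_imp_homologous_rel_chain_maps[OF hom])
    then show ?thesis using that Suc unfolding homologous_rel_def singular_boundary by auto
  qed
  let ?K = "topspace M \<times> {0::real}"
  let ?z = "chain_map n ?i c - h"
  have bi: "chain_boundary n (chain_map n ?i c) = chain_map (n - 1) ?i ?b"
    using chain_boundary_chain_map[OF cM] by simp
  have hN: "singular_chain n ?N h" using h(1) by (simp add: singular_chain_subtopology)
  have iN: "singular_chain n ?N (chain_map n ?i c)" using cM i by (rule singular_chain_chain_map)
  have z: "singular_relcycle n ?N (topspace ?N - ?K) ?z"
    unfolding singular_relcycle
  proof
    show "singular_chain n ?N ?z" using iN hN by (rule singular_chain_diff)
    have "chain_boundary n ?z = chain_map (n - 1) ?j ?b"
      by (simp add: chain_boundary_diff bi h(2))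
    moreover have "continuous_map (subtopology M D) (subtopology ?N (topspace ?N - ?K)) ?j"
      by (rule continuous_map_into_subtopology[OF continuous_map_into_fulltopology[OF j]]) (use DM in \<open>auto simp: tN\<close>)
    ultimately show "singular_chain (n - 1) (subtopology ?N (topspace ?N - ?K)) (chain_boundary n ?z)"
      using singular_chain_chain_map[OF bD] by metis
  qed
  have K: "?K = ?i ` topspace M" by auto
  have cK: "compactin ?N ?K"
    unfolding K using image_compactin[OF _ i] comp by (simp add: compact_space_def)
  have kK: "connectedin ?N ?K"
    unfolding K using connectedin_continuous_map_image[OF i] conn by (simp add: connectedin_topspace)
  have "continuous_map (subtopology M (topspace M - {y'})) (subtopology ?N (topspace ?N - {?i y'})) ?i"
    by (rule continuous_map_into_subtopology[OF continuous_map_from_subtopology[OF i]]) (auto simp: tN)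
  moreover have "singular_chain n (subtopology M (topspace M - {y'})) c"
  proof -
    have "?S \<subseteq> topspace M" using compactin_subset_topspace[OF compactin_chain_support[OF cM]] .
    then show ?thesis using cM y' by (auto simp: singular_chain_subtopology_support)
  qed
  ultimately have "singular_chain n (subtopology ?N (topspace ?N - {?i y'})) (chain_map n ?i c)"
    using singular_chain_chain_map by blast
  moreover have "singular_chain n (subtopology ?N (topspace ?N - {?i y'})) h"
    by (rule singular_chain_mono[OF h(1)]) (use y' tN in auto)
  ultimately have "singular_relboundary n ?N (topspace ?N - {?i y'}) ?z"
    by (intro singular_chain_imp_relboundary singular_chain_diff)
  moreover have "?i y' \<in> ?K" using y' by auto
  ultimately have zK: "singular_relboundary n ?N (topspace ?N - ?K) ?z"
    by (intro relboundary_of_null_at_point[OF Hausdorff_external_collar[OF H]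
        locally_Euclidean_external_collar[OF M D] cK kK z])
  have r: "continuous_map ?N M fst"
    unfolding external_collar_def by (intro continuous_map_from_subtopology continuous_map_fst)
  \<comment> \<open>Outside \<open>?K\<close> only collar points over \<open>D\<close> remain, so
    \<open>fst\<close> maps the pair to \<open>M\<close> and \<open>D\<close>. The collar chain
    \<open>h\<close> projects into \<open>D\<close> and vanishes relative to it.\<close>
  have 1: "singular_relboundary n M D (chain_map n fst ?z)"
    by (rule singular_relboundary_chain_map[OF zK r]) (auto simp: tN)
  have "continuous_map ?Y (subtopology M D) fst"
    by (rule continuous_map_into_subtopology[OF continuous_map_from_subtopology[OF r]]) auto
  then have 2: "singular_relboundary n M D (chain_map n fst h)"
    using h(1) by (intro singular_chain_imp_relboundary singular_chain_chain_map)
  have "chain_map n fst (chain_map n ?i c) = c"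
    using chain_map_id_gen[OF cM, of "fst \<circ> ?i"] by (simp add: chain_map_compose)
  then show ?thesis
    using singular_relboundary_add[OF 1 2] by (simp add: chain_map_diff)
qed

section \<open>Lattice paths and shuffles\<close>

definition delete_at :: "nat \<Rightarrow> 'a list \<Rightarrow> 'a list"
  where "delete_at k l = take k l @ drop (Suc k) l"

lemma delete_at_Cons [simp]: "delete_at 0 (x # l) = l" "delete_at (Suc k) (x # l) = x # delete_at k l"
  by (simp_all add: delete_at_def)

lemma length_delete_at: "k < length l \<Longrightarrow> length (delete_at k l) = length l - 1"
  by (simp add: delete_at_def)

lemma nth_delete_at: "k < length l \<Longrightarrow> j < length l - 1 \<Longrightarrow> delete_at k l ! j = l ! (if j < k then j else Suc j)"
  by (auto simp: delete_at_def nth_append)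

text \<open>The simplicial coboundary of \<open>\<phi>\<close>, i.e. \<open>\<phi>\<close> evaluated
  on the boundary of the formal simplex \<open>l\<close>. Functionals take the place of formal sums
  of lists, so signs are computed with plain rationals.\<close>

definition alt_sum :: "('a list \<Rightarrow> rat) \<Rightarrow> 'a list \<Rightarrow> rat"
  where "alt_sum \<phi> l = (\<Sum>k<length l. (-1) ^ k * \<phi> (delete_at k l))"

lemma alt_sum_Nil [simp]: "alt_sum \<phi> [] = 0"
  by (simp add: alt_sum_def)

lemma alt_sum_Cons: "alt_sum \<phi> (x # l) = \<phi> l - alt_sum (\<lambda>l. \<phi> (x # l)) l"
  unfolding alt_sum_def length_Cons sum.lessThan_Suc_shift by (simp add: sum_negf)

text \<open>The hypothesis is confined to lists shorter by one: in the Leibniz rule the coefficient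
  \<open>c\<close> is a sign depending on that length.\<close>

lemma alt_sum_linear:
  assumes "\<And>l'. Suc (length l') = length l \<Longrightarrow> \<phi> l' = \<psi> l' + c * \<theta> l'"
  shows "alt_sum \<phi> l = alt_sum \<psi> l + c * alt_sum \<theta> l"
proof -
  have "alt_sum \<phi> l = (\<Sum>k<length l. (-1) ^ k * (\<psi> (delete_at k l) + c * \<theta> (delete_at k l)))"
    unfolding alt_sum_def by (intro sum.cong refl) (use assms in \<open>simp add: length_delete_at\<close>)
  then show ?thesis
    by (simp add: alt_sum_def algebra_simps sum.distrib sum_distrib_left)
qed

text \<open>\<open>path_sum \<phi> X Y\<close> is the signed sum of \<open>\<phi>\<close> over the monotone lattice paths through the grid
  \<open>X \<times> Y\<close>, i.e. the shuffle product of two formal simplices evaluated by \<open>\<phi>\<close>. The values for empty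
  lists are chosen so that the recursion and the Leibniz rule hold without exceptions.\<close>

fun path_sum :: "(('a \<times> 'b) list \<Rightarrow> rat) \<Rightarrow> 'a list \<Rightarrow> 'b list \<Rightarrow> rat" where
  "path_sum \<phi> [] [y] = \<phi> []"
| "path_sum \<phi> [] [] = 0"
| "path_sum \<phi> [] (y # y' # ys) = 0"
| "path_sum \<phi> (x # xs) [] = 0"
| "path_sum \<phi> (x # xs) (y # ys) = path_sum (\<lambda>l. \<phi> ((x, y) # l)) xs (y # ys)
     + (-1) ^ length xs * path_sum (\<lambda>l. \<phi> ((x, y) # l)) (x # xs) ys"

lemma path_sum_diff: "path_sum (\<lambda>l. \<phi> l - \<psi> l) X Y = path_sum \<phi> X Y - path_sum \<psi> X Y"
proof (induction \<phi> X Y arbitrary: \<psi> rule: path_sum.induct)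
  case (5 \<phi> x xs y ys)
  show ?case unfolding path_sum.simps 5 by (simp add: right_diff_distrib)
qed simp_all

lemma path_sum_Nil1: "length Y \<noteq> 1 \<Longrightarrow> path_sum \<phi> [] Y = 0"
proof (cases Y)
  case (Cons y l)
  then show "length Y \<noteq> 1 \<Longrightarrow> path_sum \<phi> [] Y = 0" by (cases l) auto
qed simp

lemma path_sum_Nil2 [simp]: "path_sum \<phi> X [] = 0"
  by (cases X) simp_all

text \<open>Induction on the first step. Faces that cut off a corner of a path arise from two
  neighbouring paths and cancel. The minus sign is the usual one, since a list of length
  \<open>p + 1\<close> stands for a \<open>p\<close>-simplex.\<close>

theorem path_sum_Leibniz:
  "path_sum (alt_sum \<phi>) X Y
   = alt_sum (\<lambda>X'. path_sum \<phi> X' Y) X - (-1) ^ length X * alt_sum (path_sum \<phi> X) Y"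
proof (induction \<phi> X Y rule: path_sum.induct)
  case (1 \<phi> y)
  then show ?case by (simp add: alt_sum_def)
next
  case (2 \<phi>)
  then show ?case by simp
next
  case (3 \<phi> y y' ys)
  \<comment> \<open>With \<open>ys = []\<close> the two deletions both give \<open>\<phi> []\<close>
    with opposite signs; longer lists give the default 0 throughout.\<close>
  have "alt_sum (path_sum \<phi> []) (y # y' # ys) = 0"
  proof (cases ys)
    case Nil
    then show ?thesis by (simp add: alt_sum_Cons)
  next
    case (Cons a l)
    have "path_sum \<phi> [] (delete_at k (y # y' # ys)) = 0" if "k < length (y # y' # ys)" for k
      by (rule path_sum_Nil1) (use that Cons in \<open>simp add: length_delete_at\<close>)
    then show ?thesis unfolding alt_sum_def by (intro sum.neutral) simp
  qed
  then show ?case by simp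
next
  case (4 \<phi> x xs)
  then show ?case by (simp add: alt_sum_def)
next
  case (5 \<phi> x xs y ys)
  let ?\<phi> = "\<lambda>l. \<phi> ((x, y) # l)"
  let ?X = "x # xs" and ?Y = "y # ys"
  define s where "s = (-1 :: rat) ^ length xs"
  \<comment> \<open>The paths that leave \<open>(x, y)\<close> by a diagonal step. They enter
    through \<open>e2\<close> and \<open>e3\<close> with opposite signs.\<close>
  define A where "A = path_sum ?\<phi> xs ys"
  define B where "B = alt_sum (\<lambda>X'. path_sum ?\<phi> X' ?Y) xs"
  define C where "C = alt_sum (\<lambda>Y'. path_sum ?\<phi> xs (y # Y')) ys"
  define D where "D = alt_sum (\<lambda>X'. path_sum ?\<phi> (x # X') ys) xs"
  define G where "G = alt_sum (path_sum ?\<phi> ?X) ys"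
  have e1: "path_sum (alt_sum \<phi>) ?X ?Y
     = (path_sum \<phi> xs ?Y - path_sum (alt_sum ?\<phi>) xs ?Y) + s * (path_sum \<phi> ?X ys - path_sum (alt_sum ?\<phi>) ?X ys)"
    by (simp add: alt_sum_Cons path_sum_diff s_def)
  have e2: "path_sum (alt_sum ?\<phi>) xs ?Y = B - s * (A - C)"
    using 5(1) by (simp add: A_def B_def C_def s_def alt_sum_Cons)
  have e3: "path_sum (alt_sum ?\<phi>) ?X ys = A - D + s * G"
    using 5(2) by (simp add: A_def D_def G_def s_def alt_sum_Cons)
  have e4: "alt_sum (\<lambda>X'. path_sum \<phi> X' ?Y) ?X = path_sum \<phi> xs ?Y - (B + (- s) * D)"
  proof -
    have "alt_sum (\<lambda>X'. path_sum \<phi> (x # X') ?Y) xs = B + (- s) * D"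
      unfolding B_def D_def s_def by (rule alt_sum_linear) (auto dest: sym)
    then show ?thesis by (simp only: alt_sum_Cons)
  qed
  have e5: "alt_sum (path_sum \<phi> ?X) ?Y = path_sum \<phi> ?X ys - (C + s * G)"
  proof -
    have "alt_sum (\<lambda>Y'. path_sum \<phi> ?X (y # Y')) ys = C + s * G"
      unfolding C_def G_def s_def by (rule alt_sum_linear) simp
    then show ?thesis by (simp only: alt_sum_Cons)
  qed
  have e6: "(-1) ^ length ?X = - s" by (simp add: s_def)
  show ?case unfolding e1 e2 e3 e4 e5 e6 by (simp add: algebra_simps)
qed

section \<open>Shuffles as lattice paths\<close>

definition lattice_path :: "'a list \<Rightarrow> 'b list \<Rightarrow> nat \<Rightarrow> nat set \<Rightarrow> ('a \<times> 'b) list"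
  where "lattice_path X Y m S = map (\<lambda>k. (X ! card (S \<inter> {..<k}), Y ! card ({..<k} - S))) [0..<Suc m]"

lemma shuffles_of_0_0: "shuffles_of 0 0 = {{}}"
  by (auto simp: shuffles_of_def)

lemma finite_shuffles_of: "finite (shuffles_of p q)"
  by (rule finite_subset[of _ "Pow {..<p + q}"]) (auto simp: shuffles_of_def)

text \<open>The cases are the two directions of the first step: \<open>0 \<in> S\<close> means a
  step in the first direction. The remaining steps are shifted down by one.\<close>

lemma shuffles_of_split:
  assumes "p + q > 0"
  shows "shuffles_of p q = (if p > 0 then (\<lambda>S. insert 0 (Suc ` S)) ` shuffles_of (p - 1) q else {})
    \<union> (if q > 0 then (`) Suc ` shuffles_of p (q - 1) else {})"
    (is "_ = ?A \<union> ?B")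
proof
  have cS: "card (Suc ` S) = card S" for S by (simp add: card_image)
  have ci: "card (insert 0 (Suc ` S)) = Suc (card S)" if "finite S" for S
    using that cS[of S] by (subst card_insert_disjoint) auto
  show "shuffles_of p q \<subseteq> ?A \<union> ?B"
  proof
    fix S assume S: "S \<in> shuffles_of p q"
    then have SS: "S \<subseteq> {..<p + q}" "card S = p" "finite S"
      by (auto simp: shuffles_of_def finite_subset)
    define S' where "S' = {k. Suc k \<in> S}"
    have S': "S' \<subseteq> {..<p + q - 1}" using SS(1) by (auto simp: S'_def)
    then have fS': "finite S'" using finite_subset by blast
    show "S \<in> ?A \<union> ?B"
    proof (cases "0 \<in> S")
      case True
      have eq: "S = insert 0 (Suc ` S')"
        using True by (auto simp: S'_def image_iff) (metis not0_implies_Suc)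
      then have p: "p = Suc (card S')" using ci[OF fS'] SS(2) by simp
      then have "S' \<in> shuffles_of (p - 1) q" using S' by (auto simp: shuffles_of_def)
      then show ?thesis using eq p by auto
    next
      case False
      have eq: "S = Suc ` S'"
        using False by (auto simp: S'_def image_iff) (metis not0_implies_Suc)
      then have p: "p = card S'" using cS SS(2) by simp
      have "card S' \<le> p + q - 1" using card_mono[OF _ S'] by simp
      then have q: "q > 0" using p assms by linarith
      then have "S' \<in> shuffles_of p (q - 1)" using S' p by (auto simp: shuffles_of_def)
      then show ?thesis using eq q by auto
    qed
  qed
  show "?A \<union> ?B \<subseteq> shuffles_of p q"
  proof
    fix S assume "S \<in> ?A \<union> ?B"
    then show "S \<in> shuffles_of p q"
    proof
      assume "S \<in> ?A"
      then obtain S' where p: "p > 0" and S': "S' \<in> shuffles_of (p - 1) q" "S = insert 0 (Suc ` S')"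
        by (auto split: if_splits)
      then have "finite S'" "S' \<subseteq> {..<p - 1 + q}" "card S' = p - 1"
        by (auto simp: shuffles_of_def finite_subset)
      then show ?thesis using p ci[of S'] S'(2) by (auto simp: shuffles_of_def)
    next
      assume "S \<in> ?B"
      then obtain S' where q: "q > 0" and S': "S' \<in> shuffles_of p (q - 1)" "S = Suc ` S'"
        by (auto split: if_splits)
      then have "S' \<subseteq> {..<p + (q - 1)}" "card S' = p"
        by (auto simp: shuffles_of_def)
      then show ?thesis using q cS[of S'] S'(2) by (auto simp: shuffles_of_def)
    qed
  qed
qed

lemma sum_shuffles_of_split:
  fixes G :: "nat set \<Rightarrow> 'a::comm_monoid_add"
  assumes "p + q > 0"
  shows "(\<Sum>S\<in>shuffles_of p q. G S) =
    (if p > 0 then \<Sum>S\<in>shuffles_of (p - 1) q. G (insert 0 (Suc ` S)) else 0)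
    + (if q > 0 then \<Sum>S\<in>shuffles_of p (q - 1). G (Suc ` S) else 0)"
proof -
  let ?f = "\<lambda>S. insert 0 (Suc ` S)"
  have inj1: "inj_on ?f T" for T
  proof (rule inj_onI)
    fix S S' assume "?f S = ?f S'"
    then have "Suc ` S = Suc ` S'" by (auto simp: set_eq_iff)
    then show "S = S'" by (simp add: inj_image_eq_iff)
  qed
  have inj2: "inj_on ((`) Suc) T" for T by (rule inj_onI) (simp add: inj_image_eq_iff)
  show ?thesis
    unfolding shuffles_of_split[OF assms]
    by (subst sum.union_disjoint)
      (auto simp: finite_shuffles_of sum.reindex inj1 inj2)
qed

text \<open>A first step in the second direction puts 0 into the complement, below all
  \<open>p\<close> elements of the shifted set, and so creates \<open>p\<close> new
  inversions.\<close>

lemma shuffle_sign_Suc_image: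
  assumes "S \<in> shuffles_of p q"
  shows "shuffle_sign p (Suc q) (Suc ` S) = (-1) ^ p * shuffle_sign p q S"
proof -
  have S: "S \<subseteq> {..<p + q}" "card S = p" "finite S" using assms by (auto simp: shuffles_of_def finite_subset)
  let ?I = "{(a, b). a \<in> S \<and> b \<in> {..<p + q} - S \<and> b < a}"
  let ?J = "{(a, b). a \<in> Suc ` S \<and> b \<in> {..<p + Suc q} - Suc ` S \<and> b < a}"
  have "?J = (\<lambda>a. (Suc a, 0)) ` S \<union> map_prod Suc Suc ` ?I"
  proof
    show "?J \<subseteq> (\<lambda>a. (Suc a, 0)) ` S \<union> map_prod Suc Suc ` ?I"
    proof
      fix z assume "z \<in> ?J"
      then obtain a b where z: "z = (Suc a, b)" "a \<in> S" "b < p + Suc q" "b \<notin> Suc ` S" "b < Suc a" by auto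
      show "z \<in> (\<lambda>a. (Suc a, 0)) ` S \<union> map_prod Suc Suc ` ?I"
      proof (cases b)
        case 0 then show ?thesis using z by auto
      next
        case (Suc b')
        then have "(a, b') \<in> ?I" using z by auto
        then show ?thesis using Suc z(1) by (auto simp: image_iff)
      qed
    qed
  qed auto
  moreover have "finite ?I" by (rule finite_subset[of _ "S \<times> {..<p + q}"]) (use S in auto)
  moreover have "(\<lambda>a. (Suc a, 0)) ` S \<inter> map_prod Suc Suc ` ?I = {}" by auto
  ultimately have "card ?J = card ((\<lambda>a. (Suc a, 0::nat)) ` S) + card (map_prod Suc Suc ` ?I)"
    using S(3) by (simp only: card_Un_disjoint finite_imageI)
  moreover have "card ((\<lambda>a. (Suc a, 0::nat)) ` S) = p" using S by (subst card_image) (auto simp: inj_on_def)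
  moreover have "card (map_prod Suc Suc ` ?I) = card ?I" by (rule card_image) (auto simp: inj_on_def)
  ultimately show ?thesis by (simp add: shuffle_sign_def power_add)
qed

text \<open>The new element 0 of the set has nothing below it and creates no inversion.\<close>

lemma shuffle_sign_insert_0:
  assumes "S \<in> shuffles_of p q"
  shows "shuffle_sign (Suc p) q (insert 0 (Suc ` S)) = shuffle_sign p q S"
proof -
  let ?I = "{(a, b). a \<in> S \<and> b \<in> {..<p + q} - S \<and> b < a}"
  let ?J = "{(a, b). a \<in> insert 0 (Suc ` S) \<and> b \<in> {..<Suc p + q} - insert 0 (Suc ` S) \<and> b < a}"
  have "?J = map_prod Suc Suc ` ?I"
  proof
    show "?J \<subseteq> map_prod Suc Suc ` ?I"
    proof
      fix z assume "z \<in> ?J"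
      then obtain a b where z: "z = (Suc a, b)" "a \<in> S" "b < Suc p + q" "b \<noteq> 0" "b \<notin> Suc ` S" "b < Suc a" by auto
      then obtain b' where "b = Suc b'" using not0_implies_Suc by blast
      moreover then have "(a, b') \<in> ?I" using z by auto
      ultimately show "z \<in> map_prod Suc Suc ` ?I" using z(1) by (auto simp: image_iff)
    qed
  qed auto
  moreover have "card (map_prod Suc Suc ` ?I) = card ?I" by (rule card_image) (auto simp: inj_on_def)
  ultimately show ?thesis by (simp add: shuffle_sign_def)
qed

lemma lattice_path_Suc_image:
  "lattice_path (x # xs) (y # ys) (Suc m) (Suc ` S) = (x, y) # lattice_path (x # xs) ys m S"
proof -
  have "card (Suc ` S \<inter> {..<Suc k}) = card (S \<inter> {..<k})" for k
  proof -
    have "Suc ` S \<inter> {..<Suc k} = Suc ` (S \<inter> {..<k})" by auto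
    then show ?thesis by (simp add: card_image)
  qed
  moreover have "card ({..<Suc k} - Suc ` S) = Suc (card ({..<k} - S))" for k
  proof -
    have "{..<Suc k} - Suc ` S = insert 0 (Suc ` ({..<k} - S))" by (auto simp: lessThan_Suc_eq_insert_0)
    then show ?thesis by (simp add: card_image)
  qed
  ultimately show ?thesis
    unfolding lattice_path_def by (subst upt_conv_Cons) (simp_all add: map_Suc_upt[symmetric] del: upt_Suc)
qed

lemma lattice_path_insert_0:
  "lattice_path (x # xs) (y # ys) (Suc m) (insert 0 (Suc ` S)) = (x, y) # lattice_path xs (y # ys) m S"
proof -
  have "card (insert 0 (Suc ` S) \<inter> {..<Suc k}) = Suc (card (S \<inter> {..<k}))" for k
  proof -
    have "insert 0 (Suc ` S) \<inter> {..<Suc k} = insert 0 (Suc ` (S \<inter> {..<k}))" by auto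
    then show ?thesis by (simp add: card_image)
  qed
  moreover have "card ({..<Suc k} - insert 0 (Suc ` S)) = card ({..<k} - S)" for k
  proof -
    have "{..<Suc k} - insert 0 (Suc ` S) = Suc ` ({..<k} - S)" by (auto simp: lessThan_Suc_eq_insert_0)
    then show ?thesis by (simp add: card_image)
  qed
  ultimately show ?thesis
    unfolding lattice_path_def by (subst upt_conv_Cons) (simp_all add: map_Suc_upt[symmetric] del: upt_Suc)
qed

text \<open>Both sides obey the same recursion on the first step. This carries the Leibniz rule from
  the recursive form over to the sums in \<open>qchain_cross\<close>.\<close>

lemma path_sum_eq_sum_shuffles:
  assumes "X \<noteq> []" "Y \<noteq> []"
  shows "path_sum \<phi> X Y = (\<Sum>S\<in>shuffles_of (length X - 1) (length Y - 1).
    shuffle_sign (length X - 1) (length Y - 1) S * \<phi> (lattice_path X Y (length X - 1 + (length Y - 1)) S))"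
  using assms
proof (induction \<phi> X Y rule: path_sum.induct)
  case (5 \<phi> x xs y ys)
  let ?p = "length xs" and ?q = "length ys"
  show ?case
  proof (cases "?p + ?q = 0")
    case True
    then show ?thesis by (simp add: shuffles_of_0_0 shuffle_sign_def lattice_path_def)
  next
    case False
    have 1: "path_sum (\<lambda>l. \<phi> ((x, y) # l)) xs (y # ys) =
      (if ?p > 0 then \<Sum>S\<in>shuffles_of (?p - 1) ?q. shuffle_sign ?p ?q (insert 0 (Suc ` S))
         * \<phi> (lattice_path (x # xs) (y # ys) (?p + ?q) (insert 0 (Suc ` S))) else 0)"
    proof (cases xs)
      \<comment> \<open>No step in the first direction is left. Here \<open>ys\<close> is nonempty,
        so \<open>path_sum\<close> takes the default 0 and not the value
        \<open>\<phi> []\<close>.\<close>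
      case Nil
      then show ?thesis using False by (cases ys) auto
    next
      case (Cons x' xs')
      have "path_sum (\<lambda>l. \<phi> ((x, y) # l)) xs (y # ys) = (\<Sum>S\<in>shuffles_of (?p - 1) ?q.
          shuffle_sign (?p - 1) ?q S * \<phi> ((x, y) # lattice_path xs (y # ys) (?p - 1 + ?q) S))"
        using 5(1) Cons by simp
      also have "\<dots> = (\<Sum>S\<in>shuffles_of (?p - 1) ?q. shuffle_sign ?p ?q (insert 0 (Suc ` S))
         * \<phi> (lattice_path (x # xs) (y # ys) (?p + ?q) (insert 0 (Suc ` S))))"
        by (intro sum.cong refl) (use Cons in \<open>simp add: shuffle_sign_insert_0 lattice_path_insert_0\<close>)
      finally show ?thesis using Cons by simp
    qed
    have 2: "(-1) ^ ?p * path_sum (\<lambda>l. \<phi> ((x, y) # l)) (x # xs) ys =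
      (if ?q > 0 then \<Sum>S\<in>shuffles_of ?p (?q - 1). shuffle_sign ?p ?q (Suc ` S)
         * \<phi> (lattice_path (x # xs) (y # ys) (?p + ?q) (Suc ` S)) else 0)"
    proof (cases ys)
      case (Cons y' ys')
      have "path_sum (\<lambda>l. \<phi> ((x, y) # l)) (x # xs) ys = (\<Sum>S\<in>shuffles_of ?p (?q - 1).
          shuffle_sign ?p (?q - 1) S * \<phi> ((x, y) # lattice_path (x # xs) ys (?p + (?q - 1)) S))"
        using 5(2) Cons by simp
      then have "(-1) ^ ?p * path_sum (\<lambda>l. \<phi> ((x, y) # l)) (x # xs) ys
        = (\<Sum>S\<in>shuffles_of ?p (?q - 1). (-1) ^ ?p * (shuffle_sign ?p (?q - 1) S * \<phi> ((x, y) # lattice_path (x # xs) ys (?p + (?q - 1)) S)))"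
        by (simp add: sum_distrib_left)
      also have "\<dots> = (\<Sum>S\<in>shuffles_of ?p (?q - 1). shuffle_sign ?p ?q (Suc ` S)
         * \<phi> (lattice_path (x # xs) (y # ys) (?p + ?q) (Suc ` S)))"
        by (intro sum.cong refl) (use Cons in \<open>simp add: shuffle_sign_Suc_image lattice_path_Suc_image\<close>)
      finally show ?thesis using Cons by simp
    qed simp
    show ?thesis
      using False by (simp add: 1 2 sum_shuffles_of_split)
  qed
qed simp_all

section \<open>Rational chains\<close>

abbreviation qscale :: "rat \<Rightarrow> ('a \<Rightarrow>\<^sub>0 rat) \<Rightarrow> ('a \<Rightarrow>\<^sub>0 rat)"
  where "qscale r \<equiv> Poly_Mapping.map ((*) r)"

lemma lookup_qscale [simp]: "Poly_Mapping.lookup (qscale r c) x = r * Poly_Mapping.lookup c x"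
  by (simp add: Poly_Mapping.map.rep_eq when_def)

text \<open>The index set may exceed the support, so that sums for different chains can be compared
  over one common set.\<close>

lemma lookup_qextend:
  assumes "finite K" "Poly_Mapping.keys c \<subseteq> K"
  shows "Poly_Mapping.lookup (qextend b c) y = (\<Sum>\<sigma>\<in>K. Poly_Mapping.lookup c \<sigma> * Poly_Mapping.lookup (b \<sigma>) y)"
proof -
  have "Poly_Mapping.lookup (qextend b c) y
      = (\<Sum>\<sigma>\<in>Poly_Mapping.keys c. Poly_Mapping.lookup c \<sigma> * Poly_Mapping.lookup (b \<sigma>) y)"
    by (simp add: qextend_def lookup_sum)
  also have "\<dots> = (\<Sum>\<sigma>\<in>K. Poly_Mapping.lookup c \<sigma> * Poly_Mapping.lookup (b \<sigma>) y)"
    using assms by (intro sum.mono_neutral_left) (auto simp: in_keys_iff)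
  finally show ?thesis .
qed

lemma qextend_add: "qextend b (c + d) = qextend b c + qextend b d"
proof (rule poly_mapping_eqI)
  fix y
  let ?K = "Poly_Mapping.keys c \<union> Poly_Mapping.keys d"
  show "Poly_Mapping.lookup (qextend b (c + d)) y = Poly_Mapping.lookup (qextend b c + qextend b d) y"
    using keys_add[of c d]
    by (simp add: lookup_add lookup_qextend[of ?K] ring_distribs sum.distrib)
qed

lemma keys_qscale_subset: "Poly_Mapping.keys (qscale r c) \<subseteq> Poly_Mapping.keys c"
  by (auto simp: in_keys_iff)

lemma qextend_qscale: "qextend b (qscale r c) = qscale r (qextend b c)"
  by (rule poly_mapping_eqI)
    (simp add: lookup_qextend[of "Poly_Mapping.keys c"] keys_qscale_subset sum_distrib_left mult.assoc)

lemma qscale_minus_one: "qscale (- 1) c = - c"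
  by (rule poly_mapping_eqI) simp

lemma qextend_diff: "qextend b (c - d) = qextend b c - qextend b d"
  using qextend_add[of b c "qscale (- 1) d"] by (simp only: qextend_qscale) (simp add: qscale_minus_one)

lemma qextend_0 [simp]: "qextend b 0 = 0"
  by (simp add: qextend_def)

lemma qextend_single [simp]: "qextend b (Poly_Mapping.single \<sigma> r) = qscale r (b \<sigma>)"
  by (rule poly_mapping_eqI) (simp add: lookup_qextend[of "{\<sigma>}"])

lemma qscale_1 [simp]: "qscale 1 c = c"
  by (rule poly_mapping_eqI) simp

lemma qscale_qscale [simp]: "qscale r (qscale s c) = qscale (r * s) c"
  by (rule poly_mapping_eqI) simp

lemma qscale_0_right [simp]: "qscale r 0 = 0"
  by (rule poly_mapping_eqI) simp

lemma qscale_diff: "qscale r (c - d) = qscale r c - qscale r d"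
  by (rule poly_mapping_eqI) (simp add: lookup_minus algebra_simps)

lemma qextend_sum: "qextend b (\<Sum>i\<in>I. c i) = (\<Sum>i\<in>I. qextend b (c i))"
  by (induction I rule: infinite_finite_induct) (simp_all add: qextend_add)

lemma keys_qextend: "Poly_Mapping.keys (qextend b c) \<subseteq> (\<Union>\<sigma>\<in>Poly_Mapping.keys c. Poly_Mapping.keys (b \<sigma>))"
proof
  fix y assume "y \<in> Poly_Mapping.keys (qextend b c)"
  then have "(\<Sum>\<sigma>\<in>Poly_Mapping.keys c. Poly_Mapping.lookup c \<sigma> * Poly_Mapping.lookup (b \<sigma>) y) \<noteq> 0"
    by (simp add: in_keys_iff lookup_qextend[of "Poly_Mapping.keys c"])
  then obtain \<sigma> where "\<sigma> \<in> Poly_Mapping.keys c" "Poly_Mapping.lookup (b \<sigma>) y \<noteq> 0"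
    by (auto elim: sum.not_neutral_contains_not_neutral)
  then show "y \<in> (\<Union>\<sigma>\<in>Poly_Mapping.keys c. Poly_Mapping.keys (b \<sigma>))" by (auto simp: in_keys_iff)
qed

lemma qextend_expansion: "qextend b c = (\<Sum>\<sigma>\<in>Poly_Mapping.keys c. qscale (Poly_Mapping.lookup c \<sigma>) (b \<sigma>))"
  by (rule qextend_def)

lemma qextend_qextend: "qextend b (qextend b' c) = qextend (\<lambda>\<sigma>. qextend b (b' \<sigma>)) c"
  by (simp add: qextend_expansion[of b' c] qextend_sum qextend_qscale qextend_expansion[of "\<lambda>\<sigma>. qextend b (b' \<sigma>)" c])

lemma qextend_fun_add: "qextend (\<lambda>\<sigma>. b \<sigma> + b' \<sigma>) c = qextend b c + qextend b' c"
  by (rule poly_mapping_eqI)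
    (simp add: lookup_add lookup_qextend[of "Poly_Mapping.keys c"] ring_distribs sum.distrib)

lemma qextend_fun_qscale: "qextend (\<lambda>\<sigma>. qscale r (b \<sigma>)) c = qscale r (qextend b c)"
  by (rule poly_mapping_eqI)
    (simp add: lookup_qextend[of "Poly_Mapping.keys c"] sum_distrib_left algebra_simps)

lemma qsingular_chain_0 [simp]: "qsingular_chain p X 0"
  by (simp add: qsingular_chain_def)

lemma qsingular_chain_add: "qsingular_chain p X c \<Longrightarrow> qsingular_chain p X d \<Longrightarrow> qsingular_chain p X (c + d)"
  using keys_add[of c d] by (auto simp: qsingular_chain_def)

lemma qsingular_chain_qscale: "qsingular_chain p X c \<Longrightarrow> qsingular_chain p X (qscale r c)"
  using keys_qscale_subset[of r c] by (auto simp: qsingular_chain_def)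

lemma qsingular_chain_diff: "qsingular_chain p X c \<Longrightarrow> qsingular_chain p X d \<Longrightarrow> qsingular_chain p X (c - d)"
  using qsingular_chain_add[OF _ qsingular_chain_qscale[of p X d "- 1"]] by (simp add: qscale_minus_one)

lemma qsingular_chain_sum: "(\<And>i. i \<in> I \<Longrightarrow> qsingular_chain p X (c i)) \<Longrightarrow> qsingular_chain p X (\<Sum>i\<in>I. c i)"
  by (induction I rule: infinite_finite_induct) (simp_all add: qsingular_chain_add)

lemma qsingular_chain_qextend:
  "(\<And>\<sigma>. \<sigma> \<in> Poly_Mapping.keys c \<Longrightarrow> qsingular_chain p X (b \<sigma>)) \<Longrightarrow> qsingular_chain p X (qextend b c)"
  using keys_qextend[of b c] by (fastforce simp: qsingular_chain_def)

lemma qsingular_chain_single: "singular_simplex p X \<sigma> \<Longrightarrow> qsingular_chain p X (Poly_Mapping.single \<sigma> r)"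
  by (simp add: qsingular_chain_def)

lemma qsingular_chain_mono:
  "qsingular_chain p (subtopology X S) c \<Longrightarrow> S \<subseteq> T \<Longrightarrow> qsingular_chain p (subtopology X T) c"
  unfolding qsingular_chain_def using singular_simplex_mono by blast

lemma qchain_boundary_diff: "qchain_boundary p (c - d) = qchain_boundary p c - qchain_boundary p d"
  by (simp add: qchain_boundary_def qextend_diff)

lemma qchain_boundary_qscale: "qchain_boundary p (qscale r c) = qscale r (qchain_boundary p c)"
  by (simp add: qchain_boundary_def qextend_qscale)

lemma qchain_map_qscale: "qchain_map p g (qscale r c) = qscale r (qchain_map p g c)"
  by (simp add: qchain_map_def qextend_qscale)

section \<open>The Leibniz rule for the cross product\<close>

abbreviation cross_simplex ::
    "nat \<Rightarrow> nat \<Rightarrow> ((nat \<Rightarrow> real) \<Rightarrow> 'a) \<Rightarrow> ((nat \<Rightarrow> real) \<Rightarrow> 'b) \<Rightarrow> ('a \<times> 'b) qchain"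
  where "cross_simplex p q \<sigma> \<tau> \<equiv>
    \<Sum>S\<in>shuffles_of p q. Poly_Mapping.single (shuffle_simplex p q \<sigma> \<tau> S) (shuffle_sign p q S)"

section \<open>Faces of shuffle simplices\<close>

text \<open>The vertices form an arbitrary list of index pairs, because a face deletes one entry of
  a lattice path and may leave a diagonal step.\<close>

definition list_simplex ::
    "((nat \<Rightarrow> real) \<Rightarrow> 'a) \<Rightarrow> ((nat \<Rightarrow> real) \<Rightarrow> 'b) \<Rightarrow> (nat \<times> nat) list \<Rightarrow> (nat \<Rightarrow> real) \<Rightarrow> 'a \<times> 'b"
  where "list_simplex \<sigma> \<tau> l =
    (\<lambda>t\<in>standard_simplex (length l - 1).
       (\<sigma> (vertex_map_simplex (length l - 1) (\<lambda>k. fst (l ! k)) t),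
        \<tau> (vertex_map_simplex (length l - 1) (\<lambda>k. snd (l ! k)) t)))"

lemma vertex_map_simplex_cong:
  "(\<And>k. k \<le> m \<Longrightarrow> h k = h' k) \<Longrightarrow> vertex_map_simplex m h = vertex_map_simplex m h'"
  by (auto simp: vertex_map_simplex_def oriented_simplex_def)

lemma length_lattice_path [simp]: "length (lattice_path X Y m S) = Suc m"
  by (simp add: lattice_path_def)

lemma nth_lattice_path: "k \<le> m \<Longrightarrow> lattice_path X Y m S ! k = (X ! card (S \<inter> {..<k}), Y ! card ({..<k} - S))"
  by (simp add: lattice_path_def del: upt_Suc)

lemma shuffle_cards:
  assumes "S \<in> shuffles_of p q" "k \<le> p + q"
  shows "card (S \<inter> {..<k}) \<le> p" "card ({..<k} - S) \<le> q"
proof -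
  have S: "S \<subseteq> {..<p + q}" "card S = p" "finite S" using assms by (auto simp: shuffles_of_def finite_subset)
  show "card (S \<inter> {..<k}) \<le> p" using card_mono[of S "S \<inter> {..<k}"] S by simp
  have "card ({..<k} - S) \<le> card ({..<p + q} - S)" using assms by (intro card_mono) auto
  also have "\<dots> = q" using S by (simp add: card_Diff_subset)
  finally show "card ({..<k} - S) \<le> q" .
qed

lemma shuffle_simplex_eq_list_simplex:
  assumes "S \<in> shuffles_of p q"
  shows "shuffle_simplex p q \<sigma> \<tau> S = list_simplex \<sigma> \<tau> (lattice_path [0..<Suc p] [0..<Suc q] (p + q) S)"
proof -
  let ?l = "lattice_path [0..<Suc p] [0..<Suc q] (p + q) S"
  have "vertex_map_simplex (p + q) (\<lambda>k. fst (?l ! k)) = vertex_map_simplex (p + q) (\<lambda>k. card (S \<inter> {..<k}))"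
    "vertex_map_simplex (p + q) (\<lambda>k. snd (?l ! k)) = vertex_map_simplex (p + q) (\<lambda>k. card ({..<k} - S))"
    using shuffle_cards[OF assms]
    by (auto intro!: vertex_map_simplex_cong simp: nth_lattice_path less_Suc_eq_le simp del: upt_Suc)
  then show ?thesis by (simp add: shuffle_simplex_def list_simplex_def)
qed

lemma vertex_map_simplex_face:
  assumes "k \<le> Suc m" "t \<in> standard_simplex m"
  shows "vertex_map_simplex (Suc m) h (simplical_face k t)
    = vertex_map_simplex m (\<lambda>j. h (if j < k then j else Suc j)) t"
proof -
  have "vertex_map_simplex (Suc m) h (simplical_face k t) = singular_face (Suc m) k (vertex_map_simplex (Suc m) h) t"
    using assms by (simp add: singular_face_def)
  also have "\<dots> = vertex_map_simplex m (\<lambda>j. h (if j < k then j else Suc j)) t"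
    unfolding vertex_map_simplex_def using assms(1)
    by (simp add: singular_face_oriented_simplex if_distrib[of "\<lambda>j i. if i = h j then 1 else 0"] cong: if_cong)
  finally show ?thesis .
qed

lemma singular_face_list_simplex:
  assumes "length l = Suc (Suc m)" "k \<le> Suc m"
  shows "singular_face (Suc m) k (list_simplex \<sigma> \<tau> l) = list_simplex \<sigma> \<tau> (delete_at k l)"
proof
  fix t
  have len: "length (delete_at k l) = Suc m" using assms by (simp add: length_delete_at)
  have eq: "vertex_map_simplex m (\<lambda>j. g (l ! (if j < k then j else Suc j)))
      = vertex_map_simplex m (\<lambda>j. g (delete_at k l ! j))" for g :: "nat \<times> nat \<Rightarrow> nat"
    using assms by (intro vertex_map_simplex_cong) (simp add: nth_delete_at)
  show "singular_face (Suc m) k (list_simplex \<sigma> \<tau> l) t = list_simplex \<sigma> \<tau> (delete_at k l) t"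
  proof (cases "t \<in> standard_simplex m")
    case True
    then have "simplical_face k t \<in> standard_simplex (Suc m)"
      using assms simplical_face_in_standard_simplex[of "Suc m" k t] by simp
    then show ?thesis
      using True assms len
      by (simp add: singular_face_def list_simplex_def vertex_map_simplex_face eq[of fst] eq[of snd])
  next
    case False
    then show ?thesis using len by (simp add: singular_face_def list_simplex_def)
  qed
qed

lemma vertex_map_simplex_in_standard_simplex:
  assumes "t \<in> standard_simplex m" "\<And>k. k \<le> m \<Longrightarrow> h k \<le> p"
  shows "vertex_map_simplex m h t \<in> standard_simplex p"
proof -
  have t: "\<And>j. 0 \<le> t j" "\<And>j. t j \<le> 1" "(\<Sum>j\<le>m. t j) = 1" using assms(1) by (auto simp: standard_simplex_def)
  have v: "vertex_map_simplex m h t i = (\<Sum>j\<le>m. (if i = h j then 1 else 0) * t j)" for i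
    using assms(1) by (simp add: vertex_map_simplex_def oriented_simplex_def)
  have "0 \<le> vertex_map_simplex m h t i" for i unfolding v by (intro sum_nonneg) (simp add: t)
  moreover have "vertex_map_simplex m h t i \<le> 1" for i
  proof -
    have "vertex_map_simplex m h t i \<le> (\<Sum>j\<le>m. t j)" unfolding v by (intro sum_mono) (simp add: t)
    then show ?thesis using t by simp
  qed
  moreover have "vertex_map_simplex m h t i = 0" if "i > p" for i
    unfolding v by (intro sum.neutral) (use assms(2) that in force)
  moreover have "(\<Sum>i\<le>p. vertex_map_simplex m h t i) = 1"
  proof -
    have "(\<Sum>i\<le>p. vertex_map_simplex m h t i) = (\<Sum>j\<le>m. \<Sum>i\<le>p. (if i = h j then 1 else 0) * t j)"
      unfolding v by (rule sum.swap)
    also have "\<dots> = (\<Sum>j\<le>m. t j)"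
    proof (rule sum.cong[OF refl])
      fix j assume "j \<in> {..m}"
      then have "h j \<in> {..p}" using assms(2) by simp
      then show "(\<Sum>i\<le>p. (if i = h j then 1 else 0) * t j) = t j"
        by (simp add: sum_distrib_right[symmetric] sum.delta)
    qed
    finally show ?thesis using t by simp
  qed
  ultimately show ?thesis by (simp add: standard_simplex_def)
qed

text \<open>Relabelling around the index \<open>a\<close> is composition with the
  \<open>a\<close>-th face inclusion, so a path avoiding row or column \<open>a\<close> evaluates
  the simplex on its \<open>a\<close>-th face.\<close>

lemma vertex_map_simplex_skip:
  assumes "t \<in> standard_simplex m"
  shows "vertex_map_simplex m (\<lambda>j. if h j < a then h j else Suc (h j)) t = simplical_face a (vertex_map_simplex m h t)"
proof
  fix i
  have v: "vertex_map_simplex m h t i = (\<Sum>j\<le>m. (if i = h j then 1 else 0) * t j)" for i h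
    using assms by (simp add: vertex_map_simplex_def oriented_simplex_def)
  show "vertex_map_simplex m (\<lambda>j. if h j < a then h j else Suc (h j)) t i = simplical_face a (vertex_map_simplex m h t) i"
    unfolding simplical_face_def v
    by (auto intro!: sum.cong sum.neutral split: if_splits)
qed

lemma delete_at_upt: "k \<le> p \<Longrightarrow> delete_at k [0..<Suc p] = map (\<lambda>j. if j < k then j else Suc j) [0..<p]"
  by (rule nth_equalityI) (auto simp: length_delete_at nth_delete_at simp del: upt_Suc)

lemma map_lattice_path:
  assumes "S \<in> shuffles_of p q"
  shows "lattice_path (map g [0..<Suc p]) (map h [0..<Suc q]) (p + q) S
    = map (map_prod g h) (lattice_path [0..<Suc p] [0..<Suc q] (p + q) S)"
  using shuffle_cards[OF assms]
  by (intro nth_equalityI) (auto simp: nth_lattice_path less_Suc_eq_le simp del: upt_Suc)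

lemma list_simplex_skip:
  assumes "S \<in> shuffles_of p q"
  shows "list_simplex \<sigma> \<tau> (map (map_prod (\<lambda>j. if j < a then j else Suc j) id) (lattice_path [0..<Suc p] [0..<Suc q] (p + q) S))
      = shuffle_simplex p q (singular_face (Suc p) a \<sigma>) \<tau> S"
    and "list_simplex \<sigma> \<tau> (map (map_prod id (\<lambda>j. if j < a then j else Suc j)) (lattice_path [0..<Suc p] [0..<Suc q] (p + q) S))
      = shuffle_simplex p q \<sigma> (singular_face (Suc q) a \<tau>) S"
proof -
  let ?l = "lattice_path [0..<Suc p] [0..<Suc q] (p + q) S"
  let ?h = "\<lambda>j. if j < a then j else Suc j"
  note c = shuffle_cards[OF assms]
  have eq: "vertex_map_simplex (p + q) (\<lambda>k. fst (map (map_prod g g') ?l ! k)) = vertex_map_simplex (p + q) (\<lambda>k. g (card (S \<inter> {..<k})))"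
    "vertex_map_simplex (p + q) (\<lambda>k. snd (map (map_prod g g') ?l ! k)) = vertex_map_simplex (p + q) (\<lambda>k. g' (card ({..<k} - S)))" for g g'
    using c by (auto intro!: vertex_map_simplex_cong simp: nth_lattice_path less_Suc_eq_le simp del: upt_Suc)
  show "list_simplex \<sigma> \<tau> (map (map_prod ?h id) ?l) = shuffle_simplex p q (singular_face (Suc p) a \<sigma>) \<tau> S"
    unfolding list_simplex_def shuffle_simplex_def
    by (rule ext) (simp add: eq vertex_map_simplex_skip singular_face_def vertex_map_simplex_in_standard_simplex c del: upt_Suc)
  show "list_simplex \<sigma> \<tau> (map (map_prod id ?h) ?l) = shuffle_simplex p q \<sigma> (singular_face (Suc q) a \<tau>) S"
    unfolding list_simplex_def shuffle_simplex_def
    by (rule ext) (simp add: eq vertex_map_simplex_skip singular_face_def vertex_map_simplex_in_standard_simplex c del: upt_Suc)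
qed

lemma lookup_cross_simplex:
  "Poly_Mapping.lookup (cross_simplex p q \<sigma> \<tau>) \<omega>
   = (\<Sum>S\<in>shuffles_of p q. shuffle_sign p q S * of_bool (shuffle_simplex p q \<sigma> \<tau> S = \<omega>))"
  by (simp add: lookup_sum lookup_single when_def of_bool_def if_distrib cong: if_cong)

text \<open>With the indicator of one simplex \<open>\<omega>\<close> as functional, statements on
  \<open>path_sum\<close> become statements on the coefficient of \<open>\<omega>\<close> in a
  chain.\<close>

lemma path_sum_delete_left:
  assumes "a \<le> Suc p"
  shows "path_sum (\<lambda>l. of_bool (list_simplex \<sigma> \<tau> l = \<omega>)) (delete_at a [0..<Suc (Suc p)]) [0..<Suc q]
    = Poly_Mapping.lookup (cross_simplex p q (singular_face (Suc p) a \<sigma>) \<tau>) \<omega>"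
  using assms
  by (subst path_sum_eq_sum_shuffles)
    (auto simp: lookup_cross_simplex delete_at_upt map_lattice_path[of _ p q _ id, unfolded list.map_id] list_simplex_skip
      simp del: upt_Suc intro!: sum.cong)

lemma path_sum_delete_right:
  assumes "a \<le> Suc q"
  shows "path_sum (\<lambda>l. of_bool (list_simplex \<sigma> \<tau> l = \<omega>)) [0..<Suc p] (delete_at a [0..<Suc (Suc q)])
    = Poly_Mapping.lookup (cross_simplex p q \<sigma> (singular_face (Suc q) a \<tau>)) \<omega>"
  using assms
  by (subst path_sum_eq_sum_shuffles)
    (auto simp: lookup_cross_simplex delete_at_upt map_lattice_path[of _ p q id, unfolded list.map_id] list_simplex_skip
      simp del: upt_Suc intro!: sum.cong)

lemma qextend_swap: "qextend (\<lambda>\<sigma>. qextend (\<lambda>\<tau>. b \<sigma> \<tau>) d) c = qextend (\<lambda>\<tau>. qextend (\<lambda>\<sigma>. b \<sigma> \<tau>) c) d"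
proof (rule poly_mapping_eqI)
  fix y
  show "Poly_Mapping.lookup (qextend (\<lambda>\<sigma>. qextend (\<lambda>\<tau>. b \<sigma> \<tau>) d) c) y
    = Poly_Mapping.lookup (qextend (\<lambda>\<tau>. qextend (\<lambda>\<sigma>. b \<sigma> \<tau>) c) d) y"
    by (simp add: lookup_qextend[of "Poly_Mapping.keys c" c] lookup_qextend[of "Poly_Mapping.keys d" d]
        sum_distrib_left mult.left_commute sum.swap[of _ "Poly_Mapping.keys d"])
qed

lemma qextend_zero_fun [simp]: "qextend (\<lambda>\<sigma>. 0) c = 0"
  by (simp add: qextend_def)

lemma qchain_boundary_qextend: "qchain_boundary p (qextend b c) = qextend (\<lambda>\<sigma>. qchain_boundary p (b \<sigma>)) c"
  by (cases "p = 0") (simp_all add: qchain_boundary_def qextend_qextend)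

lemma qchain_boundary_expansion:
  "qchain_boundary p c = qextend (\<lambda>\<sigma>. qchain_boundary p (Poly_Mapping.single \<sigma> 1)) c"
  by (cases "p = 0") (simp_all add: qchain_boundary_def)

text \<open>Coefficients are compared at each \<open>\<omega>\<close>, where the claim is
  \<open>path_sum_Leibniz\<close> for the indicator of \<open>\<omega>\<close>. Total degree 0 is
  set apart: the boundary is 0 there, but \<open>alt_sum\<close> of a one-entry list is the value at
  \<open>[]\<close>.\<close>

lemma qchain_boundary_cross_simplex:
  "qchain_boundary (p + q) (cross_simplex p q \<sigma> \<tau>)
   = qextend (\<lambda>\<sigma>'. cross_simplex (p - 1) q \<sigma>' \<tau>) (qchain_boundary p (Poly_Mapping.single \<sigma> 1))
     + qscale ((-1) ^ p) (qextend (\<lambda>\<tau>'. cross_simplex p (q - 1) \<sigma> \<tau>') (qchain_boundary q (Poly_Mapping.single \<tau> 1)))"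
proof (cases "p + q")
  case 0
  then show ?thesis by (simp add: qchain_boundary_def)
next
  case (Suc m)
  note upt_Suc [simp del]
  let ?X = "[0..<Suc p]" and ?Y = "[0..<Suc q]"
  show ?thesis
  proof (rule poly_mapping_eqI)
    fix \<omega>
    let ?\<phi> = "\<lambda>l. of_bool (list_simplex \<sigma> \<tau> l = \<omega>) :: rat"
    let ?L = "Poly_Mapping.lookup"
    have face: "?L (\<Sum>k\<le>Suc m. Poly_Mapping.single (singular_face (Suc m) k (shuffle_simplex p q \<sigma> \<tau> S)) ((-1) ^ k)) \<omega>
        = alt_sum ?\<phi> (lattice_path ?X ?Y (p + q) S)" if "S \<in> shuffles_of p q" for S
      using that Suc
      by (simp add: alt_sum_def lookup_sum lookup_single when_def shuffle_simplex_eq_list_simplex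
          singular_face_list_simplex lessThan_Suc_atMost of_bool_def if_distrib cong: if_cong del: sum.atMost_Suc)
    have "?L (qchain_boundary (p + q) (cross_simplex p q \<sigma> \<tau>)) \<omega>
        = (\<Sum>S\<in>shuffles_of p q. shuffle_sign p q S * alt_sum ?\<phi> (lattice_path ?X ?Y (p + q) S))"
      using Suc face by (simp add: qchain_boundary_def qextend_sum lookup_sum del: sum.atMost_Suc)
    also have "\<dots> = path_sum (alt_sum ?\<phi>) ?X ?Y"
      by (simp add: path_sum_eq_sum_shuffles)
    also have "\<dots> = alt_sum (\<lambda>X'. path_sum ?\<phi> X' ?Y) ?X + (-1) ^ p * alt_sum (path_sum ?\<phi> ?X) ?Y"
      by (simp add: path_sum_Leibniz)
    also have "alt_sum (\<lambda>X'. path_sum ?\<phi> X' ?Y) ?X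
        = ?L (qextend (\<lambda>\<sigma>'. cross_simplex (p - 1) q \<sigma>' \<tau>) (qchain_boundary p (Poly_Mapping.single \<sigma> 1))) \<omega>"
    proof (cases p)
      \<comment> \<open>Deleting the only vertex of the first factor leaves \<open>[]\<close>
        against at least two vertices of the second, where the default 0 of \<open>path_sum\<close>
        agrees with the zero boundary in degree 0.\<close>
      case 0
      then have "length ?Y \<noteq> 1" using Suc by simp
      then have "path_sum ?\<phi> [] ?Y = 0" by (rule path_sum_Nil1)
      then show ?thesis using 0 by (simp add: alt_sum_def qchain_boundary_def upt_Suc delete_at_def)
    next
      case (Suc p')
      have "alt_sum (\<lambda>X'. path_sum ?\<phi> X' ?Y) ?X
          = (\<Sum>k\<le>Suc p'. (-1) ^ k * ?L (cross_simplex p' q (singular_face (Suc p') k \<sigma>) \<tau>) \<omega>)"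
        using Suc by (simp add: alt_sum_def lessThan_Suc_atMost path_sum_delete_left del: sum.atMost_Suc)
      then show ?thesis
        using Suc by (simp add: qchain_boundary_def qextend_sum lookup_sum del: sum.atMost_Suc)
    qed
    also have "alt_sum (path_sum ?\<phi> ?X) ?Y
        = ?L (qextend (\<lambda>\<tau>'. cross_simplex p (q - 1) \<sigma> \<tau>') (qchain_boundary q (Poly_Mapping.single \<tau> 1))) \<omega>"
    proof (cases q)
      case 0
      then show ?thesis by (simp add: alt_sum_def qchain_boundary_def upt_Suc delete_at_def)
    next
      case (Suc q')
      have "alt_sum (path_sum ?\<phi> ?X) ?Y
          = (\<Sum>k\<le>Suc q'. (-1) ^ k * ?L (cross_simplex p q' \<sigma> (singular_face (Suc q') k \<tau>)) \<omega>)"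
        using Suc by (simp add: alt_sum_def lessThan_Suc_atMost path_sum_delete_right del: sum.atMost_Suc)
      then show ?thesis
        using Suc by (simp add: qchain_boundary_def qextend_sum lookup_sum del: sum.atMost_Suc)
    qed
    finally show "?L (qchain_boundary (p + q) (cross_simplex p q \<sigma> \<tau>)) \<omega>
      = ?L (qextend (\<lambda>\<sigma>'. cross_simplex (p - 1) q \<sigma>' \<tau>) (qchain_boundary p (Poly_Mapping.single \<sigma> 1))
        + qscale ((-1) ^ p) (qextend (\<lambda>\<tau>'. cross_simplex p (q - 1) \<sigma> \<tau>') (qchain_boundary q (Poly_Mapping.single \<tau> 1)))) \<omega>"
      by (simp add: lookup_add)
  qed
qed

text \<open>Bilinear extension of the case of simplices. A truncated \<open>p - 1\<close> or
  \<open>q - 1\<close> does no harm, since the boundary that it accompanies is then 0.\<close>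

theorem qchain_boundary_cross:
  "qchain_boundary (p + q) (qchain_cross p q c d)
   = qchain_cross (p - 1) q (qchain_boundary p c) d + qscale ((-1) ^ p) (qchain_cross p (q - 1) c (qchain_boundary q d))"
proof -
  let ?s = "\<lambda>\<sigma>. Poly_Mapping.single \<sigma> 1"
  have "qchain_boundary (p + q) (qchain_cross p q c d)
    = qextend (\<lambda>\<sigma>. qextend (\<lambda>\<tau>. qextend (\<lambda>\<sigma>'. cross_simplex (p - 1) q \<sigma>' \<tau>) (qchain_boundary p (?s \<sigma>))
        + qscale ((-1) ^ p) (qextend (\<lambda>\<tau>'. cross_simplex p (q - 1) \<sigma> \<tau>') (qchain_boundary q (?s \<tau>)))) d) c"
    unfolding qchain_cross_def qchain_boundary_qextend qchain_boundary_cross_simplex ..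
  also have "\<dots> = qextend (\<lambda>\<sigma>. qextend (\<lambda>\<tau>. qextend (\<lambda>\<sigma>'. cross_simplex (p - 1) q \<sigma>' \<tau>) (qchain_boundary p (?s \<sigma>))) d) c
     + qscale ((-1) ^ p) (qextend (\<lambda>\<sigma>. qextend (\<lambda>\<tau>. qextend (\<lambda>\<tau>'. cross_simplex p (q - 1) \<sigma> \<tau>') (qchain_boundary q (?s \<tau>))) d) c)"
    unfolding qextend_fun_add qextend_fun_qscale ..
  also have "qextend (\<lambda>\<sigma>. qextend (\<lambda>\<tau>. qextend (\<lambda>\<sigma>'. cross_simplex (p - 1) q \<sigma>' \<tau>) (qchain_boundary p (?s \<sigma>))) d) c
     = qchain_cross (p - 1) q (qchain_boundary p c) d"
    unfolding qchain_cross_def qchain_boundary_expansion[of p c] qextend_qextend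
    by (rule arg_cong[of _ _ "\<lambda>b. qextend b c"], rule ext, rule qextend_swap)
  also have "qextend (\<lambda>\<sigma>. qextend (\<lambda>\<tau>. qextend (\<lambda>\<tau>'. cross_simplex p (q - 1) \<sigma> \<tau>') (qchain_boundary q (?s \<tau>))) d) c
     = qchain_cross p (q - 1) c (qchain_boundary q d)"
    unfolding qchain_cross_def qchain_boundary_expansion[of q d] qextend_qextend ..
  finally show ?thesis .
qed

lemma singular_simplex_shuffle:
  assumes \<sigma>: "singular_simplex p X \<sigma>" and \<tau>: "singular_simplex q Y \<tau>" and S: "S \<in> shuffles_of p q"
  shows "singular_simplex (p + q) (prod_topology X Y) (shuffle_simplex p q \<sigma> \<tau> S)"
proof -
  let ?D = "\<lambda>m. subtopology (powertop_real UNIV) (standard_simplex m)"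
  have v: "continuous_map (?D (p + q)) (?D k) (vertex_map_simplex (p + q) h)" if "\<And>i. i \<le> p + q \<Longrightarrow> h i \<le> k" for k h
  proof -
    have "simplicial_simplex (p + q) (standard_simplex k) (vertex_map_simplex (p + q) h)"
      unfolding simplicial_simplex using vertex_map_simplex_in_standard_simplex[OF _ that]
      by (auto simp: vertex_map_simplex_def)
    then show ?thesis by (simp add: simplicial_simplex_def singular_simplex_def)
  qed
  have 1: "continuous_map (?D (p + q)) X (\<sigma> \<circ> vertex_map_simplex (p + q) (\<lambda>k. card (S \<inter> {..<k})))"
    by (rule continuous_map_compose[OF v]) (use \<sigma> shuffle_cards[OF S] in \<open>auto simp: singular_simplex_def\<close>)
  have 2: "continuous_map (?D (p + q)) Y (\<tau> \<circ> vertex_map_simplex (p + q) (\<lambda>k. card ({..<k} - S)))"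
    by (rule continuous_map_compose[OF v]) (use \<tau> shuffle_cards[OF S] in \<open>auto simp: singular_simplex_def\<close>)
  have "continuous_map (?D (p + q)) (prod_topology X Y)
      (\<lambda>t. (\<sigma> (vertex_map_simplex (p + q) (\<lambda>k. card (S \<inter> {..<k})) t), \<tau> (vertex_map_simplex (p + q) (\<lambda>k. card ({..<k} - S)) t)))"
    using 1 2 by (simp add: continuous_map_pairwise o_def)
  then show ?thesis
    unfolding singular_simplex_def shuffle_simplex_def
    by (auto intro: continuous_map_eq)
qed

lemma qsingular_chain_cross:
  assumes "qsingular_chain p X c" and "qsingular_chain q Y d"
  shows "qsingular_chain (p + q) (prod_topology X Y) (qchain_cross p q c d)"
  unfolding qchain_cross_def
  by (intro qsingular_chain_qextend qsingular_chain_sum qsingular_chain_single singular_simplex_shuffle)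
    (use assms in \<open>auto simp: qsingular_chain_def\<close>)

lemma qchain_cross_0 [simp]: "qchain_cross p q 0 d = 0" "qchain_cross p q c 0 = 0"
  by (simp_all add: qchain_cross_def)

text \<open>By the Leibniz rule the boundary is the sum of a chain in
  \<open>A \<times> topspace Y\<close> and one in \<open>topspace X \<times> B\<close>, so each of
  its simplices lies in one of the two parts of \<open>prod_pair\<close>.\<close>

theorem qrelcycle_cross:
  assumes c: "qrelcycle p X A c" and d: "qrelcycle q Y B d"
  shows "qrelcycle (p + q) (prod_topology X Y) (prod_pair X A Y B) (qchain_cross p q c d)"
  unfolding qrelcycle_def
proof
  let ?P = "subtopology (prod_topology X Y) (prod_pair X A Y B)"
  have cX: "qsingular_chain p X c" and cA: "qsingular_chain (p - 1) (subtopology X A) (qchain_boundary p c)"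
    and dY: "qsingular_chain q Y d" and dB: "qsingular_chain (q - 1) (subtopology Y B) (qchain_boundary q d)"
    using c d by (auto simp: qrelcycle_def)
  show "qsingular_chain (p + q) (prod_topology X Y) (qchain_cross p q c d)"
    using cX dY by (rule qsingular_chain_cross)
  \<comment> \<open>For \<open>p = 0\<close> the degrees \<open>p - 1 + q\<close> and
    \<open>p + q - 1\<close> need not agree, but then the chain is 0.\<close>
  have "qsingular_chain (p + q - 1) ?P (qchain_cross (p - 1) q (qchain_boundary p c) d)"
  proof (cases "p = 0")
    case True
    then show ?thesis by (simp add: qchain_boundary_def)
  next
    case False
    have "qsingular_chain (p - 1 + q) (prod_topology (subtopology X A) Y) (qchain_cross (p - 1) q (qchain_boundary p c) d)"
      using cA dY by (rule qsingular_chain_cross)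
    then show ?thesis
      using False qsingular_chain_mono[of _ "prod_topology X Y" "A \<times> topspace Y" _ "prod_pair X A Y B"]
      by (simp add: prod_topology_subtopology prod_pair_def)
  qed
  moreover have "qsingular_chain (p + q - 1) ?P (qchain_cross p (q - 1) c (qchain_boundary q d))"
  proof (cases "q = 0")
    case True
    then show ?thesis by (simp add: qchain_boundary_def)
  next
    case False
    have "qsingular_chain (p + (q - 1)) (prod_topology X (subtopology Y B)) (qchain_cross p (q - 1) c (qchain_boundary q d))"
      using cX dB by (rule qsingular_chain_cross)
    then show ?thesis
      using False qsingular_chain_mono[of _ "prod_topology X Y" "topspace X \<times> B" _ "prod_pair X A Y B"]
      by (simp add: prod_topology_subtopology prod_pair_def)
  qed
  ultimately show "qsingular_chain (p + q - 1) ?P (qchain_boundary (p + q) (qchain_cross p q c d))"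
    unfolding qchain_boundary_cross by (intro qsingular_chain_add qsingular_chain_qscale)
qed

section \<open>Rational versus integral chains\<close>

abbreviation rat_chain :: "('a \<Rightarrow>\<^sub>0 int) \<Rightarrow> ('a \<Rightarrow>\<^sub>0 rat)"
  where "rat_chain \<equiv> Poly_Mapping.map rat_of_int"

lemma lookup_rat_chain [simp]: "Poly_Mapping.lookup (rat_chain c) x = rat_of_int (Poly_Mapping.lookup c x)"
  by (simp add: Poly_Mapping.map.rep_eq when_def)

lemma keys_rat_chain [simp]: "Poly_Mapping.keys (rat_chain c) = Poly_Mapping.keys c"
  by (auto simp: in_keys_iff)

lemma rat_chain_diff: "rat_chain (c - d) = rat_chain c - rat_chain d"
  by (rule poly_mapping_eqI) (simp add: lookup_minus)

lemma rat_chain_frag_extend: "rat_chain (frag_extend b c) = qextend (\<lambda>\<sigma>. rat_chain (b \<sigma>)) (rat_chain c)"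
  by (rule poly_mapping_eqI)
    (simp add: lookup_qextend[of "Poly_Mapping.keys c"] frag_extend_def lookup_sum)

lemma rat_chain_boundary: "rat_chain (chain_boundary p c) = qchain_boundary p (rat_chain c)"
proof -
  have "rat_chain (\<Sum>k\<le>p. frag_cmul ((-1) ^ k) (frag_of (singular_face p k \<sigma>)))
      = (\<Sum>k\<le>p. Poly_Mapping.single (singular_face p k \<sigma>) ((-1) ^ k))" for \<sigma> :: "(nat \<Rightarrow> real) \<Rightarrow> 'a"
    by (rule poly_mapping_eqI)
      (auto simp: lookup_sum lookup_single when_def if_distrib cong: if_cong intro!: sum.cong simp del: sum.atMost_Suc)
  then show ?thesis
    by (simp add: chain_boundary_def qchain_boundary_def rat_chain_frag_extend) (auto intro: poly_mapping_eqI)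
qed

lemma rat_chain_map: "rat_chain (chain_map p g c) = qchain_map p g (rat_chain c)"
proof -
  have "rat_chain (frag_of \<sigma>) = Poly_Mapping.single \<sigma> 1" for \<sigma> :: "(nat \<Rightarrow> real) \<Rightarrow> 'b"
    by (rule poly_mapping_eqI) (simp add: lookup_single when_def)
  then show ?thesis by (simp add: chain_map_def qchain_map_def rat_chain_frag_extend)
qed

lemma qsingular_chain_rat_chain [simp]: "qsingular_chain p X (rat_chain c) \<longleftrightarrow> singular_chain p X c"
  by (simp add: qsingular_chain_def singular_chain_def)

lemma qrelcycle_rat_chain [simp]: "qrelcycle p X A (rat_chain c) \<longleftrightarrow> singular_relcycle p X A c"
  unfolding qrelcycle_def singular_relcycle rat_chain_boundary[symmetric] qsingular_chain_rat_chain by simp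

lemma qrelboundary_rat_chain:
  assumes "singular_relboundary p X A c"
  shows "qrelboundary p X A (rat_chain c)"
proof -
  obtain d e where d: "singular_chain (Suc p) X d" and e: "singular_chain p (subtopology X A) e"
    and de: "chain_boundary (Suc p) d = c + e"
    using assms unfolding singular_relboundary_alt by blast
  have "qchain_boundary (Suc p) (rat_chain d) - rat_chain c = rat_chain e"
    unfolding rat_chain_boundary[symmetric] rat_chain_diff[symmetric] de by simp
  then show ?thesis unfolding qrelboundary_def using d e by (metis qsingular_chain_rat_chain)
qed

text \<open>A chain has finite support, so the product of the denominators of its coefficients will
  do.\<close>

lemma clear_denominators:
  fixes c :: "'a \<Rightarrow>\<^sub>0 rat"
  obtains N c' where "N \<noteq> 0" "rat_chain c' = qscale N c"
proof -
  have ex: "\<exists>N::int. N \<noteq> 0 \<and> (\<forall>x\<in>K. of_int N * Poly_Mapping.lookup c x \<in> \<int>)" if "finite K" for K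
    using that
  proof induction
    case empty
    then show ?case by (intro exI[of _ 1]) simp
  next
    case (insert x K)
    then obtain N :: int where N: "N \<noteq> 0" "\<forall>x\<in>K. of_int N * Poly_Mapping.lookup c x \<in> \<int>" by blast
    obtain a b :: int where ab: "Poly_Mapping.lookup c x = of_int a / of_int b" "b \<noteq> 0"
      by (metis Fract_of_int_quotient Rat_cases less_irrefl)
    have "of_int (N * b) * Poly_Mapping.lookup c x = rat_of_int (N * a)" using ab by simp
    moreover have "of_int (N * b) * Poly_Mapping.lookup c y \<in> \<int>" if "y \<in> K" for y
    proof -
      have "of_int (N * b) * Poly_Mapping.lookup c y = of_int b * (of_int N * Poly_Mapping.lookup c y)" by simp
      then show ?thesis using N(2) that by (metis Ints_mult Ints_of_int)
    qed
    ultimately show ?case using N(1) ab(2)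
      by (intro exI[of _ "N * b"]) (auto simp: simp del: of_int_mult)
  qed
  obtain N :: int where N: "N \<noteq> 0" "\<And>x. x \<in> Poly_Mapping.keys c \<Longrightarrow> of_int N * Poly_Mapping.lookup c x \<in> \<int>"
    using ex[of "Poly_Mapping.keys c"] by auto
  \<comment> \<open>The scaled coefficients are integers, so the floor is exact and serves only to
    convert the type.\<close>
  have "rat_chain (Poly_Mapping.map (\<lambda>r. \<lfloor>of_int N * r\<rfloor>) c) = qscale (of_int N) c"
  proof (rule poly_mapping_eqI)
    fix x
    show "Poly_Mapping.lookup (rat_chain (Poly_Mapping.map (\<lambda>r. \<lfloor>of_int N * r\<rfloor>) c)) x = Poly_Mapping.lookup (qscale (of_int N) c) x"
    proof (cases "x \<in> Poly_Mapping.keys c")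
      case True
      then have "of_int \<lfloor>of_int N * Poly_Mapping.lookup c x\<rfloor> = of_int N * Poly_Mapping.lookup c x"
        using N(2) of_int_floor by blast
      moreover have "Poly_Mapping.lookup (Poly_Mapping.map (\<lambda>r. \<lfloor>of_int N * r\<rfloor>) c) x = \<lfloor>of_int N * Poly_Mapping.lookup c x\<rfloor>"
        using True by (simp add: Poly_Mapping.map.rep_eq when_def in_keys_iff)
      ultimately show ?thesis by (simp only: lookup_rat_chain lookup_qscale)
    next
      case False
      then show ?thesis by (simp add: Poly_Mapping.map.rep_eq when_def in_keys_iff)
    qed
  qed
  then show ?thesis using that[of "of_int N"] N(1) by simp
qed

lemma qrelcycle_qscale: "qrelcycle p X A c \<Longrightarrow> qrelcycle p X A (qscale r c)"
  by (simp add: qrelcycle_def qchain_boundary_qscale qsingular_chain_qscale)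

lemma qrelboundary_qscale: "qrelboundary p X A c \<Longrightarrow> qrelboundary p X A (qscale r c)"
  unfolding qrelboundary_def
  by (metis qchain_boundary_qscale qscale_diff qsingular_chain_qscale)

lemma qrelcycle_qscale_iff:
  assumes "r \<noteq> 0" shows "qrelcycle p X A (qscale r c) \<longleftrightarrow> qrelcycle p X A c"
  using qrelcycle_qscale[of p X A "qscale r c" "1 / r"] qrelcycle_qscale[of p X A c r] assms by auto

lemma qrelboundary_qscale_iff:
  assumes "r \<noteq> 0" shows "qrelboundary p X A (qscale r c) \<longleftrightarrow> qrelboundary p X A c"
  using qrelboundary_qscale[of p X A "qscale r c" "1 / r"] qrelboundary_qscale[of p X A c r] assms by auto

text \<open>Over the rationals, scaling by a nonzero factor is reversible on relative cycles and
  boundaries. Integral homotopy invariance is applied to a multiple of \<open>c\<close>, and the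
  factor is divided out again.\<close>

lemma homotopic_imp_qhomologous:
  assumes hom: "homotopic_pair_maps X A Y B f g" and c: "qrelcycle p X A c"
  shows "qrelcycle p Y B (qchain_map p f c)" and "qrelboundary p Y B (qchain_map p f c - qchain_map p g c)"
proof -
  obtain N c' where N: "N \<noteq> 0" "rat_chain c' = qscale N c" using clear_denominators .
  have c': "singular_relcycle p X A c'"
    using c N by (simp flip: qrelcycle_rat_chain add: qrelcycle_qscale)
  have f: "continuous_map X Y f" "f \<in> A \<rightarrow> B"
    using homotopic_with_imp_continuous_maps[OF hom[unfolded homotopic_pair_maps_def]]
      homotopic_with_imp_property[OF hom[unfolded homotopic_pair_maps_def]] by simp_all
  have "qrelcycle p Y B (rat_chain (chain_map p f c'))"
    using singular_relcycle_chain_map[OF c' f] by simp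
  then show "qrelcycle p Y B (qchain_map p f c)"
    using N by (simp add: rat_chain_map qchain_map_qscale qrelcycle_qscale_iff)
  have "singular_relboundary p Y B (chain_map p f c' - chain_map p g c')"
    using homotopic_imp_homologous_rel_chain_maps[OF hom[unfolded homotopic_pair_maps_def] c']
    unfolding homologous_rel_def .
  then have "qrelboundary p Y B (qscale N (qchain_map p f c - qchain_map p g c))"
    using qrelboundary_rat_chain N by (metis rat_chain_diff rat_chain_map qchain_map_qscale qscale_diff)
  then show "qrelboundary p Y B (qchain_map p f c - qchain_map p g c)"
    using N(1) by (simp add: qrelboundary_qscale_iff)
qed

lemma qsingular_chain_qchain_map:
  assumes "qsingular_chain p X c" and "continuous_map X Y g"
  shows "qsingular_chain p Y (qchain_map p g c)"
  unfolding qchain_map_def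
  by (intro qsingular_chain_qextend qsingular_chain_single singular_simplex_simplex_map[OF _ assms(2)])
    (use assms(1) in \<open>auto simp: qsingular_chain_def\<close>)

section \<open>Trajectories\<close>

lemma qrelboundary_0 [simp]: "qrelboundary p X A 0"
  unfolding qrelboundary_def by (intro exI[of _ 0]) (simp add: qchain_boundary_def)

lemma qrelboundary_diff:
  assumes "qrelboundary p X A c" and "qrelboundary p X A d"
  shows "qrelboundary p X A (c - d)"
proof -
  obtain x y where x: "qsingular_chain (Suc p) X x" "qsingular_chain p (subtopology X A) (qchain_boundary (Suc p) x - c)"
    and y: "qsingular_chain (Suc p) X y" "qsingular_chain p (subtopology X A) (qchain_boundary (Suc p) y - d)"
    using assms unfolding qrelboundary_def by blast
  have "qchain_boundary (Suc p) (x - y) - (c - d) = (qchain_boundary (Suc p) x - c) - (qchain_boundary (Suc p) y - d)"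
    by (simp add: qchain_boundary_diff)
  then show ?thesis
    unfolding qrelboundary_def using qsingular_chain_diff[OF x(1) y(1)] qsingular_chain_diff[OF x(2) y(2)] by metis
qed

lemma mem_qhomology_class: "e \<in> qhomology_class p X A c \<longleftrightarrow> qrelboundary p X A (e - c)"
  unfolding qhomology_class_def r_coset_def qrelcycle_group_def
  by (auto intro: exI[of _ "e - c"])

lemma carrier_qhomologyE:
  assumes "\<alpha> \<in> carrier (qhomology p X A)"
  obtains c where "qrelcycle p X A c" "\<alpha> = qhomology_class p X A c"
  using assms
  by (auto simp: qhomology_def FactGroup_def RCOSETS_def qhomology_class_def qrelcycle_group_def)

lemma one_qhomology: "\<one>\<^bsub>qhomology p X A\<^esub> = Collect (qrelboundary p X A)"
  by (simp add: qhomology_def FactGroup_def)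

text \<open>One step of the system on chains, with three invariants: the cycle condition, membership
  in the class computed with \<open>f\<close>, and a support controlled by the perturbed map
  \<open>g\<close>. Homotopy invariance reconciles the last two.\<close>

lemma qhom_induced_cross_step:
  assumes hom: "homotopic_pair_maps (prod_topology X U) (prod_pair X A U U') M D g f"
    and c: "qrelcycle k X A c" "c \<in> \<alpha>" "qsingular_chain k (subtopology X R) c"
    and d: "qrelcycle l U U' d" "d \<in> \<beta>"
  defines "e \<equiv> qchain_map (k + l) g (qchain_cross k l c d)"
  shows "qrelcycle (k + l) M D e"
    and "e \<in> qhom_induced (k + l) M D f (qcross k X A l U U' \<alpha> \<beta>)"
    and "qsingular_chain (k + l) (subtopology M (g ` (R \<times> topspace U))) e"
proof -
  note cyc = qrelcycle_cross[OF c(1) d(1)]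
  show "qrelcycle (k + l) M D e"
    unfolding e_def by (rule homotopic_imp_qhomologous(1)[OF hom cyc])
  have "e \<in> qhomology_class (k + l) M D (qchain_map (k + l) f (qchain_cross k l c d))"
    unfolding e_def mem_qhomology_class by (rule homotopic_imp_qhomologous(2)[OF hom cyc])
  moreover have "qchain_cross k l c d \<in> qcross k X A l U U' \<alpha> \<beta>"
    unfolding qcross_def using c(2) d(2) by (force simp: mem_qhomology_class)
  ultimately show "e \<in> qhom_induced (k + l) M D f (qcross k X A l U U' \<alpha> \<beta>)"
    unfolding qhom_induced_def by blast
  have g: "continuous_map (prod_topology X U) M g"
    using homotopic_with_imp_continuous_maps[OF hom[unfolded homotopic_pair_maps_def]] by blast
  have "continuous_map (subtopology (prod_topology X U) (R \<times> topspace U)) (subtopology M (g ` (R \<times> topspace U))) g"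
    by (rule continuous_map_into_subtopology[OF continuous_map_from_subtopology[OF g]]) auto
  moreover have "qsingular_chain k (subtopology X R) c \<Longrightarrow>
      qsingular_chain (k + l) (subtopology (prod_topology X U) (R \<times> topspace U)) (qchain_cross k l c d)"
    unfolding prod_topology_subtopology[symmetric] using d(1)
    by (intro qsingular_chain_cross) (auto simp: qrelcycle_def)
  ultimately show "qsingular_chain (k + l) (subtopology M (g ` (R \<times> topspace U))) e"
    unfolding e_def using c(3) by (intro qsingular_chain_qchain_map)
qed

primrec reachable :: "'u set \<Rightarrow> (nat \<Rightarrow> 'm \<times> 'u \<Rightarrow> 'm) \<Rightarrow> 'm set \<Rightarrow> nat \<Rightarrow> 'm set" where
  "reachable V F L 0 = L"
| "reachable V F L (Suc k) = F k ` (reachable V F L k \<times> V)"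

lemma reachable_imp_trajectory:
  assumes "y \<in> reachable V F L k"
  shows "\<exists>x u. x 0 \<in> L \<and> (\<forall>i<k. u i \<in> V \<and> x (Suc i) = F i (x i, u i)) \<and> x k = y"
  using assms
proof (induction k arbitrary: y)
  case 0
  then show ?case by (intro exI[of _ "\<lambda>_. y"]) auto
next
  case (Suc k)
  then obtain z w where z: "z \<in> reachable V F L k" "w \<in> V" "y = F k (z, w)" by auto
  obtain x u where xu: "x 0 \<in> L" "\<forall>i<k. u i \<in> V \<and> x (Suc i) = F i (x i, u i)" "x k = z"
    using Suc.IH[OF z(1)] by blast
  let ?x = "x(Suc k := y)" and ?u = "u(k := w)"
  have "?x 0 \<in> L \<and> (\<forall>i<Suc k. ?u i \<in> V \<and> ?x (Suc i) = F i (?x i, ?u i)) \<and> ?x (Suc k) = y"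
    using xu z by (auto simp: less_Suc_eq)
  then show ?case by blast
qed

text \<open>Scaling to an integral chain keeps the cycle condition and the avoidance of
  \<open>y\<close>, and the factor can be removed from the resulting boundary.\<close>

lemma qrelboundary_of_qrelcycle_avoiding_point:
  assumes M: "manifold_with_boundary n M" "compact_space M" "connected_space M" "D = manifold_boundary n M"
    and e: "qrelcycle n M D e" and y: "y \<in> topspace M" "qsingular_chain n (subtopology M (topspace M - {y})) e"
  shows "qrelboundary n M D e"
proof -
  obtain N e' where N: "N \<noteq> 0" "rat_chain e' = qscale N e" using clear_denominators .
  have "singular_relcycle n M D e'"
    using qrelcycle_qscale[OF e, of N] unfolding N(2)[symmetric] by simp
  moreover have "singular_chain n (subtopology M (topspace M - {y})) e'"
    using qsingular_chain_qscale[OF y(2), of N] unfolding N(2)[symmetric] by simp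
  ultimately have "singular_relboundary n M D e'"
    using relboundary_of_relcycle_avoiding_point[OF M _ y(1)] by blast
  then have "qrelboundary n M D (qscale N e)" using qrelboundary_rat_chain N(2) by metis
  then show ?thesis using N(1) by (simp add: qrelboundary_qscale_iff)
qed

theorem theorem7p2:
  fixes M :: "'m topology" and U :: "'u topology" and f :: "'m \<times> 'u \<Rightarrow> 'm"
    and L L' dM :: "'m set" and U' :: "'u set" and n r p :: nat and s :: "nat \<Rightarrow> nat"
    and a :: "nat \<Rightarrow> 'm qchain set" and v :: "nat \<Rightarrow> 'u qchain set"
  assumes "manifold_with_boundary n M" and "compact_space M" and "connected_space M"
    and "orientable_manifold n M"
    and "dM = manifold_boundary n M"
    and "continuous_map (prod_topology M U) M f"
    and "f \<in> dM \<times> topspace U \<rightarrow> dM"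
    and "U' = boundary_inputs n M U f"
    and "L \<subseteq> topspace M" and "L' = L \<inter> dM"
    and "a 0 \<in> carrier (qhomology p (subtopology M L) L')"
    and "\<And>i. i \<le> r \<Longrightarrow> v i \<in> carrier (qhomology (s i) U U')"
    and "a 1 = qhom_induced (p + s 0) M dM f
           (qcross p (subtopology M L) L' (s 0) U U' (a 0) (v 0))"
    and "\<And>i. 1 \<le> i \<Longrightarrow> i \<le> r \<Longrightarrow>
           a (Suc i) = qhom_induced (p + (\<Sum>j\<le>i. s j)) M dM f
             (qcross (p + (\<Sum>j<i. s j)) M dM (s i) U U' (a i) (v i))"
    and "p + (\<Sum>j\<le>r. s j) = n"
    and "a (Suc r) \<in> carrier (qhomology n M dM) - {\<one>\<^bsub>qhomology n M dM\<^esub>}"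
  shows "strongly_robustly_controllable n M U f L"
proof -
  let ?P = "\<lambda>i. p + (\<Sum>j<i. s j)"
  \<comment> \<open>\<open>?P i\<close> is the degree of \<open>a i\<close>; the identity reconciles
    the sums over \<open>j \<le> i\<close> with those over \<open>j < i\<close>.\<close>
  have P: "p + (\<Sum>j\<le>i. s j) = ?P (Suc i)" "?P (Suc i) = ?P i + s i" for i
    by (simp_all add: lessThan_Suc_atMost[symmetric])
  obtain c0 where c0: "qrelcycle p (subtopology M L) L' c0" "a 0 = qhomology_class p (subtopology M L) L' c0"
    using carrier_qhomologyE[OF assms(11)] .
  have "\<exists>d. qrelcycle (s i) U U' d \<and> d \<in> v i" if "i \<le> r" for i
    using carrier_qhomologyE[OF assms(12)[OF that]] by (metis diff_self mem_qhomology_class qrelboundary_0)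
  then obtain d where d: "\<And>i. i \<le> r \<Longrightarrow> qrelcycle (s i) U U' (d i)" "\<And>i. i \<le> r \<Longrightarrow> d i \<in> v i"
    by metis
  have "\<exists>x u. x 0 \<in> L \<and> (\<forall>i\<le>r. u i \<in> topspace U \<and> x (Suc i) = F i (x i, u i)) \<and> x (Suc r) = y"
    if F0: "homotopic_pair_maps (prod_topology (subtopology M L) U) (prod_pair (subtopology M L) L' U U') M dM (F 0) f"
      and F: "\<And>i. i \<in> {1..r} \<Longrightarrow> homotopic_pair_maps (prod_topology M U) (prod_pair M dM U U') M dM (F i) f"
      and y: "y \<in> topspace M" for F :: "nat \<Rightarrow> 'm \<times> 'u \<Rightarrow> 'm" and y
  proof -
    let ?R = "reachable (topspace U) F L"
    \<comment> \<open>The invariants are stated from index 1 on, because the first step starts from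
      the pair over \<open>L\<close> and all later ones from \<open>M\<close> and
      \<open>dM\<close>.\<close>
    have step: "\<exists>e. qrelcycle (?P (Suc i)) M dM e \<and> e \<in> a (Suc i) \<and> qsingular_chain (?P (Suc i)) (subtopology M (?R (Suc i))) e"
      if "i \<le> r" for i
      using that
    proof (induction i)
      case 0
      have "subtopology (subtopology M L) L = subtopology M L" by (simp add: subtopology_subtopology)
      then have "qsingular_chain p (subtopology (subtopology M L) L) c0" using c0(1) by (simp add: qrelcycle_def)
      moreover have "c0 \<in> a 0" by (simp add: c0(2) mem_qhomology_class)
      ultimately show ?case
        using qhom_induced_cross_step[OF F0 c0(1) _ _ d(1)[OF 0] d(2)[OF 0]] assms(13) by fastforce
    next
      case (Suc i)
      then obtain e where e: "qrelcycle (?P (Suc i)) M dM e" "e \<in> a (Suc i)"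
        "qsingular_chain (?P (Suc i)) (subtopology M (?R (Suc i))) e" by auto
      have "homotopic_pair_maps (prod_topology M U) (prod_pair M dM U U') M dM (F (Suc i)) f"
        using F Suc.prems by simp
      note st = qhom_induced_cross_step[OF this e d(1)[OF Suc.prems] d(2)[OF Suc.prems], folded P(2)]
      have "a (Suc (Suc i)) = qhom_induced (?P (Suc (Suc i))) M dM f
             (qcross (?P (Suc i)) M dM (s (Suc i)) U U' (a (Suc i)) (v (Suc i)))"
        using assms(14)[of "Suc i"] Suc.prems unfolding P(1) by simp
      then show ?case using st unfolding reachable.simps(2)[of _ _ _ "Suc i"] by metis
    qed
    have "y \<in> ?R (Suc r)"
    proof (rule ccontr)
      assume ny: "y \<notin> ?R (Suc r)"
      obtain e where e: "qrelcycle n M dM e" "e \<in> a (Suc r)" "qsingular_chain n (subtopology M (?R (Suc r))) e"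
        using step[OF order_refl] assms(15) unfolding P(1) by auto
      have "?R (Suc r) \<subseteq> - {y}" using ny by auto
      then have "qsingular_chain n (subtopology M (topspace M \<inter> - {y})) e"
        using qsingular_chain_mono[OF e(3)] subtopology_restrict by metis
      then have eb: "qrelboundary n M dM e"
        by (intro qrelboundary_of_qrelcycle_avoiding_point[OF assms(1,2,3,5) e(1) y]) (simp add: Diff_eq)
      obtain c where c: "a (Suc r) = qhomology_class n M dM c"
        using assms(16) carrier_qhomologyE by (metis DiffD1)
      \<comment> \<open>Since \<open>a (Suc r)\<close> is a single coset, one bounding
        representative \<open>e\<close> forces every other one, and in particular \<open>c\<close>,
        to bound.\<close>
      have "qrelboundary n M dM (e - (e - c))"
        using eb e(2) unfolding c mem_qhomology_class by (rule qrelboundary_diff)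
      then have cb: "qrelboundary n M dM c" by simp
      have iff: "qrelboundary n M dM (x - c) \<longleftrightarrow> qrelboundary n M dM x" for x
      proof
        assume "qrelboundary n M dM (x - c)"
        moreover have "qrelboundary n M dM (- c)" using qrelboundary_diff[OF qrelboundary_0 cb] by simp
        ultimately have "qrelboundary n M dM (x - c - (- c))" by (rule qrelboundary_diff)
        then show "qrelboundary n M dM x" by simp
      qed (rule qrelboundary_diff[OF _ cb])
      have "a (Suc r) = \<one>\<^bsub>qhomology n M dM\<^esub>"
        unfolding c one_qhomology set_eq_iff mem_qhomology_class mem_Collect_eq iff by simp
      then show False using assms(16) by blast
    qed
    then show ?thesis
      using reachable_imp_trajectory[of y "topspace U" F L "Suc r"] by (simp add: less_Suc_eq_le)
  qed
  then show ?thesis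
    unfolding strongly_robustly_controllable_def Let_def assms(5)[symmetric] assms(8)[symmetric] assms(10)[symmetric]
    by (intro exI[of _ r]) blast
qed

end
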